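(* There is an absolute constant $A>0$ (independent of $p$ and $f$) such that the following holds. Let $1<p<\infty$, let $p'=p/(p-1)$, let $f\in L^p([0,1]^2)$ and suppose that $J_p(f)<\infty$ and $I_p(f)<\infty$. Then $f$ is equal a.e. to a continuous function and $$\|f\|_\infty\le A\left[\|f\|_p+\frac{1}{pp'}J_p(f)+\left(\frac{1}{pp'}\right)^2I_p(f)\right].$$
   Context: Functions are real-valued. $L^p([0,1]^2)$ is the class of measurable functions $f$ on $\mathbb{R}^2$ that are 1-periodic in each variable with $\|f\|_p=(\int_{[0,1]^2}|f|^p)^{1/p}<\infty$; $\|f\|_\infty$ is the essential supremum of $|f|$ over $[0,1]^2$. For $h\in\mathbb{R}^2$, $\Delta(h)f(x)=f(x+h)-f(x)$, and the $L^p$-modulus of continuity is $\omega(f;\delta)_p=\sup_{|h|\le\delta}\|\Delta(h)f\|_p$, $0<\delta\le1$. For $s,t\in\mathbb{R}$, $\Delta(s,t)f(x,y)=f(x+s,y+t)-f(x+s,y)-f(x,y+t)+f(x,y)$, and the mixed $L^p$-modulus of continuity is $\omega(f;u,v)_p=\sup_{0\le s\le u,\,0\le t\le v}\|\Delta(s,t)f\|_p$. Set $$J_p(f)=\int_0^1t^{-1/p}\omega(f;t)_p\frac{dt}{t},\qquad I_p(f)=\int_0^1\int_0^1(uv)^{-1/p}\omega(f;u,v)_p\frac{du}{u}\frac{dv}{v}.$$ *)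

theory Defs
  imports "HOL-Analysis.Analysis" "HOL-Probability.Essential_Supremum"
begin

abbreviation unit_square :: "(real \<times> real) set" where
  "unit_square \<equiv> {0..1} \<times> {0..1}"

text \<open>Norms, moduli and integrals take values in \<^typ>\<open>ennreal\<close>, so that infinite values
  are represented as such.  There is no real power on \<^typ>\<open>ennreal\<close>, and \<^const>\<open>enn2real\<close>
  sends \<open>\<infinity>\<close> to 0, hence the case distinction.  Functions are Lebesgue
  measurable, so the integrals over the square are taken with respect to \<^const>\<open>lebesgue\<close>.\<close>

definition Lp_norm :: "real \<Rightarrow> (real \<times> real \<Rightarrow> real) \<Rightarrow> ennreal" where
  "Lp_norm p f =
    (let N = (\<integral>\<^sup>+z\<in>unit_square. ennreal (\<bar>f z\<bar> powr p) \<partial>lebesgue)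
     in if N = \<infinity> then \<infinity> else ennreal (enn2real N powr (1 / p)))"

definition Linf_norm :: "(real \<times> real \<Rightarrow> real) \<Rightarrow> ennreal" where
  "Linf_norm f = esssup (lebesgue_on unit_square) (\<lambda>z. ennreal \<bar>f z\<bar>)"

definition Lp_periodic :: "real \<Rightarrow> (real \<times> real \<Rightarrow> real) set" where
  "Lp_periodic p = {f. f \<in> borel_measurable lebesgue \<and>
     (\<forall>x y. f (x + 1, y) = f (x, y) \<and> f (x, y + 1) = f (x, y)) \<and>
     Lp_norm p f < \<infinity>}"

definition diff :: "real \<times> real \<Rightarrow> (real \<times> real \<Rightarrow> real) \<Rightarrow> real \<times> real \<Rightarrow> real" where
  "diff h f z = f (z + h) - f z"

definition mixed_diff :: "real \<Rightarrow> real \<Rightarrow> (real \<times> real \<Rightarrow> real) \<Rightarrow> real \<times> real \<Rightarrow> real" where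
  "mixed_diff s t f = (\<lambda>(x, y). f (x + s, y + t) - f (x + s, y) - f (x, y + t) + f (x, y))"

definition modulus :: "real \<Rightarrow> (real \<times> real \<Rightarrow> real) \<Rightarrow> real \<Rightarrow> ennreal" where
  "modulus p f \<delta> = (SUP h\<in>{h. norm h \<le> \<delta>}. Lp_norm p (diff h f))"

definition mixed_modulus :: "real \<Rightarrow> (real \<times> real \<Rightarrow> real) \<Rightarrow> real \<Rightarrow> real \<Rightarrow> ennreal" where
  "mixed_modulus p f u v = (SUP (s, t)\<in>{0..u} \<times> {0..v}. Lp_norm p (mixed_diff s t f))"

definition J_int :: "real \<Rightarrow> (real \<times> real \<Rightarrow> real) \<Rightarrow> ennreal" where
  "J_int p f = (\<integral>\<^sup>+t\<in>{0<..1}. ennreal (t powr (- 1 / p)) * modulus p f t * ennreal (1 / t) \<partial>lborel)"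

definition I_int :: "real \<Rightarrow> (real \<times> real \<Rightarrow> real) \<Rightarrow> ennreal" where
  "I_int p f = (\<integral>\<^sup>+v\<in>{0<..1}. (\<integral>\<^sup>+u\<in>{0<..1}.
     ennreal ((u * v) powr (- 1 / p)) * mixed_modulus p f u v * ennreal (1 / u) * ennreal (1 / v)
     \<partial>lborel) \<partial>lborel)"

definition conj_exp :: "real \<Rightarrow> real" where
  "conj_exp p = p / (p - 1)"

end

theory Submission
  imports Defs
begin

text \<open>Write \<open>A\<^sub>h\<close> for the average of a function of one variable over \<open>[x, x + h]\<close> and \<open>A\<^sub>h\<^sub>,\<^sub>g\<close> for
the average of a function of two variables over a rectangle with sides \<open>h\<close> and \<open>g\<close>.  The function
\<open>f\<close> is the \<open>L\<^sup>p\<close> limit of box averages, and these are continuous.  So it is enough to find scales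
\<open>h\<^sub>n \<rightarrow> 0\<close> and \<open>g\<^sub>n \<rightarrow> 0\<close> for which \<open>A f\<close> at the scales \<open>(h\<^sub>n, g\<^sub>n)\<close> converges uniformly, with
a bound for the limit.  Telescoping in each variable separately writes this average as the average at
\<open>(h\<^sub>0, g\<^sub>0)\<close>, which \<open>\<parallel>f\<parallel>\<^sub>p\<close> controls, plus increments in one variable, which the modulus of
continuity controls, plus mixed increments in both variables, which the mixed modulus controls.

A naive choice of dyadic scales loses the factors \<open>1/(pp')\<close>.  They come from two facts together.

First, \<open>A\<^sub>h - A\<^sub>H\<close> with \<open>h < H\<close> has two different estimates.  Writing \<open>w(t)\<close> for
\<open>t\<^sup>-\<^sup>1\<^sup>/\<^sup>p\<close> times the modulus at \<open>t\<close>, its supremum norm is at most a constant times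
\<open>(H/h)\<^sup>1\<^sup>/\<^sup>p w(H)\<close>, by comparing two averages directly (\<open>increment_powr_le_coarse\<close>), and also at
most a constant times \<open>(H/h)\<close> to the power \<open>1/p'\<close> times \<open>w(h)\<close>, because \<open>A\<^sub>h f\<close> has the derivative
\<open>(f(x + h) - f(x))/h\<close> (\<open>increment_powr_le_fine\<close>).  Hence consecutive scales may have the ratio
\<open>K\<close> equal to 2 to the power \<open>max p p'\<close> at the cost of an absolute constant, and \<open>ln K\<close> is comparable
with \<open>pp'\<close> (\<open>scales_exist\<close>).

Second, averaging over \<open>u \<in> (1/K, 1]\<close> with respect to \<open>du/u\<close> shows that for some \<open>u\<close> the sum of
\<open>w(u/K\<^sup>j)\<close> over \<open>j\<close> is at most \<open>1/ln K\<close> times the integral of \<open>w(t)/t\<close> over \<open>(0, 1]\<close>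
(\<open>scale_selection\<close>).  This gives one factor \<open>1/(pp')\<close> for each variable in which an increment
is taken; one grid that suits all three sums is found by choosing the second coordinate first and then
the first one (\<open>grid_selection\<close>).

The two-variable estimates follow from those in one variable without further work, since the latter
bound the \<open>p\<close>-th power of a functional by an integral of \<open>p\<close>-th powers of differences: such bounds
can be applied in one variable after the other, by Fubini's theorem (\<open>tensor_powr_le\<close>).
The summability of \<open>w(u/K\<^sup>j)\<close> forces the modulus of continuity to tend to zero, which yields both the
continuity of box averages and their convergence to \<open>f\<close>.\<close>

section \<open>Power means\<close>

text \<open>Up to the factor \<open>p\<close> this is Young's inequality; it says that \<open>t \<mapsto> t\<^sup>p\<close> lies above its tangent at \<open>a\<close>.\<close>

lemma powr_tangent:
  fixes x a p :: real
  assumes "p > 1" "x \<ge> 0" "a \<ge> 0"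
  shows "p * x * a powr (p - 1) \<le> x powr p + (p - 1) * a powr p"
proof -
  have "x * a powr (p - 1) \<le> x powr p / p + (a powr (p - 1)) powr (p / (p - 1)) / (p / (p - 1))"
    by (rule Youngs_inequality) (use assms in \<open>auto simp: field_simps\<close>)
  also have "(a powr (p - 1)) powr (p / (p - 1)) = a powr p"
    using assms by (simp add: powr_powr)
  finally show ?thesis
    using assms by (simp add: field_simps)
qed

lemma powr_add_le:
  fixes a b p :: real
  assumes "p > 1"
  shows "\<bar>a + b\<bar> powr p \<le> 2 powr (p - 1) * (\<bar>a\<bar> powr p + \<bar>b\<bar> powr p)"
proof -
  define m where "m = (\<bar>a\<bar> + \<bar>b\<bar>) / 2"
  have "m \<ge> 0" by (simp add: m_def)
  have "p * \<bar>a\<bar> * m powr (p - 1) + p * \<bar>b\<bar> * m powr (p - 1)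
      \<le> \<bar>a\<bar> powr p + \<bar>b\<bar> powr p + 2 * ((p - 1) * m powr p)"
    using powr_tangent[OF assms _ \<open>m \<ge> 0\<close>, of "\<bar>a\<bar>"] powr_tangent[OF assms _ \<open>m \<ge> 0\<close>, of "\<bar>b\<bar>"]
    by simp
  also have "p * \<bar>a\<bar> * m powr (p - 1) + p * \<bar>b\<bar> * m powr (p - 1) = 2 * p * (m * m powr (p - 1))"
    by (simp add: m_def field_simps)
  also have "m * m powr (p - 1) = m powr p"
    using \<open>m \<ge> 0\<close> by (cases "m = 0") (use assms in \<open>auto simp: powr_diff\<close>)
  finally have *: "2 * m powr p \<le> \<bar>a\<bar> powr p + \<bar>b\<bar> powr p" by (simp add: algebra_simps)
  have "\<bar>a + b\<bar> \<le> 2 * m" using abs_triangle_ineq[of a b] by (simp add: m_def)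
  then have "\<bar>a + b\<bar> powr p \<le> (2 * m) powr p"
    using assms by (intro powr_mono2) (auto simp: m_def)
  also have "\<dots> = 2 powr (p - 1) * (2 * m powr p)"
    using \<open>m \<ge> 0\<close> by (simp add: powr_mult powr_diff)
  also have "\<dots> \<le> 2 powr (p - 1) * (\<bar>a\<bar> powr p + \<bar>b\<bar> powr p)"
    using * by (intro mult_left_mono) auto
  finally show ?thesis .
qed

lemma abs_le_one_add_powr:
  fixes t :: real
  assumes "p > 1"
  shows "\<bar>t\<bar> \<le> 1 + \<bar>t\<bar> powr p"
proof (cases "\<bar>t\<bar> \<le> 1")
  case False
  then have "\<bar>t\<bar> powr 1 \<le> \<bar>t\<bar> powr p" using assms by (intro powr_mono) auto
  then show ?thesis using False by simp
qed (use powr_ge_zero[of "\<bar>t\<bar>" p] in linarith)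

lemma set_integrable_of_powr:
  fixes g :: "'a \<Rightarrow> real"
  assumes p: "p > 1" and S [measurable]: "S \<in> sets M" and m: "emeasure M S < \<infinity>"
    and g [measurable]: "g \<in> borel_measurable M"
    and fin: "(\<integral>\<^sup>+x\<in>S. ennreal (\<bar>g x\<bar> powr p) \<partial>M) < \<infinity>"
  shows "integrable M (\<lambda>x. indicator S x * g x)"
proof -
  have iS: "integrable M (indicator S :: _ \<Rightarrow> real)"
    using m by (simp add: integrable_indicator_iff)
  have up: "integrable M (\<lambda>x. \<bar>indicator S x * g x\<bar> powr p)"
  proof (rule integrableI_nonneg)
    have "(\<integral>\<^sup>+x. ennreal (\<bar>indicator S x * g x\<bar> powr p) \<partial>M) = (\<integral>\<^sup>+x\<in>S. ennreal (\<bar>g x\<bar> powr p) \<partial>M)"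
      by (intro nn_integral_cong) (auto simp: indicator_def)
    then show "(\<integral>\<^sup>+x. ennreal (\<bar>indicator S x * g x\<bar> powr p) \<partial>M) < \<infinity>" using fin by simp
  qed auto
  show ?thesis
  proof (rule Bochner_Integration.integrable_bound[OF Bochner_Integration.integrable_add[OF iS up]])
    show "AE x in M. norm (indicator S x * g x) \<le> norm (indicator S x + \<bar>indicator S x * g x\<bar> powr p :: real)"
      using abs_le_one_add_powr[OF p] by (intro AE_I2) (auto simp: indicator_def p)
  qed simp
qed

text \<open>Jensen's inequality for the normalised measure on \<open>S\<close>.  If the right-hand side is finite then \<open>g\<close> is
integrable on \<open>S\<close>, since \<open>\<bar>t\<bar> \<le> 1 + \<bar>t\<bar>\<^sup>p\<close>, and otherwise there is nothing to prove.\<close>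

lemma set_integral_powr_le:
  fixes g :: "'a \<Rightarrow> real"
  assumes p: "p > 1" and S [measurable]: "S \<in> sets M"
    and m: "emeasure M S = ennreal m" "m > 0"
    and g [measurable]: "g \<in> borel_measurable M"
  shows "ennreal (\<bar>\<integral>x. indicator S x * g x \<partial>M\<bar> powr p)
    \<le> ennreal (m powr (p - 1)) * (\<integral>\<^sup>+x\<in>S. ennreal (\<bar>g x\<bar> powr p) \<partial>M)"
proof (cases "(\<integral>\<^sup>+x\<in>S. ennreal (\<bar>g x\<bar> powr p) \<partial>M) = \<infinity>")
  case True
  then show ?thesis using m by (simp add: ennreal_mult_top)
next
  case False
  define u where "u = (\<lambda>x. indicator S x * g x)"
  have eq: "(\<integral>\<^sup>+x\<in>S. ennreal (\<bar>g x\<bar> powr p) \<partial>M) = (\<integral>\<^sup>+x. ennreal (\<bar>u x\<bar> powr p) \<partial>M)"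
    by (intro nn_integral_cong) (auto simp: u_def indicator_def)
  have um [measurable]: "u \<in> borel_measurable M" by (simp add: u_def)
  have iS: "integrable M (indicator S :: _ \<Rightarrow> real)"
    using m by (simp add: integrable_indicator_iff)
  have IS: "(\<integral>x. indicator S x \<partial>M) = m"
    using m by (simp add: measure_def)
  have up: "integrable M (\<lambda>x. \<bar>u x\<bar> powr p)"
    using False unfolding eq by (intro integrableI_nonneg) (auto simp: top.not_eq_extremum)
  have ui: "integrable M (\<lambda>x. \<bar>u x\<bar>)"
    unfolding u_def using False m
    by (intro integrable_abs set_integrable_of_powr[OF p]) (auto simp: less_top)
  \<comment> \<open>The tangent at the mean value \<open>A\<close> of \<open>\<bar>u\<bar>\<close> has the same integral over \<open>S\<close> as the constant \<open>A\<^sup>p\<close>.\<close>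
  define A where "A = (\<integral>x. \<bar>u x\<bar> \<partial>M) / m"
  have A0: "A \<ge> 0" using m by (simp add: A_def)
  have "(\<integral>x. p * \<bar>u x\<bar> * A powr (p - 1) \<partial>M)
      \<le> (\<integral>x. \<bar>u x\<bar> powr p + (p - 1) * A powr p * indicator S x \<partial>M)"
  proof (rule integral_mono)
    fix x
    show "p * \<bar>u x\<bar> * A powr (p - 1) \<le> \<bar>u x\<bar> powr p + (p - 1) * A powr p * indicator S x"
      using powr_tangent[OF p, of "\<bar>u x\<bar>" A] A0 p by (auto simp: u_def indicator_def)
  qed (use ui up iS in auto)
  also have "\<dots> = (\<integral>x. \<bar>u x\<bar> powr p \<partial>M) + (p - 1) * A powr p * m"
    using up iS IS by simp
  also have "(\<integral>x. p * \<bar>u x\<bar> * A powr (p - 1) \<partial>M) = p * (A * m) * A powr (p - 1)"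
    using m by (simp add: A_def)
  finally have "p * m * (A * A powr (p - 1)) \<le> (\<integral>x. \<bar>u x\<bar> powr p \<partial>M) + (p - 1) * A powr p * m"
    by (simp add: algebra_simps)
  moreover have "A * A powr (p - 1) = A powr p"
    using A0 p by (cases "A = 0") (auto simp: powr_diff)
  ultimately have *: "m * A powr p \<le> (\<integral>x. \<bar>u x\<bar> powr p \<partial>M)"
    by (simp add: algebra_simps)
  have "\<bar>\<integral>x. u x \<partial>M\<bar> \<le> (\<integral>x. \<bar>u x\<bar> \<partial>M)" by (rule integral_abs_bound)
  then have "\<bar>\<integral>x. u x \<partial>M\<bar> \<le> m * A" using m by (simp add: A_def)
  then have "\<bar>\<integral>x. u x \<partial>M\<bar> powr p \<le> (m * A) powr p"
    using p by (intro powr_mono2) auto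
  also have "\<dots> = m powr (p - 1) * (m * A powr p)"
    using m A0 by (simp add: powr_mult powr_diff)
  also have "\<dots> \<le> m powr (p - 1) * (\<integral>x. \<bar>u x\<bar> powr p \<partial>M)"
    using * by (intro mult_left_mono) auto
  finally have "ennreal (\<bar>\<integral>x. u x \<partial>M\<bar> powr p) \<le> ennreal (m powr (p - 1)) * ennreal (\<integral>x. \<bar>u x\<bar> powr p \<partial>M)"
    by (subst ennreal_mult[symmetric]) (auto intro!: ennreal_leI)
  moreover have "(\<integral>\<^sup>+x. ennreal (\<bar>u x\<bar> powr p) \<partial>M) = ennreal (\<integral>x. \<bar>u x\<bar> powr p \<partial>M)"
    by (rule nn_integral_eq_integral[OF up]) simp
  ultimately show ?thesis unfolding eq by (simp add: u_def)
qed

section \<open>Averages of functions of one variable\<close>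

lemma set_nn_integral_scale:
  fixes F :: "real \<Rightarrow> ennreal"
  assumes [measurable]: "F \<in> borel_measurable borel" and h: "h > 0"
  shows "(\<integral>\<^sup>+s\<in>{0..1}. F (h * s) \<partial>lborel) = ennreal (1 / h) * (\<integral>\<^sup>+t\<in>{0..h}. F t \<partial>lborel)"
proof -
  have "(\<integral>\<^sup>+t\<in>{0..h}. F t \<partial>lborel) = ennreal h * (\<integral>\<^sup>+s. F (h * s) * indicator {0..h} (h * s) \<partial>lborel)"
    using nn_integral_real_affine[of "\<lambda>t. F t * indicator {0..h} t" h 0] h by simp
  also have "(\<integral>\<^sup>+s. F (h * s) * indicator {0..h} (h * s) \<partial>lborel) = (\<integral>\<^sup>+s\<in>{0..1}. F (h * s) \<partial>lborel)"
    using h by (intro nn_integral_cong) (auto simp: indicator_def field_simps zero_le_mult_iff)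
  finally have "(\<integral>\<^sup>+t\<in>{0..h}. F t \<partial>lborel) = ennreal h * (\<integral>\<^sup>+s\<in>{0..1}. F (h * s) \<partial>lborel)" .
  then show ?thesis using h
    by (simp add: mult.assoc[symmetric] ennreal_mult[symmetric])
qed

lemma set_nn_integral_swap:
  fixes G :: "real \<Rightarrow> real \<Rightarrow> ennreal"
  assumes [measurable]: "case_prod G \<in> borel_measurable (borel \<Otimes>\<^sub>M borel)" "A \<in> sets borel" "B \<in> sets borel"
  shows "(\<integral>\<^sup>+x\<in>A. (\<integral>\<^sup>+y\<in>B. G x y \<partial>lborel) \<partial>lborel) = (\<integral>\<^sup>+y\<in>B. (\<integral>\<^sup>+x\<in>A. G x y \<partial>lborel) \<partial>lborel)"
proof -
  have "(\<integral>\<^sup>+x\<in>A. (\<integral>\<^sup>+y\<in>B. G x y \<partial>lborel) \<partial>lborel)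
      = (\<integral>\<^sup>+x. (\<integral>\<^sup>+y. G x y * indicator B y * indicator A x \<partial>lborel) \<partial>lborel)"
    by (simp add: nn_integral_multc)
  also have "\<dots> = (\<integral>\<^sup>+y. (\<integral>\<^sup>+x. G x y * indicator B y * indicator A x \<partial>lborel) \<partial>lborel)"
    by (rule lborel_pair.Fubini') measurable
  also have "\<dots> = (\<integral>\<^sup>+y. (\<integral>\<^sup>+x. G x y * indicator A x * indicator B y \<partial>lborel) \<partial>lborel)"
    by (intro nn_integral_cong) (simp add: mult_ac)
  finally show ?thesis by (simp add: nn_integral_multc)
qed

definition avg_weight :: "real \<Rightarrow> real \<Rightarrow> real" where
  "avg_weight h s = indicator {0..h} s / h"

text \<open>Integration against the weight \<open>w\<close> is bounded, in the \<open>p\<close>-th power, by differences of step at most \<open>e\<close> if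
\<open>a = 1\<close> and by the function itself if \<open>a = 0\<close>.  Having one notion for both cases allows a single argument for products
of weights.  The steps \<open>e * min \<sigma> 1\<close> with \<open>\<sigma> \<in> [0, 2]\<close> put a unit mass of uniformly distributed steps in \<open>[0, e]\<close>
and another unit mass on the step \<open>e\<close>: the coarse increment estimate needs the former and the fine one needs both.
Keeping an integral over the steps, rather than a supremum, is what allows the bound to be used under another integral.\<close>

definition controls :: "real \<Rightarrow> (real \<Rightarrow> real) \<Rightarrow> real \<Rightarrow> real \<Rightarrow> real \<Rightarrow> bool" where
  "controls p w c a e \<longleftrightarrow>
    (\<forall>\<phi>\<in>borel_measurable borel. (\<integral>\<^sup>+t\<in>{0..2}. ennreal (\<bar>\<phi> t\<bar> powr p) \<partial>lborel) < \<infinity> \<longrightarrow>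
      ennreal (\<bar>\<integral>t. w t * \<phi> t \<partial>lborel\<bar> powr p)
        \<le> ennreal c * (\<integral>\<^sup>+\<sigma>\<in>{0..2}. (\<integral>\<^sup>+t\<in>{0..1}. ennreal (\<bar>\<phi> t - a * \<phi> (t + e * min \<sigma> 1)\<bar> powr p) \<partial>lborel) \<partial>lborel))"

lemma controlsD:
  assumes "controls p w c a e" "\<phi> \<in> borel_measurable borel"
    "(\<integral>\<^sup>+t\<in>{0..2}. ennreal (\<bar>\<phi> t\<bar> powr p) \<partial>lborel) < \<infinity>"
  shows "ennreal (\<bar>\<integral>t. w t * \<phi> t \<partial>lborel\<bar> powr p)
    \<le> ennreal c * (\<integral>\<^sup>+\<sigma>\<in>{0..2}. (\<integral>\<^sup>+t\<in>{0..1}. ennreal (\<bar>\<phi> t - a * \<phi> (t + e * min \<sigma> 1)\<bar> powr p) \<partial>lborel) \<partial>lborel)"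
  using assms unfolding controls_def by simp

lemma avg_weight_measurable [measurable]: "avg_weight h \<in> borel_measurable borel"
  unfolding avg_weight_def by measurable

lemma integral_avg_weight:
  assumes "h > 0"
  shows "(\<integral>t. avg_weight h t * \<phi> t \<partial>lborel) = (\<integral>s. indicator {0..1} s * \<phi> (h * s) \<partial>lborel)"
proof -
  have "(\<integral>t. avg_weight h t * \<phi> t \<partial>lborel) = h * (\<integral>s. avg_weight h (h * s) * \<phi> (h * s) \<partial>lborel)"
    using lborel_integral_real_affine[of h "\<lambda>t. avg_weight h t * \<phi> t" 0] assms by simp
  also have "\<dots> = (\<integral>s. h * (avg_weight h (h * s) * \<phi> (h * s)) \<partial>lborel)"
    by simp
  also have "\<dots> = (\<integral>s. indicator {0..1} s * \<phi> (h * s) \<partial>lborel)"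
    using assms by (intro Bochner_Integration.integral_cong) (auto simp: avg_weight_def indicator_def field_simps zero_le_mult_iff)
  finally show ?thesis .
qed

lemma unit_average_sub_powr_le:
  fixes \<psi> :: "real \<Rightarrow> real"
  assumes p: "p > 1" and [measurable]: "\<psi> \<in> borel_measurable borel"
    and int: "integrable lborel (\<lambda>s. indicator {0..1} s * \<psi> s)"
  shows "ennreal (\<bar>(\<integral>s. indicator {0..1} s * \<psi> s \<partial>lborel) - c\<bar> powr p)
    \<le> (\<integral>\<^sup>+s\<in>{0..1}. ennreal (\<bar>\<psi> s - c\<bar> powr p) \<partial>lborel)"
proof -
  have "(\<integral>s. indicator {0..1} s * (\<psi> s - c) \<partial>lborel)
      = (\<integral>s. indicator {0..1} s * \<psi> s - c * indicator {0..1} s \<partial>lborel)"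
    by (simp add: algebra_simps)
  also have "\<dots> = (\<integral>s. indicator {0..1} s * \<psi> s \<partial>lborel) - c"
    using int by simp
  finally show ?thesis
    using set_integral_powr_le[OF p, of "{0..1}" lborel 1 "\<lambda>s. \<psi> s - c"] by simp
qed

lemma scaled_integrable:
  fixes \<phi> :: "real \<Rightarrow> real"
  assumes "integrable lborel (\<lambda>t. indicator {0..2} t * \<phi> t)" "0 \<le> x" "0 < h" "x + h \<le> 2"
  shows "integrable lborel (\<lambda>s. indicator {0..1} s * \<phi> (x + h * s))"
proof -
  have "integrable lborel (\<lambda>s. indicator {0..2} (x + h * s) * \<phi> (x + h * s))"
    using lborel_integrable_real_affine[OF assms(1), of h x] assms by simp
  then have "integrable lborel (\<lambda>s. (indicator {0..2} (x + h * s) * \<phi> (x + h * s)) * indicator {0..1} s)"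
    by (rule integrable_real_mult_indicator[rotated]) simp
  moreover have "(\<lambda>s. (indicator {0..2} (x + h * s) * \<phi> (x + h * s)) * indicator {0..1} s)
     = (\<lambda>s. indicator {0..1} s * \<phi> (x + h * s))"
  proof
    fix s :: real
    have "x + h * s \<le> 2" if "s \<le> 1"
      using mult_left_mono[OF that, of h] assms(3,4) by linarith
    then show "(indicator {0..2} (x + h * s) * \<phi> (x + h * s)) * indicator {0..1} s = indicator {0..1} s * \<phi> (x + h * s)"
      using assms by (auto simp: indicator_def)
  qed
  ultimately show ?thesis by simp
qed

lemma integral_avg_weight_diff:
  fixes \<phi> :: "real \<Rightarrow> real"
  assumes "integrable lborel (\<lambda>t. indicator {0..2} t * \<phi> t)" "0 < h" "h \<le> 2" "0 < H" "H \<le> 2"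
  shows "(\<integral>t. (avg_weight h t - avg_weight H t) * \<phi> t \<partial>lborel) =
     (\<integral>s. indicator {0..1} s * \<phi> (h * s) \<partial>lborel) - (\<integral>s. indicator {0..1} s * \<phi> (H * s) \<partial>lborel)"
proof -
  have "integrable lborel (\<lambda>t. avg_weight h t * \<phi> t)" if "0 < h" "h \<le> 2" for h
  proof -
    have "integrable lborel (\<lambda>t. (indicator {0..2} t * \<phi> t) * indicator {0..h} t / h)"
      using assms(1) by (intro integrable_divide integrable_real_mult_indicator) auto
    moreover have "(\<lambda>t. (indicator {0..2} t * \<phi> t) * indicator {0..h} t / h) = (\<lambda>t. avg_weight h t * \<phi> t)"
      using that by (auto simp: avg_weight_def indicator_def)
    ultimately show ?thesis by simp
  qed
  then show ?thesis using assms by (simp add: left_diff_distrib integral_avg_weight)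
qed

lemma controls_avg_weight:
  assumes p: "p > 1" and h: "0 < h" "h \<le> 1"
  shows "controls p (avg_weight h) (1 / h) 0 0"
  unfolding controls_def
proof (intro ballI impI)
  fix \<phi> :: "real \<Rightarrow> real"
  assume [measurable]: "\<phi> \<in> borel_measurable borel"
  have "ennreal (\<bar>\<integral>t. avg_weight h t * \<phi> t \<partial>lborel\<bar> powr p)
      \<le> (\<integral>\<^sup>+s\<in>{0..1}. ennreal (\<bar>\<phi> (h * s)\<bar> powr p) \<partial>lborel)"
    using set_integral_powr_le[OF p, of "{0..1}" lborel 1 "\<lambda>s. \<phi> (h * s)"] h
    by (simp add: integral_avg_weight)
  also have "\<dots> = ennreal (1 / h) * (\<integral>\<^sup>+t\<in>{0..h}. ennreal (\<bar>\<phi> t\<bar> powr p) \<partial>lborel)"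
    using h by (intro set_nn_integral_scale) auto
  also have "\<dots> \<le> ennreal (1 / h) * (\<integral>\<^sup>+t\<in>{0..1}. ennreal (\<bar>\<phi> t\<bar> powr p) \<partial>lborel)"
    using h by (intro mult_left_mono nn_integral_mono) (auto simp: indicator_def)
  \<comment> \<open>The factor 2 is the length of the range of \<open>\<sigma>\<close>.\<close>
  also have "\<dots> \<le> ennreal (1 / h) * (2 * (\<integral>\<^sup>+t\<in>{0..1}. ennreal (\<bar>\<phi> t\<bar> powr p) \<partial>lborel))"
    by (intro mult_left_mono) (auto simp: mult_2)
  also have "2 * (\<integral>\<^sup>+t\<in>{0..1}. ennreal (\<bar>\<phi> t\<bar> powr p) \<partial>lborel)
     = (\<integral>\<^sup>+\<sigma>\<in>{0..2::real}. (\<integral>\<^sup>+t\<in>{0..1}. ennreal (\<bar>\<phi> t\<bar> powr p) \<partial>lborel) \<partial>lborel)"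
    by (subst nn_integral_cmult_indicator) (simp_all add: mult.commute[of _ 2])
  finally show "ennreal (\<bar>\<integral>t. avg_weight h t * \<phi> t \<partial>lborel\<bar> powr p) \<le> ennreal (1 / h) *
      (\<integral>\<^sup>+\<sigma>\<in>{0..2}. (\<integral>\<^sup>+t\<in>{0..1}. ennreal (\<bar>\<phi> t - 0 * \<phi> (t + 0 * min \<sigma> 1)\<bar> powr p) \<partial>lborel) \<partial>lborel)"
    by simp
qed

text \<open>\<open>M r\<close> is the \<open>p\<close>-th power of the \<open>L\<^sup>p\<close> norm of the difference of step \<open>r\<close> over a period.  In the last
inequality both sides are integrals of \<open>M\<close>, over \<open>[0, h]\<close> and over \<open>[0, H]\<close>, with the same factor \<open>1 / (h H)\<close>.\<close>

lemma nn_integral_scaled_shift_le: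
  fixes \<phi> :: "real \<Rightarrow> real" and p :: real
  assumes [measurable]: "\<phi> \<in> borel_measurable borel" and h: "0 < h" "h \<le> H" "H \<le> 1"
    and M_def: "M = (\<lambda>r. \<integral>\<^sup>+t\<in>{0..1}. ennreal (\<bar>\<phi> t - \<phi> (t + r)\<bar> powr p) \<partial>lborel)"
  shows "M \<in> borel_measurable borel"
    and "(\<integral>\<^sup>+s\<in>{0..1}. ennreal (\<bar>\<phi> (h * s) - \<phi> (h * s + r)\<bar> powr p) \<partial>lborel) \<le> ennreal (1 / h) * M r"
    and "ennreal (1 / H) * (\<integral>\<^sup>+s\<in>{0..1}. M (h * s) \<partial>lborel) \<le> ennreal (1 / h) * (\<integral>\<^sup>+s\<in>{0..1}. M (H * s) \<partial>lborel)"
proof -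
  show Mm [measurable]: "M \<in> borel_measurable borel" unfolding M_def by measurable
  have "(\<integral>\<^sup>+s\<in>{0..1}. ennreal (\<bar>\<phi> (h * s) - \<phi> (h * s + r)\<bar> powr p) \<partial>lborel)
     = ennreal (1 / h) * (\<integral>\<^sup>+t\<in>{0..h}. ennreal (\<bar>\<phi> t - \<phi> (t + r)\<bar> powr p) \<partial>lborel)"
    using h by (intro set_nn_integral_scale) auto
  also have "\<dots> \<le> ennreal (1 / h) * M r"
    unfolding M_def using h by (intro mult_left_mono nn_integral_mono) (auto simp: indicator_def)
  finally show "(\<integral>\<^sup>+s\<in>{0..1}. ennreal (\<bar>\<phi> (h * s) - \<phi> (h * s + r)\<bar> powr p) \<partial>lborel) \<le> ennreal (1 / h) * M r" .
  have "ennreal (1 / H) * (\<integral>\<^sup>+s\<in>{0..1}. M (h * s) \<partial>lborel)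
      = ennreal (1 / h) * (ennreal (1 / H) * (\<integral>\<^sup>+t\<in>{0..h}. M t \<partial>lborel))"
    using h by (subst set_nn_integral_scale) (auto simp: mult_ac)
  also have "\<dots> \<le> ennreal (1 / h) * (ennreal (1 / H) * (\<integral>\<^sup>+t\<in>{0..H}. M t \<partial>lborel))"
    using h by (intro mult_left_mono nn_integral_mono) (auto simp: indicator_def)
  also have "\<dots> = ennreal (1 / h) * (\<integral>\<^sup>+s\<in>{0..1}. M (H * s) \<partial>lborel)"
    using h by (simp add: set_nn_integral_scale)
  finally show "ennreal (1 / H) * (\<integral>\<^sup>+s\<in>{0..1}. M (h * s) \<partial>lborel) \<le> ennreal (1 / h) * (\<integral>\<^sup>+s\<in>{0..1}. M (H * s) \<partial>lborel)" .
qed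

lemma nn_integral_clipped:
  fixes M :: "real \<Rightarrow> ennreal"
  assumes [measurable]: "M \<in> borel_measurable borel"
  shows "(\<integral>\<^sup>+\<sigma>\<in>{0..2}. M (e * min \<sigma> 1) \<partial>lborel) = (\<integral>\<^sup>+\<sigma>\<in>{0..1}. M (e * \<sigma>) \<partial>lborel) + M e"
proof -
  have "(\<integral>\<^sup>+\<sigma>\<in>{0..2}. M (e * min \<sigma> 1) \<partial>lborel)
     = (\<integral>\<^sup>+\<sigma>. M (e * \<sigma>) * indicator {0..1} \<sigma> + M e * indicator {1<..2} \<sigma> \<partial>lborel)"
    by (intro nn_integral_cong) (auto simp: indicator_def min_def)
  also have "\<dots> = (\<integral>\<^sup>+\<sigma>\<in>{0..1}. M (e * \<sigma>) \<partial>lborel) + (\<integral>\<^sup>+\<sigma>. M e * indicator {1<..2::real} \<sigma> \<partial>lborel)"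
    by (intro nn_integral_add) auto
  finally show ?thesis by (simp add: nn_integral_cmult_indicator)
qed

section \<open>The two increment estimates\<close>

lemma unit_integrals_diff_powr_le:
  fixes \<phi> \<psi> \<theta> :: "real \<Rightarrow> real"
  assumes p: "p > 1" and [measurable]: "\<phi> \<in> borel_measurable borel" "\<theta> \<in> borel_measurable borel"
    and int: "integrable lborel (\<lambda>s. indicator {0..1} s * \<phi> s)" "integrable lborel (\<lambda>s. indicator {0..1} s * \<theta> s)"
  shows "ennreal (\<bar>(\<integral>s. indicator {0..1} s * \<phi> s \<partial>lborel) - (\<integral>s. indicator {0..1} s * \<theta> s \<partial>lborel)\<bar> powr p)
    \<le> (\<integral>\<^sup>+s\<in>{0..1}. (\<integral>\<^sup>+\<sigma>\<in>{0..1}. ennreal (\<bar>\<phi> s - \<theta> \<sigma>\<bar> powr p) \<partial>lborel) \<partial>lborel)"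
proof -
  let ?B = "\<integral>s. indicator {0..1} s * \<theta> s \<partial>lborel"
  have "ennreal (\<bar>(\<integral>s. indicator {0..1} s * \<phi> s \<partial>lborel) - ?B\<bar> powr p)
      \<le> (\<integral>\<^sup>+s\<in>{0..1}. ennreal (\<bar>\<phi> s - ?B\<bar> powr p) \<partial>lborel)"
    by (rule unit_average_sub_powr_le[OF p _ int(1)]) simp
  also have "\<dots> \<le> (\<integral>\<^sup>+s\<in>{0..1}. (\<integral>\<^sup>+\<sigma>\<in>{0..1}. ennreal (\<bar>\<phi> s - \<theta> \<sigma>\<bar> powr p) \<partial>lborel) \<partial>lborel)"
  proof (intro nn_integral_mono mult_right_mono)
    fix s
    show "ennreal (\<bar>\<phi> s - ?B\<bar> powr p) \<le> (\<integral>\<^sup>+\<sigma>\<in>{0..1}. ennreal (\<bar>\<phi> s - \<theta> \<sigma>\<bar> powr p) \<partial>lborel)"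
      using unit_average_sub_powr_le[OF p _ int(2), of "\<phi> s"] by (simp add: abs_minus_commute)
  qed simp
  finally show ?thesis .
qed

lemma powr_diff_insert_le:
  fixes x y z p :: real
  assumes "p > 1"
  shows "ennreal (\<bar>x - y\<bar> powr p) \<le> ennreal (2 powr (p - 1)) * (ennreal (\<bar>x - z\<bar> powr p) + ennreal (\<bar>z - y\<bar> powr p))"
  using powr_add_le[OF assms, of "x - z" "z - y"]
  by (simp add: ennreal_mult[symmetric] ennreal_plus[symmetric] ennreal_leI del: ennreal_plus)

text \<open>The difference of the two averages is the mean of \<open>\<phi>(h s) - \<phi>(H \<sigma>)\<close> over \<open>s, \<sigma> \<in> [0, 1]\<close>.  Passing through the
intermediate point \<open>h s + H \<sigma>\<close> replaces it by differences of steps \<open>H \<sigma>\<close> and \<open>h s\<close>, both at most \<open>H\<close>.\<close>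

lemma increment_powr_le_coarse:
  fixes \<phi> :: "real \<Rightarrow> real"
  assumes p: "p > 1" and [measurable]: "\<phi> \<in> borel_measurable borel"
    and int: "integrable lborel (\<lambda>t. indicator {0..2} t * \<phi> t)"
    and h: "0 < h" "h \<le> H" "H \<le> 1"
  defines "M \<equiv> \<lambda>r. \<integral>\<^sup>+t\<in>{0..1}. ennreal (\<bar>\<phi> t - \<phi> (t + r)\<bar> powr p) \<partial>lborel"
  shows "ennreal (\<bar>\<integral>t. (avg_weight h t - avg_weight H t) * \<phi> t \<partial>lborel\<bar> powr p)
    \<le> ennreal (2 powr p / h) * (\<integral>\<^sup>+\<sigma>\<in>{0..1}. M (H * \<sigma>) \<partial>lborel)"
proof -
  note Mb = nn_integral_scaled_shift_le[OF \<open>\<phi> \<in> _\<close> h M_def[THEN meta_eq_to_obj_eq]]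
  note Mb' = nn_integral_scaled_shift_le[OF \<open>\<phi> \<in> _\<close> _ order_refl _ M_def[THEN meta_eq_to_obj_eq], where H = H]
  note [measurable] = Mb(1)
  define G where "G = (\<lambda>t r. ennreal (\<bar>\<phi> t - \<phi> (t + r)\<bar> powr p))"
  have G [measurable]: "case_prod G \<in> borel_measurable (borel \<Otimes>\<^sub>M borel)"
    unfolding G_def by measurable
  let ?c = "ennreal (2 powr (p - 1))"
  have "ennreal (\<bar>\<integral>t. (avg_weight h t - avg_weight H t) * \<phi> t \<partial>lborel\<bar> powr p)
      \<le> (\<integral>\<^sup>+s\<in>{0..1}. (\<integral>\<^sup>+\<sigma>\<in>{0..1}. ennreal (\<bar>\<phi> (h * s) - \<phi> (H * \<sigma>)\<bar> powr p) \<partial>lborel) \<partial>lborel)"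
    using h scaled_integrable[OF int, of 0]
    by (subst integral_avg_weight_diff[OF int]) (auto intro!: unit_integrals_diff_powr_le[OF p])
  also have "\<dots> \<le> (\<integral>\<^sup>+s\<in>{0..1}. (\<integral>\<^sup>+\<sigma>\<in>{0..1}. ?c * (G (h * s) (H * \<sigma>) + G (H * \<sigma>) (h * s)) \<partial>lborel) \<partial>lborel)"
  proof (intro nn_integral_mono mult_right_mono)
    fix s \<sigma> :: real
    show "ennreal (\<bar>\<phi> (h * s) - \<phi> (H * \<sigma>)\<bar> powr p) \<le> ?c * (G (h * s) (H * \<sigma>) + G (H * \<sigma>) (h * s))"
      using powr_diff_insert_le[OF p, of "\<phi> (h * s)" "\<phi> (H * \<sigma>)" "\<phi> (h * s + H * \<sigma>)"]
      by (simp add: G_def abs_minus_commute add.commute)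
  qed auto
  also have "\<dots> = ?c * ((\<integral>\<^sup>+s\<in>{0..1}. (\<integral>\<^sup>+\<sigma>\<in>{0..1}. G (h * s) (H * \<sigma>) \<partial>lborel) \<partial>lborel)
      + (\<integral>\<^sup>+s\<in>{0..1}. (\<integral>\<^sup>+\<sigma>\<in>{0..1}. G (H * \<sigma>) (h * s) \<partial>lborel) \<partial>lborel))"
    by (simp add: nn_integral_cmult nn_integral_add distrib_left distrib_right mult.assoc)
  also have "(\<integral>\<^sup>+s\<in>{0..1}. (\<integral>\<^sup>+\<sigma>\<in>{0..1}. G (h * s) (H * \<sigma>) \<partial>lborel) \<partial>lborel)
      = (\<integral>\<^sup>+\<sigma>\<in>{0..1}. (\<integral>\<^sup>+s\<in>{0..1}. G (h * s) (H * \<sigma>) \<partial>lborel) \<partial>lborel)"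
    by (rule set_nn_integral_swap) measurable
  also have "\<dots> \<le> (\<integral>\<^sup>+\<sigma>\<in>{0..1}. ennreal (1 / h) * M (H * \<sigma>) \<partial>lborel)"
    using Mb(2) by (intro nn_integral_mono mult_right_mono) (auto simp: G_def)
  also have "\<dots> = ennreal (1 / h) * (\<integral>\<^sup>+\<sigma>\<in>{0..1}. M (H * \<sigma>) \<partial>lborel)"
    by (simp add: nn_integral_cmult mult.assoc)
  also have "(\<integral>\<^sup>+s\<in>{0..1}. (\<integral>\<^sup>+\<sigma>\<in>{0..1}. G (H * \<sigma>) (h * s) \<partial>lborel) \<partial>lborel)
      \<le> (\<integral>\<^sup>+s\<in>{0..1}. ennreal (1 / H) * M (h * s) \<partial>lborel)"
    using Mb'(2) h by (intro nn_integral_mono mult_right_mono) (auto simp: G_def)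
  also have "\<dots> = ennreal (1 / H) * (\<integral>\<^sup>+s\<in>{0..1}. M (h * s) \<partial>lborel)"
    by (simp add: nn_integral_cmult mult.assoc)
  also have "\<dots> \<le> ennreal (1 / h) * (\<integral>\<^sup>+\<sigma>\<in>{0..1}. M (H * \<sigma>) \<partial>lborel)"
    by (rule Mb(3))
  finally have "ennreal (\<bar>\<integral>t. (avg_weight h t - avg_weight H t) * \<phi> t \<partial>lborel\<bar> powr p)
     \<le> ?c * (2 * (ennreal (1 / h) * (\<integral>\<^sup>+\<sigma>\<in>{0..1}. M (H * \<sigma>) \<partial>lborel)))"
    by (simp add: mult_2 add_left_mono add_right_mono mult_left_mono)
  also have "\<dots> = ennreal (2 powr (p - 1)) * ennreal 2 * ennreal (1 / h) * (\<integral>\<^sup>+\<sigma>\<in>{0..1}. M (H * \<sigma>) \<partial>lborel)"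
    by (simp add: mult_ac)
  also have "\<dots> = ennreal (2 powr (p - 1) * 2 * (1 / h)) * (\<integral>\<^sup>+\<sigma>\<in>{0..1}. M (H * \<sigma>) \<partial>lborel)"
    using ennreal_mult''[of "1 / h" "2 powr (p - 1) * 2"] ennreal_mult''[of 2 "2 powr (p - 1)"] h by simp
  also have "2 powr (p - 1) * 2 * (1 / h) = 2 powr p / h"
    by (simp add: powr_diff)
  finally show ?thesis .
qed

text \<open>This is the formula for the derivative of an average of length \<open>h\<close>, in integrated form:
the intervals \<open>[0, h]\<close> and \<open>[\<tau>, \<tau> + h]\<close> differ by the intervals \<open>[0, \<tau>]\<close> and \<open>[h, h + \<tau>]\<close>, which are translates of
each other by \<open>h\<close>.\<close>

lemma average_shift:
  fixes \<phi> :: "real \<Rightarrow> real"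
  assumes int: "integrable lborel (\<lambda>t. indicator {0..2} t * \<phi> t)"
    and h: "0 < h" "0 \<le> \<tau>" "h + \<tau> \<le> 2"
  shows "(\<integral>s. indicator {0..1} s * \<phi> (h * s) \<partial>lborel) - (\<integral>s. indicator {0..1} s * \<phi> (\<tau> + h * s) \<partial>lborel)
    = (\<integral>s. indicator {0..\<tau>} s * ((\<phi> s - \<phi> (s + h)) / h) \<partial>lborel)"
proof -
  have I: "integrable lborel (\<lambda>t. indicator {a..b} t * \<phi> t)" if "0 \<le> a" "b \<le> 2" for a b
  proof -
    have "integrable lborel (\<lambda>t. indicator {0..2} t * \<phi> t * indicator {a..b} t)"
      using int by (intro integrable_real_mult_indicator) auto
    moreover have "(\<lambda>t. indicator {0..2} t * \<phi> t * indicator {a..b} t) = (\<lambda>t. indicator {a..b} t * \<phi> t)"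
      using that by (auto simp: indicator_def)
    ultimately show ?thesis by simp
  qed
  have avg: "h * (\<integral>s. indicator {0..1} s * \<phi> (x + h * s) \<partial>lborel) = (\<integral>t. indicator {x..x+h} t * \<phi> t \<partial>lborel)" for x
  proof -
    have "(\<integral>t. indicator {x..x+h} t * \<phi> t \<partial>lborel)
        = h * (\<integral>s. indicator {x..x+h} (x + h * s) * \<phi> (x + h * s) \<partial>lborel)"
      using lborel_integral_real_affine[of h "\<lambda>t. indicator {x..x+h} t * \<phi> t" x] h by simp
    also have "(\<lambda>s. indicator {x..x+h} (x + h * s) * \<phi> (x + h * s)) = (\<lambda>s. indicator {0..1} s * \<phi> (x + h * s))"
      using h by (auto simp: indicator_def fun_eq_iff zero_le_mult_iff field_simps)
    finally show ?thesis by simp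
  qed
  have sh: "(\<integral>s. indicator {0..\<tau>} s * \<phi> (s + h) \<partial>lborel) = (\<integral>t. indicator {h..h+\<tau>} t * \<phi> t \<partial>lborel)"
  proof -
    have "(\<integral>t. indicator {h..h+\<tau>} t * \<phi> t \<partial>lborel) = (\<integral>s. indicator {h..h+\<tau>} (h + s) * \<phi> (h + s) \<partial>lborel)"
      using lborel_integral_real_affine[of 1 "\<lambda>t. indicator {h..h+\<tau>} t * \<phi> t" h] by simp
    also have "(\<lambda>s. indicator {h..h+\<tau>} (h + s) * \<phi> (h + s)) = (\<lambda>s. indicator {0..\<tau>} s * \<phi> (s + h))"
      by (auto simp: indicator_def fun_eq_iff add.commute)
    finally show ?thesis by simp
  qed
  have shi: "integrable lborel (\<lambda>s. indicator {0..\<tau>} s * \<phi> (s + h))"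
  proof -
    have "integrable lborel (\<lambda>s. indicator {h..h+\<tau>} (h + 1 * s) * \<phi> (h + 1 * s))"
      by (rule lborel_integrable_real_affine[OF I]) (use h in auto)
    also have "(\<lambda>s. indicator {h..h+\<tau>} (h + 1 * s) * \<phi> (h + 1 * s)) = (\<lambda>s. indicator {0..\<tau>} s * \<phi> (s + h))"
      by (auto simp: indicator_def fun_eq_iff add.commute)
    finally show ?thesis .
  qed
  have "(\<integral>t. indicator {0..h} t * \<phi> t \<partial>lborel) + (\<integral>t. indicator {h..h+\<tau>} t * \<phi> t \<partial>lborel)
      = (\<integral>t. indicator {0..h} t * \<phi> t + indicator {h..h+\<tau>} t * \<phi> t \<partial>lborel)"
    using h by (intro Bochner_Integration.integral_add[symmetric] I) auto
  \<comment> \<open>Up to endpoints, both pairs of intervals partition \<open>[0, h + \<tau>]\<close>.\<close>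
  also have "\<dots> = (\<integral>t. indicator {0..\<tau>} t * \<phi> t + indicator {\<tau>..\<tau>+h} t * \<phi> t \<partial>lborel)"
  proof (rule integral_cong_AE)
    show "AE t in lborel. indicator {0..h} t * \<phi> t + indicator {h..h+\<tau>} t * \<phi> t
        = indicator {0..\<tau>} t * \<phi> t + indicator {\<tau>..\<tau>+h} t * \<phi> t"
      using AE_lborel_singleton[of h] AE_lborel_singleton[of \<tau>]
      by eventually_elim (use h in \<open>auto simp: indicator_def\<close>)
    show "(\<lambda>t. indicator {0..h} t * \<phi> t + indicator {h..h+\<tau>} t * \<phi> t) \<in> borel_measurable lborel"
      using h by (intro borel_measurable_add borel_measurable_integrable[OF I]) auto
    show "(\<lambda>t. indicator {0..\<tau>} t * \<phi> t + indicator {\<tau>..\<tau>+h} t * \<phi> t) \<in> borel_measurable lborel"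
      using h by (intro borel_measurable_add borel_measurable_integrable[OF I]) auto
  qed
  also have "\<dots> = (\<integral>t. indicator {0..\<tau>} t * \<phi> t \<partial>lborel) + (\<integral>t. indicator {\<tau>..\<tau>+h} t * \<phi> t \<partial>lborel)"
    using h by (intro Bochner_Integration.integral_add I) auto
  finally have "h * (\<integral>s. indicator {0..1} s * \<phi> (h * s) \<partial>lborel) - h * (\<integral>s. indicator {0..1} s * \<phi> (\<tau> + h * s) \<partial>lborel)
      = (\<integral>t. indicator {0..\<tau>} t * \<phi> t \<partial>lborel) - (\<integral>s. indicator {0..\<tau>} s * \<phi> (s + h) \<partial>lborel)"
    using avg[of 0] avg[of \<tau>] sh by simp
  also have "\<dots> = (\<integral>s. indicator {0..\<tau>} s * \<phi> s - indicator {0..\<tau>} s * \<phi> (s + h) \<partial>lborel)"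
    by (rule Bochner_Integration.integral_diff[symmetric]) (use h in \<open>auto intro!: I shi\<close>)
  also have "\<dots> = (\<integral>s. h * (indicator {0..\<tau>} s * ((\<phi> s - \<phi> (s + h)) / h)) \<partial>lborel)"
    using h by (intro Bochner_Integration.integral_cong) (auto simp: field_simps)
  also have "\<dots> = h * (\<integral>s. indicator {0..\<tau>} s * ((\<phi> s - \<phi> (s + h)) / h) \<partial>lborel)"
    by (rule integral_mult_right_zero)
  finally have "h * ((\<integral>s. indicator {0..1} s * \<phi> (h * s) \<partial>lborel) - (\<integral>s. indicator {0..1} s * \<phi> (\<tau> + h * s) \<partial>lborel))
      = h * (\<integral>s. indicator {0..\<tau>} s * ((\<phi> s - \<phi> (s + h)) / h) \<partial>lborel)"
    by (simp only: right_diff_distrib)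
  then show ?thesis using h by (simp only: mult_cancel_left) simp
qed

text \<open>Let \<open>g\<close> be the average of length \<open>h\<close> as a function of its left endpoint.  The difference of the two averages splits
into the mean of \<open>g(0) - g(H \<sigma>)\<close>, controlled by the derivative of \<open>g\<close> and hence by the single step \<open>h\<close>,
and the mean of \<open>g(H \<sigma>) - \<phi>(H \<sigma>)\<close>, in which all steps are at most \<open>h\<close>.\<close>

lemma increment_powr_le_fine:
  fixes \<phi> :: "real \<Rightarrow> real"
  assumes p: "p > 1" and [measurable]: "\<phi> \<in> borel_measurable borel"
    and int: "integrable lborel (\<lambda>t. indicator {0..2} t * \<phi> t)"
    and h: "0 < h" "h \<le> H" "H \<le> 1"
  defines "M \<equiv> \<lambda>r. \<integral>\<^sup>+t\<in>{0..1}. ennreal (\<bar>\<phi> t - \<phi> (t + r)\<bar> powr p) \<partial>lborel"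
  shows "ennreal (\<bar>\<integral>t. (avg_weight h t - avg_weight H t) * \<phi> t \<partial>lborel\<bar> powr p)
    \<le> ennreal (2 powr (p - 1) * (H / h) powr (p - 1) / h) * (M h + (\<integral>\<^sup>+\<sigma>\<in>{0..1}. M (h * \<sigma>) \<partial>lborel))"
proof -
  note Mb' = nn_integral_scaled_shift_le[OF \<open>\<phi> \<in> _\<close> _ order_refl _ M_def[THEN meta_eq_to_obj_eq], where H = H]
  have [measurable]: "M \<in> borel_measurable borel" using Mb'(1) h by simp
  define G where "G = (\<lambda>t r. ennreal (\<bar>\<phi> t - \<phi> (t + r)\<bar> powr p))"
  have G [measurable]: "case_prod G \<in> borel_measurable (borel \<Otimes>\<^sub>M borel)"
    unfolding G_def by measurable
  define g where "g = (\<lambda>\<tau>. \<integral>s. indicator {0..1} s * \<phi> (\<tau> + h * s) \<partial>lborel)"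
  have gm [measurable]: "g \<in> borel_measurable borel" unfolding g_def by measurable
  let ?c = "ennreal (2 powr (p - 1))"
  define D where "D = ennreal (h powr (-p) * H powr (p - 1)) * M h"
  have g1: "ennreal (\<bar>g 0 - g \<tau>\<bar> powr p) \<le> D" if "0 \<le> \<tau>" "\<tau> \<le> H" for \<tau>
  proof (cases "\<tau> = 0")
    case False
    then have \<tau>: "\<tau> > 0" using that by simp
    have "g 0 - g \<tau> = (\<integral>s. indicator {0..\<tau>} s * ((\<phi> s - \<phi> (s + h)) / h) \<partial>lborel)"
      using average_shift[OF int, of h \<tau>] h that by (simp add: g_def)
    then have "ennreal (\<bar>g 0 - g \<tau>\<bar> powr p)
        \<le> ennreal (\<tau> powr (p - 1)) * (\<integral>\<^sup>+s\<in>{0..\<tau>}. ennreal (\<bar>(\<phi> s - \<phi> (s + h)) / h\<bar> powr p) \<partial>lborel)"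
      using set_integral_powr_le[OF p, of "{0..\<tau>}" lborel \<tau> "\<lambda>s. (\<phi> s - \<phi> (s + h)) / h"] \<tau> by simp
    also have "\<dots> \<le> ennreal (H powr (p - 1)) * (\<integral>\<^sup>+s\<in>{0..1}. ennreal (h powr (-p)) * ennreal (\<bar>\<phi> s - \<phi> (s + h)\<bar> powr p) \<partial>lborel)"
    proof (intro mult_mono nn_integral_mono)
      show "ennreal (\<tau> powr (p - 1)) \<le> ennreal (H powr (p - 1))"
        using that p by (intro ennreal_leI powr_mono2) auto
      show "ennreal (\<bar>(\<phi> s - \<phi> (s + h)) / h\<bar> powr p) \<le> ennreal (h powr (-p)) * ennreal (\<bar>\<phi> s - \<phi> (s + h)\<bar> powr p)" for s
        using h by (simp add: ennreal_mult[symmetric] powr_divide powr_minus_divide)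
      show "indicator {0..\<tau>} s \<le> (indicator {0..1} s :: ennreal)" for s
        using that h by (auto simp: indicator_def)
    qed auto
    also have "\<dots> = D"
      unfolding D_def M_def by (simp add: nn_integral_cmult mult.assoc ennreal_mult mult_ac)
    finally show ?thesis .
  qed (use p in simp)
  have g2: "ennreal (\<bar>g \<tau> - \<phi> \<tau>\<bar> powr p) \<le> (\<integral>\<^sup>+s\<in>{0..1}. G \<tau> (h * s) \<partial>lborel)" if "0 \<le> \<tau>" "\<tau> \<le> H" for \<tau>
    using unit_average_sub_powr_le[OF p _ scaled_integrable[OF int, of \<tau> h], of "\<phi> \<tau>"] h that
    by (simp add: g_def G_def abs_minus_commute)
  have "ennreal (\<bar>\<integral>t. (avg_weight h t - avg_weight H t) * \<phi> t \<partial>lborel\<bar> powr p)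
     = ennreal (\<bar>(\<integral>s. indicator {0..1} s * \<phi> (H * s) \<partial>lborel) - g 0\<bar> powr p)"
    using h by (subst integral_avg_weight_diff[OF int]) (auto simp: g_def abs_minus_commute)
  also have "\<dots> \<le> (\<integral>\<^sup>+\<sigma>\<in>{0..1}. ennreal (\<bar>\<phi> (H * \<sigma>) - g 0\<bar> powr p) \<partial>lborel)"
    using h by (intro unit_average_sub_powr_le[OF p] scaled_integrable[OF int, of 0 H, simplified]) auto
  also have "\<dots> \<le> (\<integral>\<^sup>+\<sigma>\<in>{0..1}. ?c * (D + (\<integral>\<^sup>+s\<in>{0..1}. G (H * \<sigma>) (h * s) \<partial>lborel)) \<partial>lborel)"
  proof (intro nn_integral_mono)
    fix \<sigma> :: real
    show "ennreal (\<bar>\<phi> (H * \<sigma>) - g 0\<bar> powr p) * indicator {0..1} \<sigma>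
        \<le> ?c * (D + (\<integral>\<^sup>+s\<in>{0..1}. G (H * \<sigma>) (h * s) \<partial>lborel)) * indicator {0..1} \<sigma>"
    proof (cases "\<sigma> \<in> {0..1}")
      case True
      then have r: "0 \<le> H * \<sigma>" "H * \<sigma> \<le> H" using h by (auto intro: mult_left_le)
      have "ennreal (\<bar>g 0 - \<phi> (H * \<sigma>)\<bar> powr p)
         \<le> ?c * (ennreal (\<bar>g 0 - g (H * \<sigma>)\<bar> powr p) + ennreal (\<bar>g (H * \<sigma>) - \<phi> (H * \<sigma>)\<bar> powr p))"
        by (rule powr_diff_insert_le[OF p])
      also have "\<dots> \<le> ?c * (D + (\<integral>\<^sup>+s\<in>{0..1}. G (H * \<sigma>) (h * s) \<partial>lborel))"
        by (intro mult_left_mono add_mono g1 g2 r) simp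
      finally show ?thesis using True by (simp add: abs_minus_commute)
    qed simp
  qed
  also have "\<dots> = ?c * (D + (\<integral>\<^sup>+\<sigma>\<in>{0..1}. (\<integral>\<^sup>+s\<in>{0..1}. G (H * \<sigma>) (h * s) \<partial>lborel) \<partial>lborel))"
    by (simp add: nn_integral_cmult nn_integral_add distrib_left distrib_right mult.assoc)
  also have "(\<integral>\<^sup>+\<sigma>\<in>{0..1}. (\<integral>\<^sup>+s\<in>{0..1}. G (H * \<sigma>) (h * s) \<partial>lborel) \<partial>lborel)
      = (\<integral>\<^sup>+s\<in>{0..1}. (\<integral>\<^sup>+\<sigma>\<in>{0..1}. G (H * \<sigma>) (h * s) \<partial>lborel) \<partial>lborel)"
    by (rule set_nn_integral_swap) measurable
  also have "\<dots> \<le> (\<integral>\<^sup>+s\<in>{0..1}. ennreal (1 / H) * M (h * s) \<partial>lborel)"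
    using Mb'(2) h by (intro nn_integral_mono mult_right_mono) (auto simp: G_def)
  also have "\<dots> = ennreal (1 / H) * (\<integral>\<^sup>+s\<in>{0..1}. M (h * s) \<partial>lborel)"
    by (simp add: nn_integral_cmult mult.assoc)
  also have "\<dots> \<le> ennreal (h powr (-p) * H powr (p - 1)) * (\<integral>\<^sup>+s\<in>{0..1}. M (h * s) \<partial>lborel)"
  proof (intro mult_right_mono ennreal_leI)
    have "1 / H = H powr (-p) * H powr (p - 1)" using h powr_minus_divide[of H 1] powr_add[of H "-p" "p - 1"] by simp
    also have "\<dots> \<le> h powr (-p) * H powr (p - 1)"
      using h p by (intro mult_right_mono powr_mono2') auto
    finally show "1 / H \<le> h powr (-p) * H powr (p - 1)" .
  qed simp
  also have "?c * (D + \<dots>) = ennreal (2 powr (p - 1) * (h powr (-p) * H powr (p - 1))) * (M h + (\<integral>\<^sup>+\<sigma>\<in>{0..1}. M (h * \<sigma>) \<partial>lborel))"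
    unfolding D_def by (simp add: ennreal_mult distrib_left mult.assoc)
  also have "2 powr (p - 1) * (h powr (-p) * H powr (p - 1)) = 2 powr (p - 1) * (H / h) powr (p - 1) / h"
    using h by (simp add: powr_divide powr_diff powr_minus_divide)
  finally show ?thesis by (simp add: add_left_mono mult_left_mono)
qed

section \<open>Lacunary scales\<close>

text \<open>The constant \<open>4\<^sup>p / H\<close> has the \<open>p\<close>-th root \<open>4 H\<^sup>-\<^sup>1\<^sup>/\<^sup>p\<close>, so a ratio of scales as large as \<open>2\<^sup>p\<close> costs only
an absolute factor.\<close>

lemma controls_increment_coarse:
  assumes p: "p > 1" and h: "0 < h" "h \<le> H" "H \<le> 1" "H \<le> 2 powr p * h"
  shows "controls p (\<lambda>t. avg_weight h t - avg_weight H t) (4 powr p / H) 1 H"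
  unfolding controls_def
proof (intro ballI impI)
  fix \<phi> :: "real \<Rightarrow> real"
  assume [measurable]: "\<phi> \<in> borel_measurable borel"
    and fin: "(\<integral>\<^sup>+t\<in>{0..2}. ennreal (\<bar>\<phi> t\<bar> powr p) \<partial>lborel) < \<infinity>"
  define M where "M = (\<lambda>r. \<integral>\<^sup>+t\<in>{0..1}. ennreal (\<bar>\<phi> t - \<phi> (t + r)\<bar> powr p) \<partial>lborel)"
  have [measurable]: "M \<in> borel_measurable borel" unfolding M_def by measurable
  have "integrable lborel (\<lambda>t. indicator {0..2} t * \<phi> t)"
    by (rule set_integrable_of_powr[OF p _ _ _ fin]) auto
  then have "ennreal (\<bar>\<integral>t. (avg_weight h t - avg_weight H t) * \<phi> t \<partial>lborel\<bar> powr p)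
    \<le> ennreal (2 powr p / h) * (\<integral>\<^sup>+\<sigma>\<in>{0..1}. M (H * \<sigma>) \<partial>lborel)"
    unfolding M_def using h by (intro increment_powr_le_coarse[OF p]) auto
  also have "\<dots> \<le> ennreal (4 powr p / H) * (\<integral>\<^sup>+\<sigma>\<in>{0..2}. M (H * min \<sigma> 1) \<partial>lborel)"
  proof (intro mult_mono ennreal_leI)
    have "2 powr p * H \<le> 2 powr p * (2 powr p * h)" using h by (intro mult_left_mono) auto
    also have "\<dots> = 4 powr p * h" by (simp add: powr_mult[symmetric])
    finally show "2 powr p / h \<le> 4 powr p / H" using h by (simp add: field_simps)
  qed (auto simp: nn_integral_clipped)
  finally show "ennreal (\<bar>\<integral>t. (avg_weight h t - avg_weight H t) * \<phi> t \<partial>lborel\<bar> powr p) \<le> ennreal (4 powr p / H) *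
      (\<integral>\<^sup>+\<sigma>\<in>{0..2}. (\<integral>\<^sup>+t\<in>{0..1}. ennreal (\<bar>\<phi> t - 1 * \<phi> (t + H * min \<sigma> 1)\<bar> powr p) \<partial>lborel) \<partial>lborel)"
    by (simp add: M_def)
qed

text \<open>Here the ratio of scales enters with the exponent \<open>p - 1\<close>, so it may be as large as 2 to the power \<open>p'\<close>.\<close>

lemma controls_increment_fine:
  assumes p: "p > 1" and h: "0 < h" "h \<le> H" "H \<le> 1" "H \<le> 2 powr (p / (p - 1)) * h"
  shows "controls p (\<lambda>t. avg_weight h t - avg_weight H t) (4 powr p / h) 1 h"
  unfolding controls_def
proof (intro ballI impI)
  fix \<phi> :: "real \<Rightarrow> real"
  assume [measurable]: "\<phi> \<in> borel_measurable borel"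
    and fin: "(\<integral>\<^sup>+t\<in>{0..2}. ennreal (\<bar>\<phi> t\<bar> powr p) \<partial>lborel) < \<infinity>"
  define M where "M = (\<lambda>r. \<integral>\<^sup>+t\<in>{0..1}. ennreal (\<bar>\<phi> t - \<phi> (t + r)\<bar> powr p) \<partial>lborel)"
  have [measurable]: "M \<in> borel_measurable borel" unfolding M_def by measurable
  have "integrable lborel (\<lambda>t. indicator {0..2} t * \<phi> t)"
    by (rule set_integrable_of_powr[OF p _ _ _ fin]) auto
  then have "ennreal (\<bar>\<integral>t. (avg_weight h t - avg_weight H t) * \<phi> t \<partial>lborel\<bar> powr p)
    \<le> ennreal (2 powr (p - 1) * (H / h) powr (p - 1) / h) * (M h + (\<integral>\<^sup>+\<sigma>\<in>{0..1}. M (h * \<sigma>) \<partial>lborel))"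
    unfolding M_def using h by (intro increment_powr_le_fine[OF p]) auto
  also have "\<dots> \<le> ennreal (4 powr p / h) * (\<integral>\<^sup>+\<sigma>\<in>{0..2}. M (h * min \<sigma> 1) \<partial>lborel)"
  proof (intro mult_mono ennreal_leI)
    have "(H / h) powr (p - 1) \<le> (2 powr (p / (p - 1))) powr (p - 1)"
      using h p by (intro powr_mono2) (auto simp: field_simps)
    also have "\<dots> = 2 powr p" using p by (simp add: powr_powr)
    finally have "2 powr (p - 1) * (H / h) powr (p - 1) \<le> 2 powr p * 2 powr p"
      by (intro mult_mono) auto
    also have "\<dots> = 4 powr p" by (simp add: powr_mult[symmetric])
    finally show "2 powr (p - 1) * (H / h) powr (p - 1) / h \<le> 4 powr p / h"
      using h by (intro divide_right_mono) auto
  qed (auto simp: nn_integral_clipped add.commute)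
  finally show "ennreal (\<bar>\<integral>t. (avg_weight h t - avg_weight H t) * \<phi> t \<partial>lborel\<bar> powr p) \<le> ennreal (4 powr p / h) *
      (\<integral>\<^sup>+\<sigma>\<in>{0..2}. (\<integral>\<^sup>+t\<in>{0..1}. ennreal (\<bar>\<phi> t - 1 * \<phi> (t + h * min \<sigma> 1)\<bar> powr p) \<partial>lborel) \<partial>lborel)"
    by (simp add: M_def)
qed

lemma lacunary_scale_bounds:
  fixes K u :: real
  assumes "K > 1" "1 / K < u" "u \<le> 1"
  shows "0 < u / K ^ j" "u / K ^ j \<le> 1"
proof -
  have "0 < 1 / K" using assms(1) by simp
  then have "0 < u" using assms(2) by linarith
  then show "0 < u / K ^ j" using assms(1) by simp
  have "1 \<le> K ^ j" using assms(1) by (intro one_le_power) auto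
  then have "u \<le> K ^ j" using assms(3) by linarith
  then show "u / K ^ j \<le> 1" using assms(1) by (simp add: divide_le_eq)
qed

text \<open>For \<open>p \<ge> 2\<close> the larger of \<open>p\<close> and \<open>p'\<close> is \<open>p\<close> and the coarse estimate is used; for \<open>p < 2\<close> it is \<open>p'\<close> and the
fine one is used.  In both cases the \<open>j\<close>-th increment is controlled at the scale \<open>u / K\<^sup>j\<close>, whatever \<open>u\<close> is, which
leaves \<open>u\<close> free to be chosen later.  The bound on \<open>1 / h 0\<close> keeps the estimate for the
first average, whose \<open>p\<close>-th power carries this factor, absolute after a \<open>p\<close>-th root is taken.\<close>

lemma scales_exist:
  assumes p: "p > 1"
  shows "\<exists>K>1. p * conj_exp p / 3 \<le> ln K \<and> (\<forall>u. 1 / K < u \<longrightarrow> u \<le> 1 \<longrightarrow>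
    (\<exists>h :: nat \<Rightarrow> real. (\<forall>j. 0 < h j \<and> h j \<le> 1) \<and> h \<longlonglongrightarrow> 0 \<and> 1 / h 0 \<le> 2 powr p \<and>
      (\<forall>j. controls p (\<lambda>t. avg_weight (h (Suc j)) t - avg_weight (h j) t) (4 powr p / (u / K ^ j)) 1 (u / K ^ j))))"
proof (cases "p \<ge> 2")
  case True
  \<comment> \<open>Now \<open>p' \<le> 2\<close>, so that \<open>p p'\<close> is at most \<open>2 p\<close>.\<close>
  define K where "K = 2 powr p"
  have K: "K > 1" using p by (simp add: K_def)
  have lim: "(\<lambda>j. u / K ^ j) \<longlonglongrightarrow> 0" for u
    using K by (rule LIMSEQ_divide_realpow_zero)
  have "p * conj_exp p \<le> 2 * p"
    using True by (simp add: conj_exp_def field_simps) 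
  also have "\<dots> \<le> 3 * (p * ln 2)" using ln2_ge_two_thirds p by simp
  finally have "p * conj_exp p / 3 \<le> ln K" by (simp add: K_def ln_powr)
  moreover have "\<exists>h :: nat \<Rightarrow> real. (\<forall>j. 0 < h j \<and> h j \<le> 1) \<and> h \<longlonglongrightarrow> 0 \<and> 1 / h 0 \<le> 2 powr p \<and>
      (\<forall>j. controls p (\<lambda>t. avg_weight (h (Suc j)) t - avg_weight (h j) t) (4 powr p / (u / K ^ j)) 1 (u / K ^ j))"
    if u: "1 / K < u" "u \<le> 1" for u
  proof (intro exI[of _ "\<lambda>j. u / K ^ j"] conjI allI)
    have u0: "u > 0" using lacunary_scale_bounds(1)[OF K u, of 0] by simp
    show pos: "0 < u / K ^ j" for j by (rule lacunary_scale_bounds[OF K u])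
    show le1: "u / K ^ j \<le> 1" for j by (rule lacunary_scale_bounds[OF K u])
    have "1 / u \<le> K" using u(1) u0 K by (simp add: field_simps)
    then show "1 / (u / K ^ 0) \<le> 2 powr p" by (simp add: K_def)
    show "controls p (\<lambda>t. avg_weight (u / K ^ Suc j) t - avg_weight (u / K ^ j) t) (4 powr p / (u / K ^ j)) 1 (u / K ^ j)" for j
    proof (rule controls_increment_coarse[OF p pos _ le1])
      show "u / K ^ Suc j \<le> u / K ^ j" using u0 K by (intro divide_left_mono) auto
      have "u / K ^ j = K * (u / K ^ Suc j)" using K by simp
      then show "u / K ^ j \<le> 2 powr p * (u / K ^ Suc j)" unfolding K_def by linarith
    qed
  qed (rule lim)
  ultimately show ?thesis using K by blast
next
  case False
  \<comment> \<open>Now \<open>p p'\<close> is at most \<open>2 p'\<close>.\<close>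
  define K where "K = 2 powr (p / (p - 1))"
  have K: "K > 1" using p by (simp add: K_def)
  have lim: "(\<lambda>j. u / K ^ j) \<longlonglongrightarrow> 0" for u
    using K by (rule LIMSEQ_divide_realpow_zero)
  have "p * conj_exp p \<le> 2 * (p / (p - 1))"
    unfolding conj_exp_def using False p by (intro mult_right_mono) auto
  also have "\<dots> \<le> (3 * ln 2) * (p / (p - 1))" using ln2_ge_two_thirds p by (intro mult_right_mono) auto
  finally have "p * conj_exp p / 3 \<le> ln K" by (simp add: K_def ln_powr mult_ac)
  moreover have "\<exists>h :: nat \<Rightarrow> real. (\<forall>j. 0 < h j \<and> h j \<le> 1) \<and> h \<longlonglongrightarrow> 0 \<and> 1 / h 0 \<le> 2 powr p \<and>
      (\<forall>j. controls p (\<lambda>t. avg_weight (h (Suc j)) t - avg_weight (h j) t) (4 powr p / (u / K ^ j)) 1 (u / K ^ j))"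
    if u: "1 / K < u" "u \<le> 1" for u
  \<comment> \<open>The scale 1 is put in front, so that \<open>u / K\<^sup>j\<close> is the finer scale of the \<open>j\<close>-th increment.\<close>
  proof (intro exI[of _ "\<lambda>j. case j of 0 \<Rightarrow> 1 | Suc i \<Rightarrow> u / K ^ i"] conjI allI)
    let ?h = "\<lambda>j. case j of 0 \<Rightarrow> 1 | Suc i \<Rightarrow> u / K ^ i"
    have u0: "u > 0" using lacunary_scale_bounds(1)[OF K u, of 0] by simp
    have pos: "0 < u / K ^ j" for j by (rule lacunary_scale_bounds[OF K u])
    have le1: "u / K ^ j \<le> 1" for j by (rule lacunary_scale_bounds[OF K u])
    show "0 < ?h j" for j using pos by (auto split: nat.split)
    show hle1: "?h j \<le> 1" for j using le1 by (auto split: nat.split)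
    show "?h \<longlonglongrightarrow> 0" by (rule LIMSEQ_imp_Suc) (simp add: lim)
    show "1 / ?h 0 \<le> 2 powr p" using p by (simp add: ge_one_powr_ge_zero)
    show "controls p (\<lambda>t. avg_weight (?h (Suc j)) t - avg_weight (?h j) t) (4 powr p / (u / K ^ j)) 1 (u / K ^ j)" for j
    proof -
      have h1: "u / K ^ j \<le> ?h j"
      proof (cases j)
        case (Suc i)
        have "u / K ^ Suc i \<le> u / K ^ i" using u0 K by (intro divide_left_mono) auto
        then show ?thesis using Suc by simp
      qed (use u in simp)
      have h2: "?h j \<le> K * (u / K ^ j)"
      proof (cases j)
        case 0
        have "1 < K * u" using u(1) u0 K by (simp add: field_simps)
        then show ?thesis using 0 by simp
      qed (use K in simp)
      have h2': "?h j \<le> 2 powr (p / (p - 1)) * (u / K ^ j)" using h2 unfolding K_def .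
      show ?thesis using controls_increment_fine[OF p pos h1 hle1 h2'] by simp
    qed
  qed
  ultimately show ?thesis using K by blast
qed

section \<open>Products of weights\<close>

lemma set_nn_integral_Times:
  fixes F :: "real \<times> real \<Rightarrow> ennreal"
  assumes [measurable]: "F \<in> borel_measurable borel" "A \<in> sets borel" "B \<in> sets borel"
  shows "(\<integral>\<^sup>+z\<in>A \<times> B. F z \<partial>lborel) = (\<integral>\<^sup>+s\<in>A. (\<integral>\<^sup>+t\<in>B. F (s, t) \<partial>lborel) \<partial>lborel)"
proof -
  have "(\<integral>\<^sup>+z\<in>A \<times> B. F z \<partial>lborel) = (\<integral>\<^sup>+z. F z * indicator (A \<times> B) z \<partial>(lborel \<Otimes>\<^sub>M lborel))"
    by (simp add: lborel_prod)
  also have "\<dots> = (\<integral>\<^sup>+s. \<integral>\<^sup>+t. F (s, t) * indicator (A \<times> B) (s, t) \<partial>lborel \<partial>lborel)"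
  proof (rule lborel.nn_integral_fst[symmetric])
    have "A \<times> B \<in> sets borel" by (intro borel_Times) measurable
    then have "(\<lambda>z. F z * indicator (A \<times> B) z) \<in> borel_measurable borel" by measurable
    then show "(\<lambda>z. F z * indicator (A \<times> B) z) \<in> borel_measurable (lborel \<Otimes>\<^sub>M lborel)"
      by (simp add: lborel_prod)
  qed
  also have "\<dots> = (\<integral>\<^sup>+s. \<integral>\<^sup>+t. F (s, t) * indicator B t * indicator A s \<partial>lborel \<partial>lborel)"
    by (intro nn_integral_cong) (auto simp: indicator_def)
  also have "\<dots> = (\<integral>\<^sup>+s\<in>A. (\<integral>\<^sup>+t\<in>B. F (s, t) \<partial>lborel) \<partial>lborel)"
    by (simp add: nn_integral_multc)
  finally show ?thesis .
qed

text \<open>The predicate \<open>P\<close> may be non-measurable, so the translation invariance of the measure is applied to a null set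
that contains its exceptional points.\<close>

lemma AE_lborel_translate:
  fixes q :: "'a::euclidean_space"
  assumes "AE z in lborel. P z"
  shows "AE z in lborel. P (z + q)"
proof -
  obtain N where N: "N \<in> null_sets lborel" "{z. \<not> P z} \<subseteq> N"
    using assms unfolding eventually_ae_filter by auto
  have "AE z in lborel. z \<notin> N" by (rule AE_not_in[OF N(1)])
  then have "AE z in distr lborel borel ((+) q). z \<notin> N" by (subst lborel_distr_plus)
  then have "AE z in lborel. q + z \<notin> N" using N(1) by (subst (asm) AE_distr_iff) auto
  then show ?thesis by eventually_elim (use N(2) in \<open>auto simp: add.commute\<close>)
qed

lemma fst_borel: "(fst :: real \<times> real \<Rightarrow> real) \<in> borel_measurable borel"
  and snd_borel: "(snd :: real \<times> real \<Rightarrow> real) \<in> borel_measurable borel"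
  by (subst borel_prod[symmetric], measurable)+

text \<open>Integrating \<open>f\<close> against \<open>w'\<close> in the second variable gives a function \<open>G\<close> of the first one.  The bound for \<open>w\<close>
reduces the claim to differences of \<open>G\<close>; these are integrals against \<open>w'\<close> of differences of \<open>f\<close> in the first variable,
to which the bound for \<open>w'\<close> applies.  The factor 4 is the square of the length of the range of \<open>\<sigma>\<close>.
With \<open>a\<close> and \<open>a'\<close> in \<open>{0, 1}\<close> the four cases are the function, the difference in either variable, and the mixed
difference.\<close>

lemma tensor_powr_le:
  fixes f :: "real \<times> real \<Rightarrow> real"
  assumes p: "p > 1"
    and w [measurable]: "w \<in> borel_measurable borel" "w' \<in> borel_measurable borel"
    and wB: "\<And>s. \<bar>w s\<bar> \<le> B * indicator {0..1} s" "\<And>s. \<bar>w' s\<bar> \<le> B' * indicator {0..1} s"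
    and cw: "controls p w c a e" "controls p w' c' a' e'"
    and nonneg: "0 \<le> c" "0 \<le> c'" "0 \<le> e" "e \<le> 1" "0 \<le> e'" "e' \<le> 1"
    and f [measurable]: "f \<in> borel_measurable borel"
    and fin: "(\<integral>\<^sup>+z\<in>{0..2} \<times> {0..2}. ennreal (\<bar>f z\<bar> powr p) \<partial>lborel) < \<infinity>"
    and bnd: "\<And>r r'. 0 \<le> r \<Longrightarrow> r \<le> e \<Longrightarrow> 0 \<le> r' \<Longrightarrow> r' \<le> e' \<Longrightarrow>
       (\<integral>\<^sup>+(s, t)\<in>unit_square. ennreal (\<bar>f (s, t) - a * f (s + r, t) - a' * f (s, t + r') + a * a' * f (s + r, t + r')\<bar> powr p) \<partial>lborel) \<le> D"
  shows "integrable lborel (\<lambda>z. w (fst z) * w' (snd z) * f z)"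
    and "ennreal (\<bar>\<integral>z. w (fst z) * w' (snd z) * f z \<partial>lborel\<bar> powr p) \<le> ennreal (4 * c * c') * D"
proof -
  have BB: "0 \<le> B" "0 \<le> B'" using wB(1)[of 0] wB(2)[of 0] by auto
  have em: "emeasure lborel ({0..2::real} \<times> {0..2::real}) < \<infinity>"
    by (rule emeasure_bounded_finite) (intro bounded_Times bounded_closed_interval)
  have intf: "integrable lborel (\<lambda>z. indicator ({0..2} \<times> {0..2}) z * f z)"
    by (rule set_integrable_of_powr[OF p _ em _ fin]) (auto intro!: borel_Times)
  show int: "integrable lborel (\<lambda>z. w (fst z) * w' (snd z) * f z)"
  proof (rule Bochner_Integration.integrable_bound)
    show "integrable lborel (\<lambda>z. (B * B') * (indicator ({0..2} \<times> {0..2}) z * f z))"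
      using intf by simp
    show "AE z in lborel. norm (w (fst z) * w' (snd z) * f z) \<le> norm ((B * B') * (indicator ({0..2} \<times> {0..2}) z * f z))"
    proof (intro AE_I2)
      fix z :: "real \<times> real"
      have "\<bar>w (fst z)\<bar> * \<bar>w' (snd z)\<bar> \<le> (B * indicator {0..1} (fst z)) * (B' * indicator {0..1} (snd z))"
        by (intro mult_mono wB) (use BB in auto)
      also have "\<dots> \<le> B * B' * indicator ({0..2} \<times> {0..2}) z"
        using BB by (cases z) (auto simp: indicator_def)
      finally have "\<bar>w (fst z)\<bar> * \<bar>w' (snd z)\<bar> * \<bar>f z\<bar> \<le> (B * B' * indicator ({0..2} \<times> {0..2}) z) * \<bar>f z\<bar>"
        by (intro mult_right_mono) auto
      then show "norm (w (fst z) * w' (snd z) * f z) \<le> norm ((B * B') * (indicator ({0..2} \<times> {0..2}) z * f z))"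
        using BB by (simp add: abs_mult mult.assoc)
    qed
    have "(\<lambda>z. w (fst z) * w' (snd z) * f z) \<in> borel_measurable borel"
      by (intro borel_measurable_times measurable_compose[OF fst_borel w(1)] measurable_compose[OF snd_borel w(2)] f)
    then show "(\<lambda>z. w (fst z) * w' (snd z) * f z) \<in> borel_measurable lborel" by simp
  qed
  define G where "G = (\<lambda>s. \<integral>t. w' t * f (s, t) \<partial>lborel)"
  have Gm [measurable]: "G \<in> borel_measurable borel" unfolding G_def by measurable
  have LG: "(\<integral>z. w (fst z) * w' (snd z) * f z \<partial>lborel) = (\<integral>s. w s * G s \<partial>lborel)"
  proof -
    have "(\<integral>s. \<integral>t. w s * w' t * f (s, t) \<partial>lborel \<partial>lborel) = (\<integral>z. w (fst z) * w' (snd z) * f z \<partial>(lborel \<Otimes>\<^sub>M lborel))"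
      using lborel_pair.integral_fst[of "\<lambda>s t. w s * w' t * f (s, t)"] int
      by (simp add: lborel_prod case_prod_beta')
    then show ?thesis by (simp add: lborel_prod G_def mult.assoc)
  qed
  \<comment> \<open>By Fubini's theorem almost all slices are in \<open>L\<^sup>p\<close>; only for these is \<open>G\<close> linear in the slice.\<close>
  define good where "good s \<longleftrightarrow> (\<integral>\<^sup>+t\<in>{0..2}. ennreal (\<bar>f (s, t)\<bar> powr p) \<partial>lborel) < \<infinity>" for s
  have [measurable]: "Measurable.pred borel good" unfolding good_def by measurable
  have fin': "(\<integral>\<^sup>+s\<in>{0..2}. (\<integral>\<^sup>+t\<in>{0..2}. ennreal (\<bar>f (s, t)\<bar> powr p) \<partial>lborel) \<partial>lborel) < \<infinity>"
    using fin by (simp add: set_nn_integral_Times)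
  have AEg: "AE s in lborel. s \<in> {0..2} \<longrightarrow> good s"
  proof -
    have "AE s in lborel. (\<integral>\<^sup>+t\<in>{0..2}. ennreal (\<bar>f (s, t)\<bar> powr p) \<partial>lborel) * indicator {0..2} s \<noteq> \<infinity>"
      by (rule nn_integral_PInf_AE) (use fin' in auto)
    then show ?thesis by eventually_elim (auto simp: good_def indicator_def top.not_eq_extremum)
  qed
  have Gp: "ennreal (\<bar>G s\<bar> powr p) \<le> ennreal (B' powr p) * (\<integral>\<^sup>+t\<in>{0..2}. ennreal (\<bar>f (s, t)\<bar> powr p) \<partial>lborel)" for s
  proof -
    have "G s = (\<integral>t. indicator {0..1} t * (w' t * f (s, t)) \<partial>lborel)"
    proof -
      have "w' t = 0" if "t \<notin> {0..1}" for t using wB(2)[of t] that by simp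
      then show ?thesis unfolding G_def by (intro Bochner_Integration.integral_cong) (auto simp: indicator_def)
    qed
    then have "ennreal (\<bar>G s\<bar> powr p) \<le> (\<integral>\<^sup>+t\<in>{0..1}. ennreal (\<bar>w' t * f (s, t)\<bar> powr p) \<partial>lborel)"
      using set_integral_powr_le[OF p, of "{0..1}" lborel 1 "\<lambda>t. w' t * f (s, t)"] by simp
    also have "\<dots> \<le> (\<integral>\<^sup>+t. ennreal (B' powr p) * (ennreal (\<bar>f (s, t)\<bar> powr p) * indicator {0..2} t) \<partial>lborel)"
    proof (intro nn_integral_mono)
      fix t :: real
      have "\<bar>w' t * f (s, t)\<bar> powr p \<le> (B' * \<bar>f (s, t)\<bar>) powr p" if "t \<in> {0..1}"
        using wB(2)[of t] that p by (intro powr_mono2) (auto simp: abs_mult intro: mult_right_mono)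
      then show "ennreal (\<bar>w' t * f (s, t)\<bar> powr p) * indicator {0..1} t \<le> ennreal (B' powr p) * (ennreal (\<bar>f (s, t)\<bar> powr p) * indicator {0..2} t)"
        using BB by (auto simp: indicator_def powr_mult ennreal_mult[symmetric] intro!: ennreal_leI)
    qed
    also have "\<dots> = ennreal (B' powr p) * (\<integral>\<^sup>+t\<in>{0..2}. ennreal (\<bar>f (s, t)\<bar> powr p) \<partial>lborel)"
      by (rule nn_integral_cmult) measurable
    finally show ?thesis .
  qed
  have Gfin: "(\<integral>\<^sup>+s\<in>{0..2}. ennreal (\<bar>G s\<bar> powr p) \<partial>lborel) < \<infinity>"
  proof -
    have "(\<integral>\<^sup>+s\<in>{0..2}. ennreal (\<bar>G s\<bar> powr p) \<partial>lborel)
       \<le> (\<integral>\<^sup>+s\<in>{0..2}. (ennreal (B' powr p) * (\<integral>\<^sup>+t\<in>{0..2}. ennreal (\<bar>f (s, t)\<bar> powr p) \<partial>lborel)) \<partial>lborel)"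
      by (intro nn_integral_mono mult_right_mono Gp) simp
    also have "\<dots> = ennreal (B' powr p) * (\<integral>\<^sup>+s\<in>{0..2}. (\<integral>\<^sup>+t\<in>{0..2}. ennreal (\<bar>f (s, t)\<bar> powr p) \<partial>lborel) \<partial>lborel)"
      by (simp add: nn_integral_cmult mult.assoc)
    also have "\<dots> < \<infinity>" using fin' by (simp add: ennreal_mult_less_top)
    finally show ?thesis .
  qed
  define Q where "Q = (\<lambda>r r' s t. ennreal (\<bar>f (s, t) - a * f (s + r, t) - a' * f (s, t + r') + a * a' * f (s + r, t + r')\<bar> powr p))"
  have Q_measurable [measurable (raw)]: "(\<lambda>x. Q r (A x) (S x) (T x)) \<in> borel_measurable M"
    if [measurable]: "A \<in> borel_measurable M" "S \<in> borel_measurable M" "T \<in> borel_measurable M"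
    for M :: "'x measure" and r and A S T :: "'x \<Rightarrow> real"
  proof -
    have fm: "(\<lambda>x. f (S x + a, T x + A' x)) \<in> borel_measurable M" if [measurable]: "A' \<in> borel_measurable M" for a A'
      by (rule measurable_compose[OF borel_measurable_Pair f]) measurable
    note [measurable] = fm[of "\<lambda>_. 0" 0, simplified] fm[of "\<lambda>_. 0" r, simplified] fm[of A 0, simplified] fm[of A r]
    show ?thesis unfolding Q_def by measurable
  qed
  have slice: "ennreal (\<bar>G s - a * G (s + r)\<bar> powr p)
      \<le> ennreal c' * (\<integral>\<^sup>+\<sigma>\<in>{0..2}. (\<integral>\<^sup>+t\<in>{0..1}. Q r (e' * min \<sigma> 1) s t \<partial>lborel) \<partial>lborel)"
    if "good s" "good (s + r)" for r s
  proof -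
    let ?\<phi> = "\<lambda>t. f (s, t) - a * f (s + r, t)"
    have L1: "integrable lborel (\<lambda>t. w' t * f (s', t))" if "good s'" for s'
    proof (rule Bochner_Integration.integrable_bound)
      show "integrable lborel (\<lambda>t. B' * (indicator {0..2} t * f (s', t)))"
        using that unfolding good_def
        by (intro integrable_mult_right set_integrable_of_powr[OF p]) auto
      show "AE t in lborel. norm (w' t * f (s', t)) \<le> norm (B' * (indicator {0..2} t * f (s', t)))"
      proof (intro AE_I2)
        fix t :: real
        have "\<bar>w' t\<bar> \<le> B' * indicator {0..2} t" by (rule order_trans[OF wB(2)]) (use BB in \<open>auto simp: indicator_def\<close>)
        then have "\<bar>w' t\<bar> * \<bar>f (s', t)\<bar> \<le> (B' * indicator {0..2} t) * \<bar>f (s', t)\<bar>" by (intro mult_right_mono) auto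
        then show "norm (w' t * f (s', t)) \<le> norm (B' * (indicator {0..2} t * f (s', t)))"
          using BB by (simp add: abs_mult mult.assoc)
      qed
    qed measurable
    have "G s - a * G (s + r) = (\<integral>t. w' t * f (s, t) - a * (w' t * f (s + r, t)) \<partial>lborel)"
      unfolding G_def using L1[OF that(1)] L1[OF that(2)] by simp
    also have "\<dots> = (\<integral>t. w' t * ?\<phi> t \<partial>lborel)"
      by (simp add: algebra_simps)
    finally have eq: "G s - a * G (s + r) = (\<integral>t. w' t * ?\<phi> t \<partial>lborel)" .
    have "(\<integral>\<^sup>+t\<in>{0..2}. ennreal (\<bar>?\<phi> t\<bar> powr p) \<partial>lborel)
       \<le> (\<integral>\<^sup>+t. ennreal (2 powr (p - 1)) * (ennreal (\<bar>f (s, t)\<bar> powr p) * indicator {0..2} t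
            + ennreal (\<bar>a\<bar> powr p) * (ennreal (\<bar>f (s + r, t)\<bar> powr p) * indicator {0..2} t)) \<partial>lborel)"
    proof (intro nn_integral_mono)
      fix t :: real
      have "ennreal (\<bar>?\<phi> t\<bar> powr p) \<le> ennreal (2 powr (p - 1)) * (ennreal (\<bar>f (s, t) - 0\<bar> powr p) + ennreal (\<bar>0 - a * f (s + r, t)\<bar> powr p))"
        by (rule powr_diff_insert_le[OF p])
      then show "ennreal (\<bar>?\<phi> t\<bar> powr p) * indicator {0..2} t
        \<le> ennreal (2 powr (p - 1)) * (ennreal (\<bar>f (s, t)\<bar> powr p) * indicator {0..2} t
            + ennreal (\<bar>a\<bar> powr p) * (ennreal (\<bar>f (s + r, t)\<bar> powr p) * indicator {0..2} t))"
        by (auto simp: indicator_def abs_mult powr_mult ennreal_mult)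
    qed
    also have "\<dots> = ennreal (2 powr (p - 1)) * ((\<integral>\<^sup>+t\<in>{0..2}. ennreal (\<bar>f (s, t)\<bar> powr p) \<partial>lborel)
        + ennreal (\<bar>a\<bar> powr p) * (\<integral>\<^sup>+t\<in>{0..2}. ennreal (\<bar>f (s + r, t)\<bar> powr p) \<partial>lborel))"
      by (simp add: nn_integral_cmult nn_integral_add)
    also have "\<dots> < \<infinity>" using that unfolding good_def by (simp add: ennreal_mult_less_top)
    finally have \<phi>fin: "(\<integral>\<^sup>+t\<in>{0..2}. ennreal (\<bar>?\<phi> t\<bar> powr p) \<partial>lborel) < \<infinity>" .
    have \<phi>m: "?\<phi> \<in> borel_measurable borel" by measurable
    have Qeq: "Q r r' s t = ennreal (\<bar>?\<phi> t - a' * ?\<phi> (t + r')\<bar> powr p)" for r' t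
    proof -
      have "f (s, t) - a * f (s + r, t) - a' * f (s, t + r') + a * a' * f (s + r, t + r') = ?\<phi> t - a' * ?\<phi> (t + r')"
        by (simp add: algebra_simps)
      then show ?thesis by (simp only: Q_def)
    qed
    show ?thesis unfolding eq Qeq by (rule controlsD[OF cw(2) \<phi>m \<phi>fin])
  qed
  have cl: "0 \<le> x * min \<sigma> 1 \<and> x * min \<sigma> 1 \<le> x" if "\<sigma> \<in> {0..2}" "0 \<le> x" for x \<sigma> :: real
    using that by (auto simp: min_def mult_left_le)
  have const: "(\<integral>\<^sup>+\<sigma>\<in>{0..2::real}. C \<partial>lborel) = 2 * C" for C :: ennreal
    by (subst nn_integral_cmult_indicator) (simp_all add: mult.commute[of _ 2])
  have step: "(\<integral>\<^sup>+s\<in>{0..1}. ennreal (\<bar>G s - a * G (s + r)\<bar> powr p) \<partial>lborel) \<le> ennreal c' * (2 * D)"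
    if r: "0 \<le> r" "r \<le> e" for r
  proof -
    have sh: "AE s in lborel. s + r \<in> {0..2} \<longrightarrow> good (s + r)"
      by (rule AE_lborel_translate[OF AEg])
    have "(\<integral>\<^sup>+s\<in>{0..1}. ennreal (\<bar>G s - a * G (s + r)\<bar> powr p) \<partial>lborel)
       \<le> (\<integral>\<^sup>+s\<in>{0..1}. (ennreal c' * (\<integral>\<^sup>+\<sigma>\<in>{0..2}. (\<integral>\<^sup>+t\<in>{0..1}. Q r (e' * min \<sigma> 1) s t \<partial>lborel) \<partial>lborel)) \<partial>lborel)"
    proof (rule nn_integral_mono_AE)
      show "AE s in lborel. ennreal (\<bar>G s - a * G (s + r)\<bar> powr p) * indicator {0..1} s
        \<le> ennreal c' * (\<integral>\<^sup>+\<sigma>\<in>{0..2}. (\<integral>\<^sup>+t\<in>{0..1}. Q r (e' * min \<sigma> 1) s t \<partial>lborel) \<partial>lborel) * indicator {0..1} s"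
        using AEg sh
      proof eventually_elim
        case (elim s)
        show ?case
        proof (cases "s \<in> {0..1}")
          case True
          then have "good s" "good (s + r)" using elim r nonneg by auto
          from slice[OF this] True show ?thesis by simp
        qed simp
      qed
    qed
    also have "\<dots> = ennreal c' * (\<integral>\<^sup>+s\<in>{0..1}. (\<integral>\<^sup>+\<sigma>\<in>{0..2}. (\<integral>\<^sup>+t\<in>{0..1}. Q r (e' * min \<sigma> 1) s t \<partial>lborel) \<partial>lborel) \<partial>lborel)"
      by (simp add: nn_integral_cmult mult.assoc)
    also have "(\<integral>\<^sup>+s\<in>{0..1}. (\<integral>\<^sup>+\<sigma>\<in>{0..2}. (\<integral>\<^sup>+t\<in>{0..1}. Q r (e' * min \<sigma> 1) s t \<partial>lborel) \<partial>lborel) \<partial>lborel)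
       = (\<integral>\<^sup>+\<sigma>\<in>{0..2}. (\<integral>\<^sup>+s\<in>{0..1}. (\<integral>\<^sup>+t\<in>{0..1}. Q r (e' * min \<sigma> 1) s t \<partial>lborel) \<partial>lborel) \<partial>lborel)"
      by (rule set_nn_integral_swap) measurable
    also have "\<dots> \<le> (\<integral>\<^sup>+\<sigma>\<in>{0..2::real}. D \<partial>lborel)"
    proof (intro nn_integral_mono)
      fix \<sigma> :: real
      have "(\<integral>\<^sup>+s\<in>{0..1}. (\<integral>\<^sup>+t\<in>{0..1}. Q r (e' * min \<sigma> 1) s t \<partial>lborel) \<partial>lborel) \<le> D" if "\<sigma> \<in> {0..2}"
      proof -
        have "(\<integral>\<^sup>+s\<in>{0..1}. (\<integral>\<^sup>+t\<in>{0..1}. Q r (e' * min \<sigma> 1) s t \<partial>lborel) \<partial>lborel)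
          = (\<integral>\<^sup>+(s, t)\<in>unit_square. Q r (e' * min \<sigma> 1) s t \<partial>lborel)"
        proof -
          note [measurable] = fst_borel snd_borel
          have "(\<lambda>z. Q r (e' * min \<sigma> 1) (fst z) (snd z)) \<in> borel_measurable borel" by measurable
          from set_nn_integral_Times[OF this, of "{0..1}" "{0..1}"] show ?thesis
            by (simp add: case_prod_beta)
        qed
        also have "\<dots> \<le> D"
          unfolding Q_def using r cl[OF that \<open>0 \<le> e'\<close>] by (intro bnd) auto
        finally show ?thesis .
      qed
      then show "(\<integral>\<^sup>+s\<in>{0..1}. (\<integral>\<^sup>+t\<in>{0..1}. Q r (e' * min \<sigma> 1) s t \<partial>lborel) \<partial>lborel) * indicator {0..2} \<sigma> \<le> D * indicator {0..2} \<sigma>"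
        by (auto simp: indicator_def)
    qed
    finally show ?thesis by (simp add: const mult_left_mono)
  qed
  have "ennreal (\<bar>\<integral>s. w s * G s \<partial>lborel\<bar> powr p)
      \<le> ennreal c * (\<integral>\<^sup>+\<sigma>\<in>{0..2}. (\<integral>\<^sup>+s\<in>{0..1}. ennreal (\<bar>G s - a * G (s + e * min \<sigma> 1)\<bar> powr p) \<partial>lborel) \<partial>lborel)"
    by (rule controlsD[OF cw(1) Gm Gfin])
  also have "\<dots> \<le> ennreal c * (\<integral>\<^sup>+\<sigma>\<in>{0..2::real}. (ennreal c' * (2 * D)) \<partial>lborel)"
  proof (intro mult_left_mono nn_integral_mono)
    fix \<sigma> :: real
    show "(\<integral>\<^sup>+s\<in>{0..1}. ennreal (\<bar>G s - a * G (s + e * min \<sigma> 1)\<bar> powr p) \<partial>lborel) * indicator {0..2} \<sigma>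
        \<le> (ennreal c' * (2 * D)) * indicator {0..2} \<sigma>"
      using step cl[OF _ \<open>0 \<le> e\<close>] by (auto simp: indicator_def)
  qed simp
  also have "\<dots> = ennreal (4 * c * c') * D"
    unfolding const using nonneg by (simp add: ennreal_mult mult_ac)
  finally show "ennreal (\<bar>\<integral>z. w (fst z) * w' (snd z) * f z \<partial>lborel\<bar> powr p) \<le> ennreal (4 * c * c') * D"
    unfolding LG .
qed

section \<open>Periodic functions on the plane\<close>

definition periodic :: "(real \<times> real \<Rightarrow> 'b) \<Rightarrow> bool" where
  "periodic f \<longleftrightarrow> (\<forall>x y. f (x + 1, y) = f (x, y) \<and> f (x, y + 1) = f (x, y))"

lemma periodic_1d_int:
  fixes \<psi> :: "real \<Rightarrow> 'b"
  assumes "\<And>s. \<psi> (s + 1) = \<psi> s"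
  shows "\<psi> (s + of_int n) = \<psi> s"
proof -
  have nat: "\<psi> (s + of_nat n) = \<psi> s" for s and n :: nat
  proof (induction n)
    case (Suc n)
    then show ?case using assms[of "s + of_nat n"] by (simp add: add_ac)
  qed simp
  show ?thesis
  proof (cases n)
    case (nonneg k)
    then show ?thesis using nat by simp
  next
    case (neg k)
    then show ?thesis using nat[of "s + of_int n" "Suc k"] by (simp add: add_ac)
  qed
qed

lemma periodic_int:
  assumes "periodic f"
  shows "f (x + of_int m, y + of_int n) = f (x, y)"
  using periodic_1d_int[of "\<lambda>x. f (x, y + of_int n)" x m] periodic_1d_int[of "\<lambda>y. f (x, y)" y n] assms
  by (simp add: periodic_def)

lemma nn_integral_shift:
  fixes F :: "real \<Rightarrow> ennreal"
  assumes "F \<in> borel_measurable borel"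
  shows "(\<integral>\<^sup>+s. F (s + q) \<partial>lborel) = (\<integral>\<^sup>+t. F t \<partial>lborel)"
  using nn_integral_real_affine[of F 1 q] assms by (simp add: add.commute)

text \<open>Only the fractional part \<open>r\<close> of \<open>q\<close> matters, and \<open>[r, 1 + r]\<close> is rearranged to \<open>[0, 1]\<close> by moving its part
beyond 1 back by one period.\<close>

lemma nn_integral_periodic_shift_1d:
  fixes \<psi> :: "real \<Rightarrow> ennreal"
  assumes [measurable]: "\<psi> \<in> borel_measurable borel" and per: "\<And>s. \<psi> (s + 1) = \<psi> s"
  shows "(\<integral>\<^sup>+s\<in>{0..1}. \<psi> (s + q) \<partial>lborel) = (\<integral>\<^sup>+s\<in>{0..1}. \<psi> s \<partial>lborel)"
proof -
  define r where "r = q - of_int \<lfloor>q\<rfloor>"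
  have r: "0 \<le> r" "r < 1" unfolding r_def by linarith+
  have eq: "\<psi> (s + q) = \<psi> (s + r)" for s
    using periodic_1d_int[of \<psi>, OF per, of "s + r" "\<lfloor>q\<rfloor>"] by (simp add: r_def add_ac)
  have "(\<integral>\<^sup>+s\<in>{0..1}. \<psi> (s + q) \<partial>lborel)
      = (\<integral>\<^sup>+s. \<psi> (s + r) * indicator {r..<1} (s + r) + \<psi> (s + (r - 1)) * indicator {0..<r} (s + (r - 1)) \<partial>lborel)"
  proof (rule nn_integral_cong_AE)
    show "AE s in lborel. \<psi> (s + q) * indicator {0..1} s
        = \<psi> (s + r) * indicator {r..<1} (s + r) + \<psi> (s + (r - 1)) * indicator {0..<r} (s + (r - 1))"
      using AE_lborel_singleton[of 1]
    proof eventually_elim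
      case (elim s)
      have "\<psi> (s + (r - 1)) = \<psi> (s + r)" using per[of "s + (r - 1)"] by simp
      then show ?case using r elim unfolding eq by (auto simp: indicator_def)
    qed
  qed
  also have "\<dots> = (\<integral>\<^sup>+s. \<psi> (s + r) * indicator {r..<1} (s + r) \<partial>lborel)
      + (\<integral>\<^sup>+s. \<psi> (s + (r - 1)) * indicator {0..<r} (s + (r - 1)) \<partial>lborel)"
    by (rule nn_integral_add) measurable
  also have "\<dots> = (\<integral>\<^sup>+t. \<psi> t * indicator {r..<1} t \<partial>lborel) + (\<integral>\<^sup>+t. \<psi> t * indicator {0..<r} t \<partial>lborel)"
    using nn_integral_shift[of "\<lambda>t. \<psi> t * indicator {r..<1} t" r]
      nn_integral_shift[of "\<lambda>t. \<psi> t * indicator {0..<r} t" "r - 1"] by simp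
  also have "\<dots> = (\<integral>\<^sup>+t. \<psi> t * indicator {r..<1} t + \<psi> t * indicator {0..<r} t \<partial>lborel)"
    by (rule nn_integral_add[symmetric]) measurable
  also have "\<dots> = (\<integral>\<^sup>+t\<in>{0..1}. \<psi> t \<partial>lborel)"
  proof (rule nn_integral_cong_AE)
    show "AE t in lborel. \<psi> t * indicator {r..<1} t + \<psi> t * indicator {0..<r} t = \<psi> t * indicator {0..1} t"
      using AE_lborel_singleton[of 1]
      by eventually_elim (use r in \<open>auto simp: indicator_def\<close>)
  qed
  finally show ?thesis .
qed

lemma nn_integral_periodic_shift:
  fixes F :: "real \<times> real \<Rightarrow> ennreal"
  assumes [measurable]: "F \<in> borel_measurable borel" and per: "periodic F"
  shows "(\<integral>\<^sup>+z\<in>unit_square. F (z + q) \<partial>lborel) = (\<integral>\<^sup>+z\<in>unit_square. F z \<partial>lborel)"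
proof -
  have "(\<integral>\<^sup>+z\<in>unit_square. F (z + q) \<partial>lborel) = (\<integral>\<^sup>+s\<in>{0..1}. (\<integral>\<^sup>+t\<in>{0..1}. F (s + fst q, t + snd q) \<partial>lborel) \<partial>lborel)"
  proof -
    have "(\<lambda>z. F (z + q)) \<in> borel_measurable borel" by measurable
    from set_nn_integral_Times[OF this, of "{0..1}" "{0..1}"] show ?thesis by (simp add: plus_prod_def)
  qed
  also have "\<dots> = (\<integral>\<^sup>+s\<in>{0..1}. (\<integral>\<^sup>+t\<in>{0..1}. F (s + fst q, t) \<partial>lborel) \<partial>lborel)"
    using per by (subst nn_integral_periodic_shift_1d) (auto simp: periodic_def)
  also have "\<dots> = (\<integral>\<^sup>+s\<in>{0..1}. (\<integral>\<^sup>+t\<in>{0..1}. F (s, t) \<partial>lborel) \<partial>lborel)"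
    using nn_integral_periodic_shift_1d[of "\<lambda>s. \<integral>\<^sup>+t\<in>{0..1}. F (s, t) \<partial>lborel" "fst q"] per
    by (simp add: periodic_def)
  also have "\<dots> = (\<integral>\<^sup>+z\<in>unit_square. F z \<partial>lborel)"
    by (subst set_nn_integral_Times) auto
  finally show ?thesis .
qed

lemma nn_integral_big_square_finite:
  fixes F :: "real \<times> real \<Rightarrow> ennreal"
  assumes [measurable]: "F \<in> borel_measurable borel" and per: "periodic F"
    and fin: "(\<integral>\<^sup>+z\<in>unit_square. F z \<partial>lborel) < \<infinity>"
  shows "(\<integral>\<^sup>+z\<in>{0..2} \<times> {0..2}. F z \<partial>lborel) < \<infinity>"
proof -
  let ?I = "\<integral>\<^sup>+z\<in>unit_square. F z \<partial>lborel"
  have [measurable]: "unit_square \<in> sets borel" by (intro borel_Times) auto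
  have sh: "(\<integral>\<^sup>+z. F z * indicator unit_square (z - q) \<partial>lborel) = ?I" for q
  proof -
    have "(\<integral>\<^sup>+z. F z * indicator unit_square (z - q) \<partial>lborel)
       = (\<integral>\<^sup>+z. F z * indicator unit_square (z - q) \<partial>(distr lborel borel ((+) q)))"
      by (simp add: lborel_distr_plus)
    also have "\<dots> = (\<integral>\<^sup>+z\<in>unit_square. F (z + q) \<partial>lborel)"
      by (subst nn_integral_distr) (auto simp: add.commute)
    finally show ?thesis using nn_integral_periodic_shift[OF _ per] by simp
  qed
  let ?u = "\<lambda>q z. F z * indicator unit_square (z - q)"
  have "(\<integral>\<^sup>+z\<in>{0..2} \<times> {0..2}. F z \<partial>lborel)
      \<le> (\<integral>\<^sup>+z. ?u (0,0) z + ?u (1,0) z + ?u (0,1) z + ?u (1,1) z \<partial>lborel)"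
    by (intro nn_integral_mono) (auto simp: indicator_def minus_prod_def)
  also have "\<dots> = ?I + ?I + ?I + ?I"
    by (simp add: nn_integral_add sh)
  also have "\<dots> < \<infinity>" using fin by simp
  finally show ?thesis .
qed

text \<open>The integer translates of the half-open unit square cover the plane, and there are countably many of them.\<close>

lemma AE_periodic:
  assumes per: "periodic P" and ae: "AE z in lborel. z \<in> {0..<1} \<times> {0..<1} \<longrightarrow> P z"
  shows "AE z in lborel. P (z :: real \<times> real)"
proof -
  have all: "AE z in lborel. \<forall>q\<in>(\<lambda>(m, n). (of_int m, of_int n)) ` (UNIV :: (int \<times> int) set). z + q \<in> {0..<1} \<times> {0..<1} \<longrightarrow> P (z + q)"
  proof (subst AE_ball_countable, simp, intro ballI)
    fix q :: "real \<times> real"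
    show "AE z in lborel. z + q \<in> {0..<1} \<times> {0..<1} \<longrightarrow> P (z + q)"
      by (rule AE_lborel_translate[OF ae])
  qed
  show ?thesis using all
  proof eventually_elim
    case (elim z)
    let ?q = "(of_int (- \<lfloor>fst z\<rfloor>), of_int (- \<lfloor>snd z\<rfloor>)) :: real \<times> real"
    have qi: "?q \<in> (\<lambda>(m, n). (of_int m, of_int n)) ` (UNIV :: (int \<times> int) set)"
      by (rule image_eqI[of _ _ "(- \<lfloor>fst z\<rfloor>, - \<lfloor>snd z\<rfloor>)"]) auto
    have zi: "z + ?q \<in> {0..<1} \<times> {0..<1}"
      by (cases z) (auto, linarith+)
    have "P (z + ?q)" by (rule mp[OF bspec[OF elim qi] zi])
    then show "P z" using periodic_int[OF per, of "fst z" "- \<lfloor>fst z\<rfloor>" "snd z" "- \<lfloor>snd z\<rfloor>"]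
      by (simp add: plus_prod_def)
  qed
qed

lemma powr_le_imp_abs_le:
  fixes X W C p :: real
  assumes "p > 1" "ennreal (\<bar>X\<bar> powr p) \<le> ennreal (4 * C) * ennreal (W powr p)" "C \<ge> 0" "W \<ge> 0"
  shows "\<bar>X\<bar> \<le> 4 * C powr (1 / p) * W"
proof -
  have "\<bar>X\<bar> powr p \<le> 4 * C * W powr p"
    using assms by (simp add: ennreal_mult[symmetric] ennreal_le_iff)
  then have "(\<bar>X\<bar> powr p) powr (1 / p) \<le> (4 * C * W powr p) powr (1 / p)"
    using assms by (intro powr_mono2) auto
  then have "\<bar>X\<bar> \<le> 4 powr (1 / p) * (C powr (1 / p) * W)"
    using assms by (simp add: powr_powr powr_mult mult.assoc)
  also have "\<dots> \<le> 4 powr 1 * (C powr (1 / p) * W)"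
    using assms by (intro mult_right_mono powr_mono) auto
  finally show ?thesis by simp
qed

text \<open>The \<open>p\<close>-th power of the \<open>L\<^sup>p\<close> norm; estimates are made for it, since Fubini's theorem applies to it directly.\<close>

definition power_integral :: "real \<Rightarrow> (real \<times> real \<Rightarrow> real) \<Rightarrow> ennreal" where
  "power_integral p f = (\<integral>\<^sup>+z\<in>unit_square. ennreal (\<bar>f z\<bar> powr p) \<partial>lborel)"

lemma Lp_norm_eq_power_integral:
  "Lp_norm p f = (if power_integral p f = \<infinity> then \<infinity> else ennreal (enn2real (power_integral p f) powr (1 / p)))"
  by (simp add: Lp_norm_def power_integral_def nn_integral_completion Let_def)

lemma power_integral_le:
  assumes "p > 1" "Lp_norm p f \<le> ennreal W" "W \<ge> 0"
  shows "power_integral p f \<le> ennreal (W powr p)"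
proof -
  have fin: "power_integral p f \<noteq> \<infinity>"
    using assms(2) by (auto simp: Lp_norm_eq_power_integral top_unique split: if_splits)
  let ?n = "enn2real (power_integral p f)"
  have "?n powr (1 / p) \<le> W" using fin assms by (simp add: Lp_norm_eq_power_integral ennreal_le_iff)
  then have "(?n powr (1 / p)) powr p \<le> W powr p" using assms by (intro powr_mono2) auto
  then have "?n \<le> W powr p" using assms by (simp add: powr_powr)
  then have "ennreal ?n \<le> ennreal (W powr p)" by (rule ennreal_leI)
  moreover have "ennreal ?n = power_integral p f" using fin by (simp add: ennreal_enn2real_if)
  ultimately show ?thesis by simp
qed

section \<open>Box averages\<close>

definition smear :: "(real \<Rightarrow> real) \<Rightarrow> (real \<Rightarrow> real) \<Rightarrow> (real \<times> real \<Rightarrow> real) \<Rightarrow> real \<times> real \<Rightarrow> real" where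
  "smear w w' f z = (\<integral>y. w (fst y) * w' (snd y) * f (z + y) \<partial>lborel)"

text \<open>By periodicity the hypotheses, stated for \<open>f\<close> on the unit square, carry over to the translate of \<open>f\<close> by \<open>z\<close>.
The bound is therefore uniform in \<open>z\<close>.\<close>

lemma smear_abs_le:
  fixes f :: "real \<times> real \<Rightarrow> real"
  assumes p: "p > 1"
    and w: "w \<in> borel_measurable borel" "w' \<in> borel_measurable borel"
    and wB: "\<And>s. \<bar>w s\<bar> \<le> B * indicator {0..1} s" "\<And>s. \<bar>w' s\<bar> \<le> B' * indicator {0..1} s"
    and cw: "controls p w c a e" "controls p w' c' a' e'"
    and nonneg: "0 \<le> c" "0 \<le> c'" "0 \<le> e" "e \<le> 1" "0 \<le> e'" "e' \<le> 1"
    and f [measurable]: "f \<in> borel_measurable borel" and per: "periodic f"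
    and fin: "power_integral p f < \<infinity>"
    and bnd: "\<And>r r'. 0 \<le> r \<Longrightarrow> r \<le> e \<Longrightarrow> 0 \<le> r' \<Longrightarrow> r' \<le> e' \<Longrightarrow>
       power_integral p (\<lambda>(s, t). f (s, t) - a * f (s + r, t) - a' * f (s, t + r') + a * a' * f (s + r, t + r')) \<le> ennreal (W powr p)"
    and W: "W \<ge> 0"
  shows "integrable lborel (\<lambda>y. w (fst y) * w' (snd y) * f (z + y))"
    and "\<bar>smear w w' f z\<bar> \<le> 4 * (c * c') powr (1 / p) * W"
proof -
  let ?f = "\<lambda>y. f (z + y)"
  have 1: "?f \<in> borel_measurable borel" by measurable
  have pF: "periodic (\<lambda>z. ennreal (\<bar>f z\<bar> powr p))" using per by (simp add: periodic_def)
  have "(\<integral>\<^sup>+y\<in>unit_square. ennreal (\<bar>?f y\<bar> powr p) \<partial>lborel) < \<infinity>"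
    using nn_integral_periodic_shift[OF _ pF, of z] fin by (simp add: power_integral_def add.commute)
  moreover have "periodic (\<lambda>y. ennreal (\<bar>?f y\<bar> powr p))"
  proof -
    have "f (z + (x + 1, y)) = f (z + (x, y))" "f (z + (x, y + 1)) = f (z + (x, y))" for x y
      using per by (simp_all add: periodic_def plus_prod_def add.assoc[symmetric])
    then show ?thesis by (simp add: periodic_def)
  qed
  ultimately have 2: "(\<integral>\<^sup>+y\<in>{0..2}\<times>{0..2}. ennreal (\<bar>?f y\<bar> powr p) \<partial>lborel) < \<infinity>"
    by (intro nn_integral_big_square_finite) auto
  have 3: "(\<integral>\<^sup>+(s, t)\<in>unit_square. ennreal (\<bar>?f (s, t) - a * ?f (s + r, t) - a' * ?f (s, t + r') + a * a' * ?f (s + r, t + r')\<bar> powr p) \<partial>lborel)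
      \<le> ennreal (W powr p)" if "0 \<le> r" "r \<le> e" "0 \<le> r'" "r' \<le> e'" for r r'
  proof -
    define H where "H = (\<lambda>(s, t). ennreal (\<bar>f (s, t) - a * f (s + r, t) - a' * f (s, t + r') + a * a' * f (s + r, t + r')\<bar> powr p))"
    have Hm: "H \<in> borel_measurable borel" unfolding H_def by (subst borel_prod[symmetric]) measurable
    have Hp: "periodic H" unfolding periodic_def
    proof (intro allI conjI)
      fix x y
      have "f (x + 1 + r, y') = f (x + r, y')" "f (x', y + 1 + r') = f (x', y + r')" for x' y'
        using per unfolding periodic_def by (metis add.assoc add.commute)+
      then show "H (x + 1, y) = H (x, y)" "H (x, y + 1) = H (x, y)"
        using per by (auto simp: H_def periodic_def)
    qed
    have "(\<integral>\<^sup>+(s, t)\<in>unit_square. ennreal (\<bar>?f (s, t) - a * ?f (s + r, t) - a' * ?f (s, t + r') + a * a' * ?f (s + r, t + r')\<bar> powr p) \<partial>lborel)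
       = (\<integral>\<^sup>+y\<in>unit_square. H (y + z) \<partial>lborel)"
      by (intro nn_integral_cong) (auto simp: H_def plus_prod_def case_prod_beta add_ac)
    also have "\<dots> = (\<integral>\<^sup>+y\<in>unit_square. H y \<partial>lborel)"
      by (rule nn_integral_periodic_shift[OF Hm Hp])
    also have "\<dots> = power_integral p (\<lambda>(s, t). f (s, t) - a * f (s + r, t) - a' * f (s, t + r') + a * a' * f (s + r, t + r'))"
      unfolding power_integral_def by (intro nn_integral_cong) (auto simp: H_def)
    finally show ?thesis using bnd[OF that] by simp
  qed
  note T = tensor_powr_le[OF p w wB cw nonneg 1 2 3]
  show "integrable lborel (\<lambda>y. w (fst y) * w' (snd y) * f (z + y))" by (rule T(1))
  show "\<bar>smear w w' f z\<bar> \<le> 4 * (c * c') powr (1 / p) * W"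
    unfolding smear_def using T(2) nonneg W by (intro powr_le_imp_abs_le[OF p]) (auto simp: mult.assoc)
qed

lemma avg_weight_abs_le:
  assumes "0 < h" "h \<le> 1"
  shows "\<bar>avg_weight h s\<bar> \<le> (1 / h) * indicator {0..1} s"
  using assms by (auto simp: avg_weight_def indicator_def)

lemma avg_weight_diff_abs_le:
  assumes "0 < h" "h \<le> 1" "0 < H" "H \<le> 1"
  shows "\<bar>avg_weight h s - avg_weight H s\<bar> \<le> (1 / h + 1 / H) * indicator {0..1} s"
  using avg_weight_abs_le[OF assms(1,2), of s] avg_weight_abs_le[OF assms(3,4), of s]
  by (simp add: distrib_right)

definition box_average :: "real \<Rightarrow> real \<Rightarrow> (real \<times> real \<Rightarrow> real) \<Rightarrow> real \<times> real \<Rightarrow> real" where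
  "box_average h g = smear (avg_weight h) (avg_weight g)"

locale periodic_Lp =
  fixes p :: real and f :: "real \<times> real \<Rightarrow> real"
  assumes p: "p > 1" and f_borel [measurable]: "f \<in> borel_measurable borel"
    and per: "periodic f" and fin: "power_integral p f < \<infinity>"
begin

lemma power_integral_real: "\<exists>W\<ge>0. power_integral p f \<le> ennreal (W powr p)"
proof (intro exI conjI)
  let ?W = "enn2real (power_integral p f) powr (1 / p)"
  show "power_integral p f \<le> ennreal (?W powr p)"
    using fin p by (simp add: powr_powr ennreal_enn2real_if less_top)
qed simp

lemma box_average_integrable:
  assumes "0 < h" "h \<le> 1" "0 < g" "g \<le> 1"
  shows "integrable lborel (\<lambda>y. avg_weight h (fst y) * avg_weight g (snd y) * f (z + y))"
proof -
  obtain W where "W \<ge> 0" "power_integral p f \<le> ennreal (W powr p)" using power_integral_real by blast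
  then show ?thesis
    using assms
    by (intro smear_abs_le(1)[OF p _ _ avg_weight_abs_le avg_weight_abs_le
        controls_avg_weight[OF p] controls_avg_weight[OF p] _ _ _ _ _ _ f_borel per fin, where W = W]) auto
qed

lemma box_average_abs_le:
  assumes "0 < h" "h \<le> 1" "0 < g" "g \<le> 1" "power_integral p f \<le> ennreal (W powr p)" "W \<ge> 0"
  shows "\<bar>box_average h g f z\<bar> \<le> 4 * (1 / h * (1 / g)) powr (1 / p) * W"
  unfolding box_average_def using assms
  by (intro smear_abs_le(2)[OF p _ _ avg_weight_abs_le avg_weight_abs_le
      controls_avg_weight[OF p] controls_avg_weight[OF p] _ _ _ _ _ _ f_borel per fin]) auto

lemma box_average_diff_x:
  assumes "0 < h" "h \<le> 1" "0 < H" "H \<le> 1" "0 < g" "g \<le> 1"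
  shows "box_average h g f z - box_average H g f z = smear (\<lambda>t. avg_weight h t - avg_weight H t) (avg_weight g) f z"
  unfolding box_average_def smear_def
  using Bochner_Integration.integral_diff[OF box_average_integrable[of h g z] box_average_integrable[of H g z]] assms
  by (simp add: left_diff_distrib)

lemma box_average_diff_y:
  assumes "0 < h" "h \<le> 1" "0 < H" "H \<le> 1" "0 < g" "g \<le> 1"
  shows "box_average g h f z - box_average g H f z = smear (avg_weight g) (\<lambda>t. avg_weight h t - avg_weight H t) f z"
  unfolding box_average_def smear_def
  using Bochner_Integration.integral_diff[OF box_average_integrable[of g h z] box_average_integrable[of g H z]] assms
  by (simp add: left_diff_distrib right_diff_distrib)

lemma box_average_diff_xy:
  assumes "0 < h" "h \<le> 1" "0 < H" "H \<le> 1" "0 < g" "g \<le> 1" "0 < G" "G \<le> 1"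
  shows "(box_average h g f z - box_average H g f z) - (box_average h G f z - box_average H G f z)
    = smear (\<lambda>t. avg_weight h t - avg_weight H t) (\<lambda>t. avg_weight g t - avg_weight G t) f z"
proof -
  let ?A = "\<lambda>h g y. avg_weight h (fst y) * avg_weight g (snd y) * f (z + y)"
  have "(box_average h g f z - box_average H g f z) - (box_average h G f z - box_average H G f z)
      = (\<integral>y. (?A h g y - ?A H g y) - (?A h G y - ?A H G y) \<partial>lborel)"
    unfolding box_average_def smear_def using assms
    by (simp add: Bochner_Integration.integral_diff box_average_integrable)
  also have "\<dots> = smear (\<lambda>t. avg_weight h t - avg_weight H t) (\<lambda>t. avg_weight g t - avg_weight G t) f z"
    unfolding smear_def by (intro Bochner_Integration.integral_cong) (simp_all add: algebra_simps)
  finally show ?thesis .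
qed

lemma power_integral_diff_le:
  assumes "modulus p f \<delta> \<le> ennreal W" "W \<ge> 0" "norm k \<le> \<delta>"
  shows "power_integral p (diff k f) \<le> ennreal (W powr p)"
proof (rule power_integral_le[OF p _ assms(2)])
  have "Lp_norm p (diff k f) \<le> modulus p f \<delta>"
    unfolding modulus_def using assms(3) by (intro SUP_upper) auto
  then show "Lp_norm p (diff k f) \<le> ennreal W" using assms(1) by (rule order_trans)
qed

lemma power_integral_mixed_diff_le:
  assumes "mixed_modulus p f u v \<le> ennreal W" "W \<ge> 0" "0 \<le> r" "r \<le> u" "0 \<le> r'" "r' \<le> v"
  shows "power_integral p (mixed_diff r r' f) \<le> ennreal (W powr p)"
proof (rule power_integral_le[OF p _ assms(2)])
  have "(case (r, r') of (s, t) \<Rightarrow> Lp_norm p (mixed_diff s t f)) \<le> mixed_modulus p f u v"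
    unfolding mixed_modulus_def using assms(3-) by (intro SUP_upper) auto
  then show "Lp_norm p (mixed_diff r r' f) \<le> ennreal W" using assms(1) by simp
qed

lemma increment_x_abs_le:
  assumes hs: "0 < h" "h \<le> 1" "0 < H" "H \<le> 1" "0 < g" "g \<le> 1"
    and cw: "controls p (\<lambda>t. avg_weight h t - avg_weight H t) c 1 e" "0 \<le> c" "0 \<le> e" "e \<le> 1"
    and W: "modulus p f e \<le> ennreal W" "W \<ge> 0"
  shows "\<bar>box_average h g f z - box_average H g f z\<bar> \<le> 4 * (c * (1 / g)) powr (1 / p) * W"
  unfolding box_average_diff_x[OF hs]
proof (rule smear_abs_le(2)[OF p _ _ avg_weight_diff_abs_le[OF hs(1-4)] avg_weight_abs_le[OF hs(5,6)] cw(1)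
      controls_avg_weight[OF p hs(5,6)] cw(2) _ cw(3,4) _ _ f_borel per fin _ W(2)])
  fix r r' :: real assume r: "0 \<le> r" "r \<le> e" "0 \<le> r'" "r' \<le> 0"
  have "(\<lambda>(s, t). f (s, t) - 1 * f (s + r, t) - 0 * f (s, t + r') + 1 * 0 * f (s + r, t + r')) = (\<lambda>z. - diff (r, 0) f z)"
    by (auto simp: diff_def)
  then show "power_integral p (\<lambda>(s, t). f (s, t) - 1 * f (s + r, t) - 0 * f (s, t + r') + 1 * 0 * f (s + r, t + r')) \<le> ennreal (W powr p)"
    using power_integral_diff_le[OF W, of "(r, 0)"] r by (simp add: power_integral_def)
qed (use hs in auto)

lemma increment_y_abs_le:
  assumes hs: "0 < h" "h \<le> 1" "0 < H" "H \<le> 1" "0 < g" "g \<le> 1"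
    and cw: "controls p (\<lambda>t. avg_weight h t - avg_weight H t) c 1 e" "0 \<le> c" "0 \<le> e" "e \<le> 1"
    and W: "modulus p f e \<le> ennreal W" "W \<ge> 0"
  shows "\<bar>box_average g h f z - box_average g H f z\<bar> \<le> 4 * (1 / g * c) powr (1 / p) * W"
  unfolding box_average_diff_y[OF hs]
proof (rule smear_abs_le(2)[OF p _ _ avg_weight_abs_le[OF hs(5,6)] avg_weight_diff_abs_le[OF hs(1-4)]
      controls_avg_weight[OF p hs(5,6)] cw(1) _ cw(2) _ _ cw(3,4) f_borel per fin _ W(2)])
  fix r r' :: real assume r: "0 \<le> r" "r \<le> 0" "0 \<le> r'" "r' \<le> e"
  have "(\<lambda>(s, t). f (s, t) - 0 * f (s + r, t) - 1 * f (s, t + r') + 0 * 1 * f (s + r, t + r')) = (\<lambda>z. - diff (0, r') f z)"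
    by (auto simp: diff_def)
  then show "power_integral p (\<lambda>(s, t). f (s, t) - 0 * f (s + r, t) - 1 * f (s, t + r') + 0 * 1 * f (s + r, t + r')) \<le> ennreal (W powr p)"
    using power_integral_diff_le[OF W, of "(0, r')"] r by (simp add: power_integral_def)
qed (use hs in auto)

lemma increment_xy_abs_le:
  assumes hs: "0 < h" "h \<le> 1" "0 < H" "H \<le> 1" "0 < g" "g \<le> 1" "0 < G" "G \<le> 1"
    and cw: "controls p (\<lambda>t. avg_weight h t - avg_weight H t) c 1 e" "0 \<le> c" "0 \<le> e" "e \<le> 1"
    and cw': "controls p (\<lambda>t. avg_weight g t - avg_weight G t) c' 1 e'" "0 \<le> c'" "0 \<le> e'" "e' \<le> 1"
    and W: "mixed_modulus p f e e' \<le> ennreal W" "W \<ge> 0"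
  shows "\<bar>(box_average h g f z - box_average H g f z) - (box_average h G f z - box_average H G f z)\<bar>
    \<le> 4 * (c * c') powr (1 / p) * W"
  unfolding box_average_diff_xy[OF hs]
proof (rule smear_abs_le(2)[OF p _ _ avg_weight_diff_abs_le[OF hs(1-4)] avg_weight_diff_abs_le[OF hs(5-8)] cw(1) cw'(1)
     cw(2) cw'(2) cw(3,4) cw'(3,4) f_borel per fin _ W(2)])
  fix r r' :: real assume r: "0 \<le> r" "r \<le> e" "0 \<le> r'" "r' \<le> e'"
  have "(\<lambda>(s, t). f (s, t) - 1 * f (s + r, t) - 1 * f (s, t + r') + 1 * 1 * f (s + r, t + r')) = mixed_diff r r' f"
    by (auto simp: mixed_diff_def)
  then show "power_integral p (\<lambda>(s, t). f (s, t) - 1 * f (s + r, t) - 1 * f (s, t + r') + 1 * 1 * f (s + r, t + r')) \<le> ennreal (W powr p)"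
    using power_integral_mixed_diff_le[OF W r] by simp
qed auto

lemma diff_periodic: "periodic (diff k f)"
proof -
  have "f ((x + 1, y) + k) = f ((x, y) + k)" "f ((x, y + 1) + k) = f ((x, y) + k)" for x y
    using per unfolding periodic_def plus_prod_def fst_conv snd_conv by (metis add.assoc add.commute)+
  then show ?thesis using per by (simp add: periodic_def diff_def)
qed

text \<open>The difference of the values at two points is the box average of a difference of \<open>f\<close>, so its size is at most a
constant, depending on the box, times the modulus of continuity of \<open>f\<close> at the distance of the points.\<close>

lemma box_average_continuous:
  assumes hg: "0 < h" "h \<le> 1" "0 < g" "g \<le> 1"
    and small: "\<And>\<epsilon>. \<epsilon> > 0 \<Longrightarrow> \<exists>\<delta>>0. modulus p f \<delta> \<le> ennreal \<epsilon>"
  shows "continuous_on UNIV (box_average h g f)"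
proof -
  let ?C = "4 * (1 / h * (1 / g)) powr (1 / p)"
  have C: "?C > 0" using hg by auto
  have "\<exists>\<delta>>0. \<forall>z'. dist z' z < \<delta> \<longrightarrow> dist (box_average h g f z') (box_average h g f z) < \<epsilon>" if "\<epsilon> > 0" for \<epsilon> z
  proof -
    define \<eta> where "\<eta> = \<epsilon> / (2 * ?C)"
    have \<eta>: "\<eta> > 0" using that C by (simp add: \<eta>_def)
    obtain \<delta> where \<delta>: "\<delta> > 0" "modulus p f \<delta> \<le> ennreal \<eta>" using small[OF \<eta>] by blast
    show ?thesis
    proof (intro exI[of _ \<delta>] conjI allI impI \<delta>(1))
      fix z' assume "dist z' z < \<delta>"
      define k where "k = z' - z"
      have k: "norm k \<le> \<delta>" using \<open>dist z' z < \<delta>\<close> by (simp add: k_def dist_norm)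
      have pk: "power_integral p (diff k f) \<le> ennreal (\<eta> powr p)"
        using power_integral_diff_le[OF \<delta>(2) _ k] \<eta> by simp
      have "diff k f \<in> borel_measurable borel" unfolding diff_def[abs_def] by measurable
      then interpret D: periodic_Lp p "diff k f"
        using p diff_periodic pk by unfold_locales (auto intro: le_less_trans simp: less_top)
      have "box_average h g (diff k f) z = box_average h g f z' - box_average h g f z"
        unfolding box_average_def smear_def diff_def
        using Bochner_Integration.integral_diff[OF box_average_integrable[OF hg, of z'] box_average_integrable[OF hg, of z]]
        by (simp add: right_diff_distrib k_def add_ac)
      then have "\<bar>box_average h g f z' - box_average h g f z\<bar> \<le> ?C * \<eta>"
        using D.box_average_abs_le[OF hg pk, of z] \<eta> by simp
      also have "\<dots> = \<epsilon> / 2" using C by (simp add: \<eta>_def)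
      finally show "dist (box_average h g f z') (box_average h g f z) < \<epsilon>" using that by (simp add: dist_real_def)
    qed
  qed
  then show ?thesis by (simp add: continuous_on_iff)
qed

lemma box_average_borel [measurable]: "box_average h g f \<in> borel_measurable borel"
proof -
  note [measurable] = measurable_compose[OF fst_borel avg_weight_measurable] measurable_compose[OF snd_borel avg_weight_measurable]
  show ?thesis unfolding box_average_def smear_def[abs_def] by measurable
qed

text \<open>Jensen's inequality bounds \<open>\<bar>A f - f\<bar>\<^sup>p\<close> at \<open>z\<close> by the mean of \<open>\<bar>f(z + y) - f(z)\<bar>\<^sup>p\<close> over \<open>y\<close> in the box.
The integrals over \<open>z\<close> and \<open>y\<close> are then exchanged.\<close>

lemma box_average_Lp_close:
  assumes hg: "0 < h" "h \<le> 1" "0 < g" "g \<le> 1" and W: "modulus p f (h + g) \<le> ennreal W" "W \<ge> 0"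
  shows "power_integral p (\<lambda>z. box_average h g f z - f z) \<le> ennreal (W powr p)"
proof -
  let ?S = "{0..h} \<times> {0..g}"
  have S [measurable]: "?S \<in> sets borel" by (intro borel_Times) auto
  have [measurable]: "unit_square \<in> sets borel" by (intro borel_Times) auto
  have m: "emeasure lborel ?S = ennreal (h * g)"
  proof -
    have "emeasure lborel ?S = emeasure (lborel \<Otimes>\<^sub>M lborel) ?S" by (simp add: lborel_prod)
    also have "\<dots> = emeasure lborel {0..h} * emeasure lborel {0..g}"
      by (rule lborel.emeasure_pair_measure_Times) auto
    finally show ?thesis using hg by (simp add: ennreal_mult)
  qed
  have avg: "avg_weight h (fst y) * avg_weight g (snd y) = indicator ?S y / (h * g)" for y
    by (cases y) (auto simp: avg_weight_def indicator_def)
  have point: "ennreal (\<bar>box_average h g f z - f z\<bar> powr p)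
      \<le> ennreal (1 / (h * g)) * (\<integral>\<^sup>+y\<in>?S. ennreal (\<bar>diff y f z\<bar> powr p) \<partial>lborel)" for z
  proof -
    have int: "integrable lborel (\<lambda>y. indicator ?S y / (h * g) * f (z + y))"
      using box_average_integrable[OF hg, of z] by (simp add: avg)
    have intS: "integrable lborel (\<lambda>y. indicator ?S y / (h * g) * f z)"
      using m by (intro integrable_mult_left integrable_divide) (simp add: integrable_indicator_iff)
    have "measure lborel ?S = h * g" using m hg by (simp add: measure_def)
    then have "(\<integral>y. indicator ?S y / (h * g) * f z \<partial>lborel) = f z"
      using hg by simp
    then have "box_average h g f z - f z = (\<integral>y. indicator ?S y / (h * g) * f (z + y) - indicator ?S y / (h * g) * f z \<partial>lborel)"
      unfolding box_average_def smear_def avg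
      by (subst Bochner_Integration.integral_diff[OF int intS]) simp
    also have "\<dots> = (\<integral>y. indicator ?S y * (diff y f z / (h * g)) \<partial>lborel)"
      by (intro Bochner_Integration.integral_cong) (auto simp: diff_def diff_divide_distrib right_diff_distrib)
    finally have "ennreal (\<bar>box_average h g f z - f z\<bar> powr p)
       \<le> ennreal ((h * g) powr (p - 1)) * (\<integral>\<^sup>+y\<in>?S. ennreal (\<bar>diff y f z / (h * g)\<bar> powr p) \<partial>lborel)"
      using set_integral_powr_le[OF p _ m, of "\<lambda>y. diff y f z / (h * g)"] hg by (simp add: diff_def)
    also have "\<dots> = ennreal ((h * g) powr (p - 1)) * (\<integral>\<^sup>+y. ennreal ((h * g) powr (-p)) * (ennreal (\<bar>diff y f z\<bar> powr p) * indicator ?S y) \<partial>lborel)"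
    proof -
      have "ennreal (\<bar>d / (h * g)\<bar> powr p) = ennreal ((h * g) powr (-p)) * ennreal (\<bar>d\<bar> powr p)" for d
      proof -
        have "\<bar>d / (h * g)\<bar> = \<bar>d\<bar> / (h * g)" using hg by (simp add: abs_mult)
        then have "\<bar>d / (h * g)\<bar> powr p = (h * g) powr (-p) * \<bar>d\<bar> powr p"
          using hg by (simp only: powr_divide powr_minus_divide) simp
        then show ?thesis by (simp add: ennreal_mult)
      qed
      then show ?thesis by (simp add: mult.assoc)
    qed
    also have "\<dots> = ennreal ((h * g) powr (p - 1)) * (ennreal ((h * g) powr (-p)) * (\<integral>\<^sup>+y\<in>?S. ennreal (\<bar>diff y f z\<bar> powr p) \<partial>lborel))"
      unfolding diff_def by (subst nn_integral_cmult) auto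
    also have "\<dots> = ennreal ((h * g) powr (p - 1) * (h * g) powr (-p)) * (\<integral>\<^sup>+y\<in>?S. ennreal (\<bar>diff y f z\<bar> powr p) \<partial>lborel)"
      by (simp add: ennreal_mult mult.assoc)
    also have "(h * g) powr (p - 1) * (h * g) powr (-p) = 1 / (h * g)"
      using powr_add[of "h * g" "p - 1" "-p"] powr_minus_divide[of "h * g" 1] hg by simp
    finally show ?thesis .
  qed
  have "power_integral p (\<lambda>z. box_average h g f z - f z)
     \<le> (\<integral>\<^sup>+z. ennreal (1 / (h * g)) * ((\<integral>\<^sup>+y. ennreal (\<bar>diff y f z\<bar> powr p) * indicator ?S y \<partial>lborel) * indicator unit_square z) \<partial>lborel)"
    unfolding power_integral_def
  proof (intro nn_integral_mono)
    fix z
    show "ennreal (\<bar>box_average h g f z - f z\<bar> powr p) * indicator unit_square z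
      \<le> ennreal (1 / (h * g)) * ((\<integral>\<^sup>+y. ennreal (\<bar>diff y f z\<bar> powr p) * indicator ?S y \<partial>lborel) * indicator unit_square z)"
      using point[of z] by (auto simp: indicator_def)
  qed
  also have "\<dots> = ennreal (1 / (h * g)) * (\<integral>\<^sup>+z. (\<integral>\<^sup>+y. ennreal (\<bar>diff y f z\<bar> powr p) * indicator ?S y * indicator unit_square z \<partial>lborel) \<partial>lborel)"
    unfolding diff_def by (simp add: nn_integral_cmult nn_integral_multc)
  also have "(\<integral>\<^sup>+z. (\<integral>\<^sup>+y. ennreal (\<bar>diff y f z\<bar> powr p) * indicator ?S y * indicator unit_square z \<partial>lborel) \<partial>lborel)
    = (\<integral>\<^sup>+y. (\<integral>\<^sup>+z. ennreal (\<bar>diff y f z\<bar> powr p) * indicator ?S y * indicator unit_square z \<partial>lborel) \<partial>lborel)"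
    unfolding diff_def by (rule lborel_pair.Fubini') measurable
  also have "\<dots> \<le> (\<integral>\<^sup>+y\<in>?S. ennreal (W powr p) \<partial>lborel)"
  proof (intro nn_integral_mono)
    fix y :: "real \<times> real"
    have "(\<integral>\<^sup>+z\<in>unit_square. ennreal (\<bar>diff y f z\<bar> powr p) \<partial>lborel) \<le> ennreal (W powr p)" if "y \<in> ?S"
    proof -
      have "norm y \<le> h + g" using that norm_Pair_le[of "fst y" "snd y"] by auto
      then show ?thesis using power_integral_diff_le[OF W] by (simp add: power_integral_def)
    qed
    then show "(\<integral>\<^sup>+z. ennreal (\<bar>diff y f z\<bar> powr p) * indicator ?S y * indicator unit_square z \<partial>lborel) \<le> ennreal (W powr p) * indicator ?S y"
      by (auto simp: indicator_def)
  qed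
  also have "\<dots> = ennreal (W powr p) * ennreal (h * g)" using m by (simp add: nn_integral_cmult_indicator)
  also have "ennreal (1 / (h * g)) * \<dots> = ennreal (W powr p)"
    using hg by (simp add: ennreal_mult[symmetric])
  finally show ?thesis by (simp add: mult_left_mono)
qed

end

section \<open>Choosing the scales\<close>

lemma borel_measurable_mono_ennreal:
  fixes m :: "real \<Rightarrow> ennreal"
  assumes "mono m"
  shows "m \<in> borel_measurable borel"
proof (rule borel_measurableI_greater)
  fix y
  have "is_interval {x. y < m x}"
    unfolding is_interval_1 using monoD[OF assms] by (auto intro: less_le_trans)
  then show "{x \<in> space borel. y < m x} \<in> sets borel"
    using real_interval_borel_measurable by simp
qed

lemma geometric_blocks:
  fixes K :: real
  assumes K: "K > 1"
  shows "disjoint_family (\<lambda>j. {1 / K ^ Suc j<..1 / K ^ j})" and "(\<Union>j. {1 / K ^ Suc j<..1 / K ^ j}) = {0<..1}"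
proof -
  have "{1 / K ^ Suc i<..1 / K ^ i} \<inter> {1 / K ^ Suc j<..1 / K ^ j} = {}" if "i < j" for i j
  proof -
    have "1 / K ^ j \<le> 1 / K ^ Suc i" using K that by (intro divide_left_mono power_increasing) auto
    then show ?thesis by auto
  qed
  then show "disjoint_family (\<lambda>j. {1 / K ^ Suc j<..1 / K ^ j})"
    unfolding disjoint_family_on_def by (metis inf_commute linorder_neqE_nat)
  show "(\<Union>j. {1 / K ^ Suc j<..1 / K ^ j}) = {0<..1}"
  proof (intro equalityI subsetI)
    fix t :: real assume t: "t \<in> {0<..1}"
    have ex: "\<exists>n. 1 / K ^ Suc n < t"
    proof -
      obtain n where "(1 / K) ^ n < t" using real_arch_pow_inv[of t "1 / K"] t K by auto
      moreover have "1 / K ^ Suc n \<le> 1 / K ^ n" using K by (intro divide_left_mono power_increasing) auto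
      ultimately show ?thesis by (intro exI[of _ n]) (simp add: power_divide)
    qed
    define n where "n = (LEAST n. 1 / K ^ Suc n < t)"
    have "1 / K ^ Suc n < t" unfolding n_def by (rule LeastI_ex[OF ex])
    moreover have "t \<le> 1 / K ^ n"
    proof (cases n)
      case (Suc k)
      then have "\<not> 1 / K ^ Suc k < t" using not_less_Least[of k "\<lambda>n. 1 / K ^ Suc n < t"] by (simp add: n_def)
      then show ?thesis using Suc by simp
    qed (use t in simp)
    ultimately show "t \<in> (\<Union>j. {1 / K ^ Suc j<..1 / K ^ j})" by auto
  next
    fix t assume "t \<in> (\<Union>j. {1 / K ^ Suc j<..1 / K ^ j})"
    then obtain j where j: "1 / K ^ Suc j < t" "t \<le> 1 / K ^ j" by auto
    have "0 < 1 / K ^ Suc j" "1 / K ^ j \<le> 1" using K one_le_power[of K j] by auto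
    then show "t \<in> {0<..1}" using j less_trans[of 0 "1 / K ^ Suc j" t] order_trans[of t "1 / K ^ j" 1] by simp
  qed
qed

text \<open>The measure \<open>dt/t\<close> is invariant under dilations, so all the blocks \<open>(1/K\<^sup>j\<^sup>+\<^sup>1, 1/K\<^sup>j]\<close> can be moved to
\<open>(1/K, 1]\<close>.\<close>

lemma nn_integral_blocks:
  fixes \<psi> :: "real \<Rightarrow> ennreal"
  assumes [measurable]: "\<psi> \<in> borel_measurable borel" and K: "K > 1"
  shows "(\<integral>\<^sup>+t\<in>{0<..1}. \<psi> t * ennreal (1 / t) \<partial>lborel)
    = (\<integral>\<^sup>+u\<in>{1 / K<..1}. (\<Sum>j. \<psi> (u / K ^ j)) * ennreal (1 / u) \<partial>lborel)"
proof -
  let ?F = "\<lambda>t. \<psi> t * ennreal (1 / t)"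
  have "(\<integral>\<^sup>+t\<in>{0<..1}. ?F t \<partial>lborel) = (\<Sum>j. (\<integral>\<^sup>+t\<in>{1 / K ^ Suc j<..1 / K ^ j}. ?F t \<partial>lborel))"
    unfolding geometric_blocks(2)[OF K, symmetric]
    by (rule nn_integral_disjoint_family[OF _ _ geometric_blocks(1)[OF K]]) auto
  also have "\<dots> = (\<Sum>j. (\<integral>\<^sup>+u. \<psi> (u / K ^ j) * ennreal (1 / u) * indicator {1 / K<..1} u \<partial>lborel))"
  proof (intro suminf_cong)
    fix j
    have Kj: "K ^ j > 0" using K by simp
    have "(\<integral>\<^sup>+t\<in>{1 / K ^ Suc j<..1 / K ^ j}. ?F t \<partial>lborel)
        = ennreal (1 / K ^ j) * (\<integral>\<^sup>+u. ?F (u / K ^ j) * indicator {1 / K ^ Suc j<..1 / K ^ j} (u / K ^ j) \<partial>lborel)"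
      using nn_integral_real_affine[of "\<lambda>t. ?F t * indicator {1 / K ^ Suc j<..1 / K ^ j} t" "1 / K ^ j" 0] Kj K by simp
    also have "\<dots> = (\<integral>\<^sup>+u. ennreal (1 / K ^ j) * (?F (u / K ^ j) * indicator {1 / K ^ Suc j<..1 / K ^ j} (u / K ^ j)) \<partial>lborel)"
      by (rule nn_integral_cmult[symmetric]) measurable
    also have "\<dots> = (\<integral>\<^sup>+u. \<psi> (u / K ^ j) * ennreal (1 / u) * indicator {1 / K<..1} u \<partial>lborel)"
    proof (intro nn_integral_cong)
      fix u :: real
      have iff: "u / K ^ j \<in> {1 / K ^ Suc j<..1 / K ^ j} \<longleftrightarrow> u \<in> {1 / K<..1}"
      proof -
        have "1 / K ^ Suc j = (1 / K) / K ^ j" by simp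
        then show ?thesis using Kj K by (simp only: greaterThanAtMost_iff divide_less_cancel divide_le_cancel) auto
      qed
      have e: "ennreal (1 / K ^ j) * ennreal (1 / (u / K ^ j)) = ennreal (1 / u)"
        using Kj K by (simp add: ennreal_mult'[symmetric])
      show "ennreal (1 / K ^ j) * (?F (u / K ^ j) * indicator {1 / K ^ Suc j<..1 / K ^ j} (u / K ^ j))
          = \<psi> (u / K ^ j) * ennreal (1 / u) * indicator {1 / K<..1} u"
      proof (cases "u \<in> {1 / K<..1}")
        case True
        then show ?thesis using iff
          by (simp only: indicator_simps mult_1_right mult.left_commute[of "ennreal (1 / K ^ j)" "\<psi> (u / K ^ j)"] e)
      next
        case False
        then show ?thesis using iff by (simp only: indicator_simps simp_thms mult_zero_right)
      qed
    qed
    finally show "(\<integral>\<^sup>+t\<in>{1 / K ^ Suc j<..1 / K ^ j}. ?F t \<partial>lborel)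
        = (\<integral>\<^sup>+u. \<psi> (u / K ^ j) * ennreal (1 / u) * indicator {1 / K<..1} u \<partial>lborel)" .
  qed
  also have "\<dots> = (\<integral>\<^sup>+u. (\<Sum>j. \<psi> (u / K ^ j) * ennreal (1 / u) * indicator {1 / K<..1} u) \<partial>lborel)"
    by (rule nn_integral_suminf[symmetric]) measurable
  also have "\<dots> = (\<integral>\<^sup>+u\<in>{1 / K<..1}. (\<Sum>j. \<psi> (u / K ^ j)) * ennreal (1 / u) \<partial>lborel)"
    by (simp add: mult.assoc)
  finally show ?thesis .
qed

lemma nn_integral_reciprocal:
  fixes K :: real
  assumes K: "K > 1"
  shows "(\<integral>\<^sup>+u\<in>{1 / K<..1}. ennreal (1 / u) \<partial>lborel) = ennreal (ln K)"
proof -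
  have "(\<integral>\<^sup>+u\<in>{1 / K<..1}. ennreal (1 / u) \<partial>lborel) = (\<integral>\<^sup>+u. ennreal (1 / u) * indicator {1 / K..1} u \<partial>lborel)"
    by (rule nn_integral_cong_AE, use AE_lborel_singleton[of "1 / K"] in eventually_elim) (auto simp: indicator_def)
  also have "\<dots> = ennreal (ln 1 - ln (1 / K))"
  proof (rule nn_integral_FTC_Icc)
    fix x assume "x \<in> {1 / K..1}"
    then have "1 / K \<le> x" by simp
    then have "x > 0" using K by (meson less_le_trans zero_less_divide_1_iff zero_less_one less_trans)
    then show "(ln has_real_derivative 1 / x) (at x)" "0 \<le> 1 / x"
      by (auto intro!: derivative_eq_intros)
  qed (use K in auto)
  finally show ?thesis using K by (simp add: ln_div)
qed

text \<open>The right-hand side is the mean of the left-hand side over \<open>u \<in> (1/K, 1]\<close> with respect to \<open>du/u\<close>, a measure of total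
mass \<open>ln K\<close>, and a function cannot exceed its mean everywhere.\<close>

lemma scale_selection:
  fixes \<psi> :: "real \<Rightarrow> ennreal"
  assumes [measurable]: "\<psi> \<in> borel_measurable borel" and K: "K > 1"
  shows "\<exists>u. 1 / K < u \<and> u \<le> 1 \<and>
    (\<Sum>j. \<psi> (u / K ^ j)) \<le> ennreal (1 / ln K) * (\<integral>\<^sup>+t\<in>{0<..1}. \<psi> t * ennreal (1 / t) \<partial>lborel)"
proof (rule ccontr)
  define I where "I = (\<integral>\<^sup>+t\<in>{0<..1}. \<psi> t * ennreal (1 / t) \<partial>lborel)"
  define c where "c = ennreal (1 / ln K) * I"
  assume "\<not> ?thesis"
  then have gt: "c < (\<Sum>j. \<psi> (u / K ^ j))" if "1 / K < u" "u \<le> 1" for u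
    using that by (auto simp: c_def I_def not_le)
  have lnK: "ln K > 0" using K by simp
  have "c \<noteq> \<infinity>" using gt[of 1] K by auto
  have cI: "c * ennreal (ln K) = I"
    unfolding c_def using lnK by (simp add: mult_ac mult.assoc[symmetric] ennreal_mult[symmetric])
  let ?f = "\<lambda>u. c * (ennreal (1 / u) * indicator {1 / K<..1} u)"
  let ?g = "\<lambda>u. (\<Sum>j. \<psi> (u / K ^ j)) * ennreal (1 / u) * indicator {1 / K<..1} u"
  have f: "(\<integral>\<^sup>+u. ?f u \<partial>lborel) = I"
    by (subst nn_integral_cmult) (auto simp: nn_integral_reciprocal[OF K] cI)
  have g: "(\<integral>\<^sup>+u. ?g u \<partial>lborel) = I"
    unfolding I_def by (rule nn_integral_blocks[OF _ K, symmetric]) simp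
  have "(\<integral>\<^sup>+u. ?f u \<partial>lborel) < (\<integral>\<^sup>+u. ?g u \<partial>lborel)"
  proof (rule nn_integral_less)
    show "(\<integral>\<^sup>+u. ?f u \<partial>lborel) \<noteq> \<infinity>"
      unfolding f using \<open>c \<noteq> \<infinity>\<close> by (auto simp: cI[symmetric] ennreal_mult_eq_top_iff)
    show "AE u in lborel. ?f u \<le> ?g u"
      using mult_right_mono[OF less_imp_le[OF gt]] by (intro AE_I2) (auto simp: indicator_def)
    show "\<not> (AE u in lborel. ?g u \<le> ?f u)"
    proof
      assume "AE u in lborel. ?g u \<le> ?f u"
      then have "AE u in lborel. u \<notin> {1 / K<..1}"
      proof eventually_elim
        case (elim u)
        show ?case
        proof
          assume u: "u \<in> {1 / K<..1}"
          then have "u > 0" using K by (auto intro: less_trans[of 0 "1 / K"])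
          then have "c * ennreal (1 / u) < (\<Sum>j. \<psi> (u / K ^ j)) * ennreal (1 / u)"
            using gt[of u] u by (intro ennreal_mult_strict_right_mono) auto
          then show False using elim u by simp
        qed
      qed
      then have "emeasure lborel {1 / K<..1} = 0"
        by (subst (asm) AE_iff_measurable[of "{1 / K<..1}"]) auto
      then show False using K by simp
    qed
  qed auto
  then show False using f g by simp
qed

text \<open>First \<open>v\<close> is chosen for the sum of \<open>\<phi>\<close> and of the mean of \<open>\<Phi>\<close> in its first variable, and then \<open>u\<close> for the
sum of \<open>\<phi>\<close> and of \<open>\<Phi>\<close> summed over the points \<open>v / K\<^sup>k\<close>.  In this way \<open>\<Phi>\<close> has to be measurable only in the
iterated sense.  A function increasing in each of two variables has this property, although it need not be a
Borel function of the pair.\<close>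

lemma grid_selection:
  fixes \<phi> :: "real \<Rightarrow> ennreal" and \<Phi> :: "real \<Rightarrow> real \<Rightarrow> ennreal"
  assumes K: "K > 1" and \<phi> [measurable]: "\<phi> \<in> borel_measurable borel"
    and \<Phi>1 [measurable]: "\<And>v. (\<lambda>u. \<Phi> u v) \<in> borel_measurable borel"
    and \<Phi>2 [measurable]: "(\<lambda>v. \<integral>\<^sup>+u\<in>{0<..1}. \<Phi> u v * ennreal (1 / u) \<partial>lborel) \<in> borel_measurable borel"
  shows "\<exists>u v. 1 / K < u \<and> u \<le> 1 \<and> 1 / K < v \<and> v \<le> 1 \<and>
    (\<Sum>j. \<phi> (u / K ^ j)) + (\<Sum>k. \<phi> (v / K ^ k)) + (\<Sum>j. \<Sum>k. \<Phi> (u / K ^ j) (v / K ^ k))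
    \<le> 2 * (ennreal (1 / ln K) * (\<integral>\<^sup>+t\<in>{0<..1}. \<phi> t * ennreal (1 / t) \<partial>lborel))
      + ennreal (1 / ln K) * (ennreal (1 / ln K) *
          (\<integral>\<^sup>+v\<in>{0<..1}. (\<integral>\<^sup>+u\<in>{0<..1}. \<Phi> u v * ennreal (1 / u) \<partial>lborel) * ennreal (1 / v) \<partial>lborel))"
proof -
  define c where "c = ennreal (1 / ln K)"
  define T where "T = (\<lambda>v. \<integral>\<^sup>+u\<in>{0<..1}. \<Phi> u v * ennreal (1 / u) \<partial>lborel)"
  have T [measurable]: "T \<in> borel_measurable borel" using \<Phi>2 by (simp add: T_def)
  define J where "J = (\<integral>\<^sup>+t\<in>{0<..1}. \<phi> t * ennreal (1 / t) \<partial>lborel)"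
  define I where "I = (\<integral>\<^sup>+v\<in>{0<..1}. T v * ennreal (1 / v) \<partial>lborel)"
  obtain v where v: "1 / K < v" "v \<le> 1"
    and v': "(\<Sum>k. c * T (v / K ^ k) + \<phi> (v / K ^ k)) \<le> c * (\<integral>\<^sup>+t\<in>{0<..1}. (c * T t + \<phi> t) * ennreal (1 / t) \<partial>lborel)"
    using scale_selection[of "\<lambda>v. c * T v + \<phi> v" K] K unfolding c_def by auto
  have "(\<integral>\<^sup>+t\<in>{0<..1}. (c * T t + \<phi> t) * ennreal (1 / t) \<partial>lborel)
     = (\<integral>\<^sup>+t. c * (T t * ennreal (1 / t) * indicator {0<..1} t) + \<phi> t * ennreal (1 / t) * indicator {0<..1} t \<partial>lborel)"
    by (intro nn_integral_cong) (simp add: distrib_right mult.assoc)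
  also have "\<dots> = c * I + J"
    unfolding I_def J_def by (simp add: nn_integral_add nn_integral_cmult)
  finally have eqv: "(\<integral>\<^sup>+t\<in>{0<..1}. (c * T t + \<phi> t) * ennreal (1 / t) \<partial>lborel) = c * I + J" .
  obtain u where u: "1 / K < u" "u \<le> 1"
    and u': "(\<Sum>j. (\<Sum>k. \<Phi> (u / K ^ j) (v / K ^ k)) + \<phi> (u / K ^ j))
      \<le> c * (\<integral>\<^sup>+t\<in>{0<..1}. ((\<Sum>k. \<Phi> t (v / K ^ k)) + \<phi> t) * ennreal (1 / t) \<partial>lborel)"
    using scale_selection[of "\<lambda>u. (\<Sum>k. \<Phi> u (v / K ^ k)) + \<phi> u" K] K unfolding c_def by auto
  have "(\<integral>\<^sup>+t\<in>{0<..1}. ((\<Sum>k. \<Phi> t (v / K ^ k)) + \<phi> t) * ennreal (1 / t) \<partial>lborel)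
     = (\<integral>\<^sup>+t. (\<Sum>k. \<Phi> t (v / K ^ k) * ennreal (1 / t) * indicator {0<..1} t) + \<phi> t * ennreal (1 / t) * indicator {0<..1} t \<partial>lborel)"
    by (intro nn_integral_cong) (simp add: distrib_right mult.assoc)
  also have "\<dots> = (\<integral>\<^sup>+t. (\<Sum>k. \<Phi> t (v / K ^ k) * ennreal (1 / t) * indicator {0<..1} t) \<partial>lborel) + J"
    unfolding J_def by (rule nn_integral_add) measurable
  also have "(\<integral>\<^sup>+t. (\<Sum>k. \<Phi> t (v / K ^ k) * ennreal (1 / t) * indicator {0<..1} t) \<partial>lborel) = (\<Sum>k. T (v / K ^ k))"
    unfolding T_def by (rule nn_integral_suminf) measurable
  finally have equ: "(\<integral>\<^sup>+t\<in>{0<..1}. ((\<Sum>k. \<Phi> t (v / K ^ k)) + \<phi> t) * ennreal (1 / t) \<partial>lborel) = (\<Sum>k. T (v / K ^ k)) + J" .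
  have "(\<Sum>j. \<phi> (u / K ^ j)) + (\<Sum>k. \<phi> (v / K ^ k)) + (\<Sum>j. \<Sum>k. \<Phi> (u / K ^ j) (v / K ^ k))
      = (\<Sum>j. (\<Sum>k. \<Phi> (u / K ^ j) (v / K ^ k)) + \<phi> (u / K ^ j)) + (\<Sum>k. \<phi> (v / K ^ k))"
    by (simp add: suminf_add[symmetric] add_ac)
  also have "\<dots> \<le> c * ((\<Sum>k. T (v / K ^ k)) + J) + (\<Sum>k. \<phi> (v / K ^ k))"
    using u' unfolding equ by (rule add_right_mono)
  also have "\<dots> = (\<Sum>k. c * T (v / K ^ k) + \<phi> (v / K ^ k)) + c * J"
    by (simp add: suminf_add[symmetric] distrib_left add_ac)
  also have "\<dots> \<le> c * (c * I + J) + c * J"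
    using v' unfolding eqv by (rule add_right_mono)
  also have "\<dots> = 2 * (c * J) + c * (c * I)" by (simp add: distrib_left mult_2 add_ac)
  finally have "(\<Sum>j. \<phi> (u / K ^ j)) + (\<Sum>k. \<phi> (v / K ^ k)) + (\<Sum>j. \<Sum>k. \<Phi> (u / K ^ j) (v / K ^ k))
     \<le> 2 * (c * J) + c * (c * I)" .
  then show ?thesis using u v unfolding c_def J_def I_def T_def by blast
qed

section \<open>The continuous representative\<close>

text \<open>The path from \<open>(n, n)\<close> to \<open>(n + 1, n + 1)\<close> goes through \<open>(n, n + 1)\<close>.  Along each of its two sides the increment is
compared with the increment at the edge of the grid, and the mixed increments bridge the difference.\<close>

lemma diagonal_increment_le:
  fixes a :: "nat \<Rightarrow> nat \<Rightarrow> real"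
  assumes x: "\<And>j. \<bar>a (Suc j) 0 - a j 0\<bar> \<le> \<alpha> j"
    and y: "\<And>k. \<bar>a 0 (Suc k) - a 0 k\<bar> \<le> \<beta> k"
    and xy: "\<And>j k. \<bar>(a (Suc j) (Suc k) - a j (Suc k)) - (a (Suc j) k - a j k)\<bar> \<le> \<gamma> j k"
  shows "\<bar>a (Suc n) (Suc n) - a n n\<bar> \<le> \<alpha> n + \<beta> n + ((\<Sum>k<Suc n. \<gamma> n k) + (\<Sum>j<n. \<gamma> j n))"
proof -
  have X: "\<bar>a (Suc j) m - a j m\<bar> \<le> \<alpha> j + (\<Sum>k<m. \<gamma> j k)" for j m
  proof (induction m)
    case (Suc m)
    then show ?case using xy[of j m] by (simp add: abs_le_iff)
  qed (use x in simp)
  have Y: "\<bar>a m (Suc k) - a m k\<bar> \<le> \<beta> k + (\<Sum>j<m. \<gamma> j k)" for k m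
  proof (induction m)
    case (Suc m)
    then show ?case using xy[of m k] by (simp add: abs_le_iff)
  qed (use y in simp)
  show ?thesis using X[of n "Suc n"] Y[of n n] by (simp add: abs_le_iff)
qed

text \<open>The mixed increments used at step \<open>n\<close> fill the \<open>n\<close>-th hook of the square, so that each is counted once.\<close>

lemma sum_square_Suc:
  fixes \<gamma> :: "nat \<Rightarrow> nat \<Rightarrow> real"
  shows "(\<Sum>n<N. (\<Sum>k<Suc n. \<gamma> n k) + (\<Sum>j<n. \<gamma> j n)) = (\<Sum>j<N. \<Sum>k<N. \<gamma> j k)"
  by (induction N) (simp_all add: sum.distrib)

lemma diagonal_limit:
  fixes a :: "nat \<Rightarrow> nat \<Rightarrow> 'a::topological_space \<Rightarrow> real"
  assumes x: "\<And>j z. \<bar>a (Suc j) 0 z - a j 0 z\<bar> \<le> \<alpha> j"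
    and y: "\<And>k z. \<bar>a 0 (Suc k) z - a 0 k z\<bar> \<le> \<beta> k"
    and xy: "\<And>j k z. \<bar>(a (Suc j) (Suc k) z - a j (Suc k) z) - (a (Suc j) k z - a j k z)\<bar> \<le> \<gamma> j k"
    and S: "\<And>N. (\<Sum>j<N. \<alpha> j) + (\<Sum>k<N. \<beta> k) + (\<Sum>j<N. \<Sum>k<N. \<gamma> j k) \<le> S"
    and cont: "\<And>n. continuous_on UNIV (a n n)"
  obtains g where "continuous_on UNIV g" "\<And>z. (\<lambda>n. a n n z) \<longlonglongrightarrow> g z" "\<And>z. \<bar>g z - a 0 0 z\<bar> \<le> S"
proof -
  define d where "d = (\<lambda>n z. a (Suc n) (Suc n) z - a n n z)"
  define M where "M = (\<lambda>n. \<alpha> n + \<beta> n + ((\<Sum>k<Suc n. \<gamma> n k) + (\<Sum>j<n. \<gamma> j n)))"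
  have dM: "\<bar>d n z\<bar> \<le> M n" for n z
    unfolding d_def M_def using x y xy by (intro diagonal_increment_le[where a = "\<lambda>j k. a j k z"]) auto
  have M0: "0 \<le> M n" for n using dM[of n undefined] by linarith
  have MS: "(\<Sum>n<N. M n) \<le> S" for N
    using S[of N] by (simp only: M_def sum.distrib[of _ _ "{..<N}"] sum_square_Suc[of _ N, unfolded sum.distrib[of _ _ "{..<N}"]])
  have sM: "summable M" using M0 MS by (rule summableI_nonneg_bounded)
  define D where "D = (\<lambda>z. \<Sum>n. d n z)"
  have ul: "uniform_limit UNIV (\<lambda>N z. \<Sum>n<N. d n z) D sequentially"
    unfolding D_def by (rule Weierstrass_m_test) (use dM sM in auto)
  have tel: "(\<Sum>n<N. d n z) = a N N z - a 0 0 z" for N z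
    unfolding d_def by (rule sum_lessThan_telescope[of "\<lambda>n. a n n z"])
  have contD: "continuous_on UNIV D"
  proof (rule uniform_limit_theorem[OF _ ul])
    show "\<forall>\<^sub>F N in sequentially. continuous_on UNIV (\<lambda>z. \<Sum>n<N. d n z)"
      unfolding d_def by (intro always_eventually allI continuous_on_sum continuous_on_diff cont)
  qed simp
  have lim: "(\<lambda>N. a N N z - a 0 0 z) \<longlonglongrightarrow> D z" for z
    using tendsto_uniform_limitI[OF ul, of z] by (simp add: tel)
  show thesis
  proof (rule that[of "\<lambda>z. a 0 0 z + D z"])
    show "continuous_on UNIV (\<lambda>z. a 0 0 z + D z)" by (intro continuous_on_add cont contD)
    show "(\<lambda>n. a n n z) \<longlonglongrightarrow> a 0 0 z + D z" for z
      using tendsto_add[OF tendsto_const[of "a 0 0 z"] lim[of z]] by simp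
    show "\<bar>a 0 0 z + D z - a 0 0 z\<bar> \<le> S" for z
    proof -
      have sd: "summable (\<lambda>n. \<bar>d n z\<bar>)" by (rule summable_comparison_test'[OF sM, of 0]) (use dM in simp)
      have "\<bar>D z\<bar> \<le> (\<Sum>n. \<bar>d n z\<bar>)" unfolding D_def using sd by (rule summable_rabs)
      also have "\<dots> \<le> (\<Sum>n. M n)" using dM sd sM by (intro suminf_le) auto
      also have "\<dots> \<le> S" using MS by (intro suminf_le_const sM)
      finally show ?thesis by simp
    qed
  qed
qed

context periodic_Lp
begin

lemma box_average_periodic: "periodic (box_average h g f)"
proof -
  have "f ((x + 1, y) + k) = f ((x, y) + k)" "f ((x, y + 1) + k) = f ((x, y) + k)" for x y k
    using per unfolding periodic_def plus_prod_def fst_conv snd_conv by (metis add.assoc add.commute)+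
  then show ?thesis by (simp add: periodic_def box_average_def smear_def)
qed

lemma modulus_mono: "mono (modulus p f)"
  unfolding mono_def modulus_def by (auto intro!: SUP_subset_mono)

lemma mixed_modulus_mono: "u \<le> u' \<Longrightarrow> v \<le> v' \<Longrightarrow> mixed_modulus p f u v \<le> mixed_modulus p f u' v'"
  unfolding mixed_modulus_def by (intro SUP_subset_mono) auto

definition J_term :: "real \<Rightarrow> ennreal" where
  "J_term t = ennreal (t powr (- 1 / p)) * modulus p f t"

text \<open>For positive \<open>u\<close> and \<open>v\<close> the two powers multiply to \<open>(u v)\<^sup>-\<^sup>1\<^sup>/\<^sup>p\<close>.  In the separated form, the integral over
\<open>u\<close> is a power of \<open>v\<close> times an increasing function of \<open>v\<close>, and so it is measurable for all real \<open>v\<close>.\<close>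

definition I_term :: "real \<Rightarrow> real \<Rightarrow> ennreal" where
  "I_term u v = ennreal (u powr (- 1 / p)) * ennreal (v powr (- 1 / p)) * mixed_modulus p f u v"

lemma J_term_borel [measurable]: "J_term \<in> borel_measurable borel"
  using borel_measurable_mono_ennreal[OF modulus_mono] unfolding J_term_def[abs_def] by measurable

lemma I_term_borel [measurable]: "(\<lambda>u. I_term u v) \<in> borel_measurable borel"
proof -
  have [measurable]: "(\<lambda>u. mixed_modulus p f u v) \<in> borel_measurable borel"
    by (intro borel_measurable_mono_ennreal monoI mixed_modulus_mono) auto
  show ?thesis unfolding I_term_def by measurable
qed

lemma I_term_partial_borel [measurable]: "(\<lambda>v. \<integral>\<^sup>+u\<in>{0<..1}. I_term u v * ennreal (1 / u) \<partial>lborel) \<in> borel_measurable borel"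
proof -
  have [measurable]: "(\<lambda>u. mixed_modulus p f u v) \<in> borel_measurable borel" for v
    by (intro borel_measurable_mono_ennreal monoI mixed_modulus_mono) auto
  let ?T = "\<lambda>v. \<integral>\<^sup>+u\<in>{0<..1}. ennreal (u powr (- 1 / p)) * mixed_modulus p f u v * ennreal (1 / u) \<partial>lborel"
  have T: "?T \<in> borel_measurable borel"
    by (intro borel_measurable_mono_ennreal monoI nn_integral_mono mult_right_mono mult_left_mono mixed_modulus_mono) auto
  have "(\<integral>\<^sup>+u\<in>{0<..1}. I_term u v * ennreal (1 / u) \<partial>lborel) = ennreal (v powr (- 1 / p)) * ?T v" for v
    unfolding I_term_def by (subst nn_integral_cmult[symmetric]) (auto intro!: nn_integral_cong simp: mult_ac)
  moreover have "(\<lambda>v. ennreal (v powr (- 1 / p)) * ?T v) \<in> borel_measurable borel"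
    by (rule borel_measurable_times_ennreal[OF _ T]) measurable
  ultimately show ?thesis by (simp only:)
qed

lemma J_eq: "(\<integral>\<^sup>+t\<in>{0<..1}. J_term t * ennreal (1 / t) \<partial>lborel) = J_int p f"
  by (simp add: J_int_def J_term_def)

lemma I_eq: "(\<integral>\<^sup>+v\<in>{0<..1}. (\<integral>\<^sup>+u\<in>{0<..1}. I_term u v * ennreal (1 / u) \<partial>lborel) * ennreal (1 / v) \<partial>lborel) = I_int p f"
  unfolding I_int_def
proof (intro nn_integral_cong)
  fix v :: real
  have "(\<integral>\<^sup>+u\<in>{0<..1}. I_term u v * ennreal (1 / u) \<partial>lborel) * ennreal (1 / v)
     = (\<integral>\<^sup>+u. I_term u v * ennreal (1 / u) * indicator {0<..1} u * ennreal (1 / v) \<partial>lborel)"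
    by (rule nn_integral_multc[symmetric]) measurable
  moreover have "\<dots> = (\<integral>\<^sup>+u\<in>{0<..1}. ennreal ((u * v) powr (- 1 / p)) * mixed_modulus p f u v * ennreal (1 / u) * ennreal (1 / v) \<partial>lborel)"
    if "v \<in> {0<..1}"
    using that by (intro nn_integral_cong) (auto simp: I_term_def indicator_def powr_mult ennreal_mult mult_ac)
  ultimately show "(\<integral>\<^sup>+u\<in>{0<..1}. I_term u v * ennreal (1 / u) \<partial>lborel) * ennreal (1 / v) * indicator {0<..1} v
      = (\<integral>\<^sup>+u\<in>{0<..1}. ennreal ((u * v) powr (- 1 / p)) * mixed_modulus p f u v * ennreal (1 / u) * ennreal (1 / v) \<partial>lborel) * indicator {0<..1} v"
    by (auto simp: indicator_def)
qed

text \<open>The box averages tend to \<open>f\<close> in \<open>L\<^sup>p\<close> on the unit square, and Fatou's lemma identifies their pointwise limit with \<open>f\<close>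
there; periodicity does the rest.\<close>

lemma ae_limit_eq:
  assumes hg: "\<And>n. 0 < h n \<and> h n \<le> 1" "\<And>n. 0 < g n \<and> g n \<le> 1"
    and lim0: "h \<longlonglongrightarrow> 0" "g \<longlonglongrightarrow> 0"
    and small: "\<And>\<epsilon>. \<epsilon> > 0 \<Longrightarrow> \<exists>\<delta>>0. modulus p f \<delta> \<le> ennreal \<epsilon>"
    and lim: "\<And>z. (\<lambda>n. box_average (h n) (g n) f z) \<longlonglongrightarrow> F z"
  shows "AE z in lborel. f z = F z"
proof -
  have [measurable]: "unit_square \<in> sets borel" by (intro borel_Times) auto
  have Fm [measurable]: "F \<in> borel_measurable borel"
    by (rule borel_measurable_LIMSEQ_real[OF lim]) measurable
  let ?A = "\<lambda>n z. box_average (h n) (g n) f z"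
  have tend: "(\<lambda>n. power_integral p (\<lambda>z. ?A n z - f z)) \<longlonglongrightarrow> 0"
  proof (rule order_tendstoI)
    fix a :: ennreal assume "0 < a"
    then obtain b :: real where b: "0 < b" "ennreal b < a"
      by (metis dense ennreal_cases ennreal_less_zero_iff less_top top.not_eq_extremum less_trans not_less_iff_gr_or_eq)
    define \<epsilon> where "\<epsilon> = b powr (1 / p)"
    have \<epsilon>: "\<epsilon> > 0" "\<epsilon> powr p = b" using b p by (simp_all add: \<epsilon>_def powr_powr)
    obtain \<delta> where \<delta>: "\<delta> > 0" "modulus p f \<delta> \<le> ennreal \<epsilon>" using small[OF \<epsilon>(1)] by blast
    have "(\<lambda>n. h n + g n) \<longlonglongrightarrow> 0" using tendsto_add[OF lim0] by simp
    then have "\<forall>\<^sub>F n in sequentially. h n + g n < \<delta>" using \<delta>(1) by (rule order_tendstoD)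
    then show "\<forall>\<^sub>F n in sequentially. power_integral p (\<lambda>z. ?A n z - f z) < a"
    proof eventually_elim
      case (elim n)
      have "modulus p f (h n + g n) \<le> ennreal \<epsilon>"
        using monoD[OF modulus_mono, of "h n + g n" \<delta>] elim \<delta>(2) by simp
      then have "power_integral p (\<lambda>z. ?A n z - f z) \<le> ennreal (\<epsilon> powr p)"
        using hg \<epsilon>(1) by (intro box_average_Lp_close) auto
      then show ?case using b \<epsilon>(2) by simp
    qed
  qed simp
  have conv: "(\<lambda>n. ennreal (\<bar>?A n z - f z\<bar> powr p) * indicator unit_square z) \<longlonglongrightarrow> ennreal (\<bar>F z - f z\<bar> powr p) * indicator unit_square z" for z
  proof (cases "z \<in> unit_square")
    case True
    have "(\<lambda>n. \<bar>?A n z - f z\<bar> powr p) \<longlonglongrightarrow> \<bar>F z - f z\<bar> powr p"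
      by (rule tendsto_powr') (use p in \<open>auto intro!: tendsto_rabs tendsto_diff lim\<close>)
    then show ?thesis using True by (simp add: tendsto_ennrealI)
  qed simp
  have "power_integral p (\<lambda>z. F z - f z)
      = (\<integral>\<^sup>+z. liminf (\<lambda>n. ennreal (\<bar>?A n z - f z\<bar> powr p) * indicator unit_square z) \<partial>lborel)"
    unfolding power_integral_def by (intro nn_integral_cong lim_imp_Liminf[symmetric] conv) simp
  also have "\<dots> \<le> liminf (\<lambda>n. power_integral p (\<lambda>z. ?A n z - f z))"
    unfolding power_integral_def by (rule nn_integral_liminf) measurable
  also have "\<dots> = 0" by (rule lim_imp_Liminf[OF _ tend]) simp
  finally have "power_integral p (\<lambda>z. F z - f z) = 0" by simp
  then have "AE z in lborel. ennreal (\<bar>F z - f z\<bar> powr p) * indicator unit_square z = 0"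
    unfolding power_integral_def by (subst (asm) nn_integral_0_iff_AE) auto
  then have ae: "AE z in lborel. z \<in> {0..<1} \<times> {0..<1} \<longrightarrow> f z = F z"
    by eventually_elim (auto simp: indicator_def)
  have "periodic F"
  proof -
    have "F (x + 1, y) = F (x, y)" "F (x, y + 1) = F (x, y)" for x y
      using LIMSEQ_unique[OF lim[of "(x + 1, y)"], of "F (x, y)"] lim[of "(x, y)"]
        LIMSEQ_unique[OF lim[of "(x, y + 1)"], of "F (x, y)"] box_average_periodic
      by (simp_all add: periodic_def)
    then show ?thesis by (simp add: periodic_def)
  qed
  then have "periodic (\<lambda>z. f z = F z)" using per by (simp add: periodic_def)
  then show ?thesis using ae by (rule AE_periodic)
qed

theorem continuous_representative:
  assumes J: "J_int p f < \<infinity>" and I: "I_int p f < \<infinity>"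
  shows "\<exists>G. continuous_on UNIV G \<and> (AE z in lborel. f z = G z) \<and>
    (\<forall>z. ennreal \<bar>G z\<bar> \<le> ennreal 576 *
      (Lp_norm p f + ennreal (1 / (p * conj_exp p)) * J_int p f + ennreal ((1 / (p * conj_exp p))\<^sup>2) * I_int p f))"
proof -
  obtain K where K: "K > 1" and lnK: "p * conj_exp p / 3 \<le> ln K"
    and scales: "\<And>u. 1 / K < u \<Longrightarrow> u \<le> 1 \<Longrightarrow>
    (\<exists>h :: nat \<Rightarrow> real. (\<forall>j. 0 < h j \<and> h j \<le> 1) \<and> h \<longlonglongrightarrow> 0 \<and> 1 / h 0 \<le> 2 powr p \<and>
      (\<forall>j. controls p (\<lambda>t. avg_weight (h (Suc j)) t - avg_weight (h j) t) (4 powr p / (u / K ^ j)) 1 (u / K ^ j)))"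
    using scales_exist[OF p] by blast
  define c where "c = ennreal (1 / ln K)"
  obtain u v where u: "1 / K < u" "u \<le> 1" and v: "1 / K < v" "v \<le> 1"
    and uv: "(\<Sum>j. J_term (u / K ^ j)) + (\<Sum>k. J_term (v / K ^ k)) + (\<Sum>j. \<Sum>k. I_term (u / K ^ j) (v / K ^ k))
    \<le> 2 * (c * J_int p f) + c * (c * I_int p f)"
    using grid_selection[OF K J_term_borel I_term_borel I_term_partial_borel] unfolding J_eq I_eq c_def by blast
  define T where "T = (\<Sum>j. J_term (u / K ^ j)) + (\<Sum>k. J_term (v / K ^ k)) + (\<Sum>j. \<Sum>k. I_term (u / K ^ j) (v / K ^ k))"
  have "2 * (c * J_int p f) + c * (c * I_int p f) < \<infinity>"
    using J I by (simp add: c_def ennreal_mult_less_top)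
  then have Tfin: "T < \<infinity>" using uv unfolding T_def by (rule le_less_trans[rotated])
  define S where "S = enn2real T"
  have TS: "T = ennreal S" using Tfin by (simp add: S_def)
  obtain h where h: "\<And>j. 0 < h j \<and> h j \<le> 1" "h \<longlonglongrightarrow> 0" "1 / h 0 \<le> 2 powr p"
    and hc: "\<And>j. controls p (\<lambda>t. avg_weight (h (Suc j)) t - avg_weight (h j) t) (4 powr p / (u / K ^ j)) 1 (u / K ^ j)"
    using scales[OF u] by blast
  obtain g where g: "\<And>j. 0 < g j \<and> g j \<le> 1" "g \<longlonglongrightarrow> 0" "1 / g 0 \<le> 2 powr p"
    and gc: "\<And>j. controls p (\<lambda>t. avg_weight (g (Suc j)) t - avg_weight (g j) t) (4 powr p / (v / K ^ j)) 1 (v / K ^ j)"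
    using scales[OF v] by blast
  define d where "d = (\<lambda>j. u / K ^ j)"
  define e where "e = (\<lambda>j. v / K ^ j)"
  have d: "0 < d j" "d j \<le> 1" and e: "0 < e j" "e j \<le> 1" for j
    using lacunary_scale_bounds[OF K u] lacunary_scale_bounds[OF K v] by (auto simp: d_def e_def)
  let ?Ju = "\<Sum>j. J_term (d j)" and ?Jv = "\<Sum>j. J_term (e j)" and ?Iuv = "\<Sum>j. \<Sum>k. I_term (d j) (e k)"
  have T_eq: "T = ?Ju + ?Jv + ?Iuv" by (simp add: T_def d_def e_def)
  \<comment> \<open>Finiteness of the selected sums makes every modulus that occurs in them finite.\<close>
  have fin_u: "J_term (d j) < \<infinity>" for j
  proof -
    have "J_term (d j) \<le> ?Ju" using sum_le_suminf[of "\<lambda>j. J_term (d j)" "{j}"] by simp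
    also have "\<dots> \<le> T" by (simp add: T_eq add.assoc)
    finally show ?thesis using Tfin by (rule le_less_trans)
  qed
  have fin_v: "J_term (e j) < \<infinity>" for j
  proof -
    have "J_term (e j) \<le> ?Jv" using sum_le_suminf[of "\<lambda>j. J_term (e j)" "{j}"] by simp
    also have "\<dots> \<le> T" by (simp add: T_eq add.assoc add_increasing)
    finally show ?thesis using Tfin by (rule le_less_trans)
  qed
  have fin_uv: "I_term (d j) (e k) < \<infinity>" for j k
  proof -
    have "I_term (d j) (e k) \<le> (\<Sum>k. I_term (d j) (e k))" using sum_le_suminf[of "\<lambda>k. I_term (d j) (e k)" "{k}"] by simp
    also have "\<dots> \<le> ?Iuv" using sum_le_suminf[of "\<lambda>j. \<Sum>k. I_term (d j) (e k)" "{j}"] by simp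
    also have "\<dots> \<le> T" by (simp add: T_eq)
    finally show ?thesis using Tfin by (rule le_less_trans)
  qed
  define \<alpha> where "\<alpha> = (\<lambda>j. enn2real (J_term (d j)))"
  define \<beta> where "\<beta> = (\<lambda>j. enn2real (J_term (e j)))"
  define \<gamma> where "\<gamma> = (\<lambda>j k. enn2real (I_term (d j) (e k)))"
  have \<alpha>: "J_term (d j) = ennreal (\<alpha> j)" and \<beta>: "J_term (e j) = ennreal (\<beta> j)" for j
    using fin_u[of j] fin_v[of j] by (simp_all add: \<alpha>_def \<beta>_def)
  have \<gamma>: "I_term (d j) (e k) = ennreal (\<gamma> j k)" for j k
    using fin_uv[of j k] by (simp add: \<gamma>_def)
  have nonneg: "0 \<le> \<alpha> j" "0 \<le> \<beta> j" "0 \<le> \<gamma> j k" for j k by (simp_all add: \<alpha>_def \<beta>_def \<gamma>_def)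
  have S: "(\<Sum>j<N. \<alpha> j) + (\<Sum>k<N. \<beta> k) + (\<Sum>j<N. \<Sum>k<N. \<gamma> j k) \<le> S" for N
  proof -
    have "ennreal ((\<Sum>j<N. \<alpha> j) + (\<Sum>k<N. \<beta> k) + (\<Sum>j<N. \<Sum>k<N. \<gamma> j k))
      = (\<Sum>j<N. J_term (d j)) + (\<Sum>j<N. J_term (e j)) + (\<Sum>j<N. \<Sum>k<N. I_term (d j) (e k))"
      unfolding \<alpha> \<beta> \<gamma> using nonneg by (simp add: sum_nonneg)
    also have "\<dots> \<le> ?Ju + ?Jv + ?Iuv"
    proof (intro add_mono sum_le_suminf)
      have "(\<Sum>j<N. \<Sum>k<N. I_term (d j) (e k)) \<le> (\<Sum>j<N. \<Sum>k. I_term (d j) (e k))"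
        by (intro sum_mono sum_le_suminf) auto
      also have "\<dots> \<le> ?Iuv" by (intro sum_le_suminf) auto
      finally show "(\<Sum>j<N. \<Sum>k<N. I_term (d j) (e k)) \<le> ?Iuv" .
    qed auto
    finally show ?thesis unfolding T_eq[symmetric] TS by (subst (asm) ennreal_le_iff) (simp add: S_def)
  qed
  have modulus_eq: "modulus p f t = ennreal (t powr (1 / p) * a)" if "0 < t" "J_term t = ennreal a" "0 \<le> a" for t a
  proof -
    have "ennreal (t powr (1 / p)) * (ennreal (t powr (- 1 / p)) * modulus p f t) = ennreal (t powr (1 / p) * t powr (- 1 / p)) * modulus p f t"
      by (simp add: ennreal_mult mult.assoc)
    also have "t powr (1 / p) * t powr (- 1 / p) = 1" using that(1) by (simp flip: powr_add)
    finally have "modulus p f t = ennreal (t powr (1 / p)) * J_term t" by (simp add: J_term_def)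
    then show ?thesis using that by (simp add: ennreal_mult)
  qed
  have mixed_eq: "mixed_modulus p f (d j) (e k) = ennreal (d j powr (1 / p) * e k powr (1 / p) * \<gamma> j k)" for j k
  proof -
    have "d j powr (1 / p) * e k powr (1 / p) * (d j powr (- 1 / p) * e k powr (- 1 / p)) = 1"
      using powr_add[of "d j" "1 / p" "- 1 / p"] powr_add[of "e k" "1 / p" "- 1 / p"] d[of j] e[of k] by (simp add: mult_ac)
    then have "ennreal (d j powr (1 / p) * e k powr (1 / p)) * (ennreal (d j powr (- 1 / p) * e k powr (- 1 / p)) * mixed_modulus p f (d j) (e k))
       = mixed_modulus p f (d j) (e k)"
      by (subst mult.assoc[symmetric], subst ennreal_mult[symmetric]) auto
    then have "mixed_modulus p f (d j) (e k) = ennreal (d j powr (1 / p) * e k powr (1 / p)) * I_term (d j) (e k)"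
      by (simp add: I_term_def ennreal_mult mult.assoc)
    then show ?thesis unfolding \<gamma> using nonneg by (simp add: ennreal_mult)
  qed
  \<comment> \<open>The terms of a convergent series tend to zero, and \<open>d j\<close> is at most 1.\<close>
  have small: "\<exists>\<delta>>0. modulus p f \<delta> \<le> ennreal \<epsilon>" if "\<epsilon> > 0" for \<epsilon>
  proof -
    have "summable \<alpha>"
    proof (rule summableI_nonneg_bounded[of _ S])
      fix N
      have "0 \<le> (\<Sum>k<N. \<beta> k) + (\<Sum>j<N. \<Sum>k<N. \<gamma> j k)" using nonneg by (intro add_nonneg_nonneg sum_nonneg) auto
      then show "(\<Sum>j<N. \<alpha> j) \<le> S" using S[of N] by linarith
    qed (rule nonneg)
    then have "\<alpha> \<longlonglongrightarrow> 0" by (rule summable_LIMSEQ_zero)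
    then have "\<forall>\<^sub>F j in sequentially. \<alpha> j < \<epsilon>" using that by (rule order_tendstoD(2))
    then obtain j where j: "\<alpha> j < \<epsilon>" by (auto simp: eventually_sequentially)
    have "modulus p f (d j) = ennreal (d j powr (1 / p) * \<alpha> j)" using d \<alpha> nonneg by (intro modulus_eq) auto
    also have "\<dots> \<le> ennreal (1 * \<alpha> j)"
      using d[of j] p nonneg by (intro ennreal_leI mult_right_mono powr_le1) auto
    also have "\<dots> \<le> ennreal \<epsilon>" using j by (intro ennreal_leI) auto
    finally show ?thesis using d by blast
  qed
  have root: "(X powr p) powr (1 / p) = X" if "X > 0" for X :: real using that p by (simp add: powr_powr)
  have inc: "(4 powr p / t) powr (1 / p) = 4 * t powr (- 1 / p)" if "t > 0" for t :: real
    using that p by (simp add: powr_divide root powr_minus_divide)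
  have base: "(1 / x) powr (1 / p) \<le> 2" if "0 < x" "1 / x \<le> 2 powr p" for x
    using powr_mono2[of "1 / p" "1 / x" "2 powr p"] that p root[of 2] by simp
  have cancel: "t powr (- 1 / p) * t powr (1 / p) = 1" if "t > 0" for t :: real
    using that by (simp flip: powr_add)
  let ?a = "\<lambda>j k z. box_average (h j) (g k) f z"
  \<comment> \<open>The constant 64 is \<open>4\<^sup>3\<close>: a factor at most 4 from the estimate for products of weights, and one from each variable.\<close>
  have incx: "\<bar>?a (Suc j) 0 z - ?a j 0 z\<bar> \<le> 64 * \<alpha> j" for j z
  proof -
    have "\<bar>?a (Suc j) 0 z - ?a j 0 z\<bar> \<le> 4 * (4 powr p / d j * (1 / g 0)) powr (1 / p) * (d j powr (1 / p) * \<alpha> j)"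
    proof (rule increment_x_abs_le)
      show "controls p (\<lambda>t. avg_weight (h (Suc j)) t - avg_weight (h j) t) (4 powr p / d j) 1 (d j)" using hc by (simp add: d_def)
      show "modulus p f (d j) \<le> ennreal (d j powr (1 / p) * \<alpha> j)"
        using modulus_eq[OF d(1) \<alpha> nonneg(1)] by simp
    qed (use h g d[of j] nonneg in \<open>auto simp: less_imp_le\<close>)
    also have "(4 powr p / d j * (1 / g 0)) powr (1 / p) = 4 * d j powr (- 1 / p) * (1 / g 0) powr (1 / p)"
      using d[of j] g by (simp only: powr_mult[of "4 powr p / d j"]  inc[OF d(1)])
    also have "4 * (4 * d j powr (- 1 / p) * (1 / g 0) powr (1 / p)) * (d j powr (1 / p) * \<alpha> j)
      = 16 * (d j powr (- 1 / p) * d j powr (1 / p)) * (1 / g 0) powr (1 / p) * \<alpha> j" by (simp add: mult_ac)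
    also have "\<dots> = 16 * (1 / g 0) powr (1 / p) * \<alpha> j" using cancel[OF d(1)] by simp
    also have "\<dots> \<le> 16 * 4 * \<alpha> j"
      using base[of "g 0"] g nonneg by (intro mult_right_mono mult_left_mono) (auto intro: order_trans)
    finally show ?thesis by simp
  qed
  have incy: "\<bar>?a 0 (Suc k) z - ?a 0 k z\<bar> \<le> 64 * \<beta> k" for k z
  proof -
    have "\<bar>?a 0 (Suc k) z - ?a 0 k z\<bar> \<le> 4 * (1 / h 0 * (4 powr p / e k)) powr (1 / p) * (e k powr (1 / p) * \<beta> k)"
    proof (rule increment_y_abs_le)
      show "controls p (\<lambda>t. avg_weight (g (Suc k)) t - avg_weight (g k) t) (4 powr p / e k) 1 (e k)" using gc by (simp add: e_def)
      show "modulus p f (e k) \<le> ennreal (e k powr (1 / p) * \<beta> k)"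
        using modulus_eq[OF e(1) \<beta> nonneg(2)] by simp
    qed (use h g e[of k] nonneg in \<open>auto simp: less_imp_le\<close>)
    also have "(1 / h 0 * (4 powr p / e k)) powr (1 / p) = (1 / h 0) powr (1 / p) * (4 * e k powr (- 1 / p))"
      using e[of k] h by (simp only: powr_mult[of "1 / h 0"] inc[OF e(1)])
    also have "4 * ((1 / h 0) powr (1 / p) * (4 * e k powr (- 1 / p))) * (e k powr (1 / p) * \<beta> k)
      = 16 * (e k powr (- 1 / p) * e k powr (1 / p)) * (1 / h 0) powr (1 / p) * \<beta> k" by (simp add: mult_ac)
    also have "\<dots> = 16 * (1 / h 0) powr (1 / p) * \<beta> k" using cancel[OF e(1)] by simp
    also have "\<dots> \<le> 16 * 4 * \<beta> k"
      using base[of "h 0"] h nonneg by (intro mult_right_mono mult_left_mono) (auto intro: order_trans)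
    finally show ?thesis by simp
  qed
  have incxy: "\<bar>(?a (Suc j) (Suc k) z - ?a j (Suc k) z) - (?a (Suc j) k z - ?a j k z)\<bar> \<le> 64 * \<gamma> j k" for j k z
  proof -
    have "\<bar>(?a (Suc j) (Suc k) z - ?a j (Suc k) z) - (?a (Suc j) k z - ?a j k z)\<bar>
      \<le> 4 * (4 powr p / d j * (4 powr p / e k)) powr (1 / p) * (d j powr (1 / p) * e k powr (1 / p) * \<gamma> j k)"
    proof (rule increment_xy_abs_le)
      show "controls p (\<lambda>t. avg_weight (h (Suc j)) t - avg_weight (h j) t) (4 powr p / d j) 1 (d j)" using hc by (simp add: d_def)
      show "controls p (\<lambda>t. avg_weight (g (Suc k)) t - avg_weight (g k) t) (4 powr p / e k) 1 (e k)" using gc by (simp add: e_def)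
      show "mixed_modulus p f (d j) (e k) \<le> ennreal (d j powr (1 / p) * e k powr (1 / p) * \<gamma> j k)"
        using mixed_eq by simp
    qed (use h g d[of j] e[of k] nonneg in \<open>auto simp: less_imp_le\<close>)
    also have "(4 powr p / d j * (4 powr p / e k)) powr (1 / p) = 4 * d j powr (- 1 / p) * (4 * e k powr (- 1 / p))"
      using d[of j] e[of k] by (simp only: powr_mult[of "4 powr p / d j"] inc[OF d(1)] inc[OF e(1)])
    also have "4 * (4 * d j powr (- 1 / p) * (4 * e k powr (- 1 / p))) * (d j powr (1 / p) * e k powr (1 / p) * \<gamma> j k)
      = 64 * (d j powr (- 1 / p) * d j powr (1 / p)) * (e k powr (- 1 / p) * e k powr (1 / p)) * \<gamma> j k" by (simp add: mult_ac)
    also have "\<dots> = 64 * \<gamma> j k" using cancel[OF d(1)] cancel[OF e(1)] by simp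
    finally show ?thesis .
  qed
  have S64: "(\<Sum>j<N. 64 * \<alpha> j) + (\<Sum>k<N. 64 * \<beta> k) + (\<Sum>j<N. \<Sum>k<N. 64 * \<gamma> j k) \<le> 64 * S" for N
  proof -
    have "(\<Sum>j<N. 64 * \<alpha> j) + (\<Sum>k<N. 64 * \<beta> k) + (\<Sum>j<N. \<Sum>k<N. 64 * \<gamma> j k)
        = 64 * ((\<Sum>j<N. \<alpha> j) + (\<Sum>k<N. \<beta> k) + (\<Sum>j<N. \<Sum>k<N. \<gamma> j k))"
      by (simp only: sum_distrib_left distrib_left)
    also have "\<dots> \<le> 64 * S" using S[of N] by (rule mult_left_mono) simp
    finally show ?thesis .
  qed
  have cont: "continuous_on UNIV (?a n n)" for n
    using h(1) g(1) by (intro box_average_continuous small) auto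
  obtain G where G: "continuous_on UNIV G" "\<And>z. (\<lambda>n. ?a n n z) \<longlonglongrightarrow> G z" "\<And>z. \<bar>G z - ?a 0 0 z\<bar> \<le> 64 * S"
    by (rule diagonal_limit[where a = ?a, OF incx incy incxy S64 cont]) blast
  have ae: "AE z in lborel. f z = G z"
    using ae_limit_eq[OF h(1) g(1) h(2) g(2) small G(2)] by simp
  define W where "W = enn2real (Lp_norm p f)"
  have W: "Lp_norm p f = ennreal W" using fin by (simp add: W_def Lp_norm_eq_power_integral)
  have W0: "W \<ge> 0" by (simp add: W_def)
  have a0: "\<bar>?a 0 0 z\<bar> \<le> 64 * W" for z
  proof -
    have "power_integral p f \<le> ennreal (W powr p)" by (rule power_integral_le[OF p _ W0]) (simp add: W)
    then have "\<bar>?a 0 0 z\<bar> \<le> 4 * (1 / h 0 * (1 / g 0)) powr (1 / p) * W"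
      using h g W0 by (intro box_average_abs_le) auto
    also have "(1 / h 0 * (1 / g 0)) powr (1 / p) = (1 / h 0) powr (1 / p) * (1 / g 0) powr (1 / p)"
      by (rule powr_mult)
    also have "4 * \<dots> * W \<le> 4 * (2 * 2) * W"
      using base[of "h 0"] base[of "g 0"] h g W0 by (intro mult_right_mono mult_left_mono mult_mono) auto
    also have "\<dots> \<le> 64 * W" using W0 by simp
    finally show ?thesis .
  qed
  have S0: "S \<ge> 0" by (simp add: S_def)
  define q where "q = 1 / (p * conj_exp p)"
  have pq: "p * conj_exp p > 0" using p by (simp add: conj_exp_def)
  \<comment> \<open>This is where the factors \<open>1 / (p p')\<close> come from.\<close>
  have c_le: "c \<le> ennreal (3 * q)"
  proof -
    have "1 / ln K \<le> 1 / (p * conj_exp p / 3)" using lnK pq by (intro divide_left_mono) auto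
    then show ?thesis unfolding c_def q_def by (intro ennreal_leI) simp
  qed
  have q0: "q \<ge> 0" using pq by (simp add: q_def)
  have bound: "ennreal \<bar>G z\<bar> \<le> ennreal 576 * (Lp_norm p f + ennreal q * J_int p f + ennreal (q\<^sup>2) * I_int p f)" for z
  proof -
    have "\<bar>G z\<bar> \<le> 64 * (W + S)" using G(3)[of z] a0[of z] by (simp add: abs_le_iff)
    then have "ennreal \<bar>G z\<bar> \<le> ennreal (64 * (W + S))" by (rule ennreal_leI)
    also have "\<dots> = 64 * (Lp_norm p f + T)" using W0 S0 by (simp add: W TS ennreal_mult)
    also have "\<dots> \<le> 64 * (Lp_norm p f + (2 * (c * J_int p f) + c * (c * I_int p f)))"
      using uv unfolding T_def by (intro mult_left_mono add_left_mono) auto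
    \<comment> \<open>The largest of the numerical factors 1, 6 and 9 is the square of 3, from the mixed term.\<close>
    also have "\<dots> \<le> 64 * (9 * Lp_norm p f + (2 * (ennreal (3 * q) * J_int p f) + ennreal (3 * q) * (ennreal (3 * q) * I_int p f)))"
    proof (intro mult_left_mono add_mono mult_mono c_le)
      show "Lp_norm p f \<le> 9 * Lp_norm p f" using mult_right_mono[of 1 9 "Lp_norm p f"] by simp
    qed auto
    also have "2 * (ennreal (3 * q) * J_int p f) = 6 * (ennreal q * J_int p f)"
      using q0 by (simp add: ennreal_mult mult.assoc[symmetric])
    also have "\<dots> \<le> 9 * (ennreal q * J_int p f)" by (intro mult_right_mono) auto
    also have "ennreal (3 * q) * (ennreal (3 * q) * I_int p f) = 9 * (ennreal (q\<^sup>2) * I_int p f)"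
    proof -
      have "ennreal (3 * q) * ennreal (3 * q) = ennreal (9 * q\<^sup>2)" using q0 by (simp add: ennreal_mult[symmetric] power2_eq_square)
      also have "\<dots> = 9 * ennreal (q\<^sup>2)" by (simp add: ennreal_mult)
      finally show ?thesis by (simp add: mult.assoc[symmetric])
    qed
    also have "64 * (9 * Lp_norm p f + (9 * (ennreal q * J_int p f) + 9 * (ennreal (q\<^sup>2) * I_int p f)))
       = ennreal 576 * (Lp_norm p f + ennreal q * J_int p f + ennreal (q\<^sup>2) * I_int p f)"
      by (simp add: distrib_left mult.assoc[symmetric] add.assoc)
    finally show ?thesis by (simp add: add_mono mult_left_mono)
  qed
  show ?thesis using G(1) ae bound unfolding q_def by blast
qed

end

section \<open>Passage to Lebesgue measurable functions\<close>

lemma Lp_norm_cong_AE: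
  assumes "AE z in lborel. f z = g z"
  shows "Lp_norm p f = Lp_norm p g"
proof -
  have "power_integral p f = power_integral p g"
    unfolding power_integral_def using assms by (intro nn_integral_cong_AE) auto
  then show ?thesis by (simp add: Lp_norm_eq_power_integral)
qed

lemma modulus_cong_AE:
  assumes "AE z in lborel. f z = g z"
  shows "modulus p f = modulus p g"
proof
  fix \<delta>
  have "Lp_norm p (diff h f) = Lp_norm p (diff h g)" for h
    by (rule Lp_norm_cong_AE, use assms AE_lborel_translate[OF assms, of h] in eventually_elim) (simp add: diff_def)
  then show "modulus p f \<delta> = modulus p g \<delta>" by (simp add: modulus_def)
qed

lemma mixed_modulus_cong_AE:
  assumes "AE z in lborel. f z = g z"
  shows "mixed_modulus p f = mixed_modulus p g"
proof (intro ext)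
  fix u v
  have "Lp_norm p (mixed_diff s t f) = Lp_norm p (mixed_diff s t g)" for s t
    by (rule Lp_norm_cong_AE, use assms AE_lborel_translate[OF assms, of "(s, t)"]
        AE_lborel_translate[OF assms, of "(s, 0)"] AE_lborel_translate[OF assms, of "(0, t)"] in eventually_elim)
      (auto simp: mixed_diff_def)
  then show "mixed_modulus p f u v = mixed_modulus p g u v" by (simp add: mixed_modulus_def)
qed

text \<open>A Borel function that agrees with \<open>f\<close> almost everywhere may fail to be periodic; extending its restriction to the half-open
unit square periodically repairs this.\<close>

lemma periodic_borel_version:
  assumes f: "f \<in> borel_measurable lebesgue" and per: "periodic f"
  obtains f0 :: "real \<times> real \<Rightarrow> real" where "f0 \<in> borel_measurable borel" "periodic f0" "AE z in lborel. f z = f0 z"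
proof -
  obtain g where g: "g \<in> borel_measurable lborel" "AE z in lborel. f z = g z"
    using completion_ex_borel_measurable_real[OF f] by blast
  define f0 where "f0 = (\<lambda>z. g (frac (fst z), frac (snd z)))"
  note [measurable] = fst_borel snd_borel
  have [measurable]: "g \<in> borel_measurable borel" using g(1) by simp
  have "f0 \<in> borel_measurable borel"
    unfolding f0_def frac_def by measurable
  moreover have per0: "periodic f0" by (simp add: periodic_def f0_def frac_1_eq)
  moreover have "AE z in lborel. f z = f0 z"
  proof (rule AE_periodic)
    show "periodic (\<lambda>z. f z = f0 z)" using per per0 by (simp add: periodic_def)
    show "AE z in lborel. z \<in> {0..<1} \<times> {0..<1} \<longrightarrow> f z = f0 z"
      using g(2) by eventually_elim (auto simp: f0_def frac_eq[THEN iffD2])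
  qed
  ultimately show thesis by (rule that)
qed

theorem theorem3p1:
  shows "\<exists>A::real. A > 0 \<and>
    (\<forall>(p::real) (f :: real \<times> real \<Rightarrow> real).
      1 < p \<longrightarrow> f \<in> Lp_periodic p \<longrightarrow> J_int p f < \<infinity> \<longrightarrow> I_int p f < \<infinity> \<longrightarrow>
        (\<exists>g. continuous_on UNIV g \<and> (AE z in lebesgue. f z = g z)) \<and>
        Linf_norm f \<le> ennreal A *
          (Lp_norm p f + ennreal (1 / (p * conj_exp p)) * J_int p f
             + ennreal ((1 / (p * conj_exp p))\<^sup>2) * I_int p f))"
proof (intro exI[of _ 576] conjI allI impI)
  fix p :: real and f :: "real \<times> real \<Rightarrow> real"
  assume p: "1 < p" and f: "f \<in> Lp_periodic p" and J: "J_int p f < \<infinity>" and I: "I_int p f < \<infinity>"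
  let ?B = "ennreal 576 * (Lp_norm p f + ennreal (1 / (p * conj_exp p)) * J_int p f
             + ennreal ((1 / (p * conj_exp p))\<^sup>2) * I_int p f)"
  have fm: "f \<in> borel_measurable lebesgue" and per: "periodic f" and fin: "Lp_norm p f < \<infinity>"
    using f by (auto simp: Lp_periodic_def periodic_def)
  obtain f0 where f0: "f0 \<in> borel_measurable borel" "periodic f0" and ae: "AE z in lborel. f z = f0 z"
    using periodic_borel_version[OF fm per] by blast
  note same = Lp_norm_cong_AE[OF ae] modulus_cong_AE[OF ae] mixed_modulus_cong_AE[OF ae]
  have JI: "J_int p f = J_int p f0" "I_int p f = I_int p f0" by (simp_all add: J_int_def I_int_def same)
  have "power_integral p f0 < \<infinity>"
    using fin unfolding same by (auto simp: Lp_norm_eq_power_integral less_top split: if_splits)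
  then interpret periodic_Lp p f0 using p f0 by unfold_locales
  obtain G where G: "continuous_on UNIV G" "AE z in lborel. f0 z = G z" "\<And>z. ennreal \<bar>G z\<bar> \<le> ?B"
    using continuous_representative J I unfolding JI same by blast
  have "AE z in lborel. f z = G z" using ae G(2) by eventually_elim simp
  then have aeG: "AE z in lebesgue. f z = G z" by (rule AE_completion)
  then show "\<exists>g. continuous_on UNIV g \<and> (AE z in lebesgue. f z = g z)" using G(1) by blast
  show "Linf_norm f \<le> ?B"
    unfolding Linf_norm_def
  proof (rule esssup_I)
    show "(\<lambda>z. ennreal \<bar>f z\<bar>) \<in> borel_measurable (lebesgue_on unit_square)"
      using fm by (intro measurable_restrict_space1) measurable
    have "unit_square \<inter> space lebesgue \<in> sets lebesgue"
      using borel_Times[of "{0..1::real}" "{0..1::real}"] by (auto intro!: sets_completionI_sets)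
    then show "AE z in lebesgue_on unit_square. ennreal \<bar>f z\<bar> \<le> ?B"
      using aeG G(3) by (subst AE_restrict_space_iff) (auto elim!: eventually_mono)
  qed
qed simp

end
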